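(* Write $L^{\pm}(z)$ as a block matrix $$L^{\pm}(z)=\begin{pmatrix}L^{\pm}(z)_{11}&L^{\pm}(z)_{12}\\ L^{\pm}(z)_{21}&L^{\pm}(z)_{22}\end{pmatrix}$$ such that $L^{\pm}(z)_{11}$ and $L^{\pm}(z)_{22}$ are submatrices of size $k\times k$ and $(M+N-k)\times(M+N-k)$ respectively. Then, in $\mathrm{U}_q(\widehat{\mathfrak{gl}}_{M|N})$, $$B_q(L^{\pm}(z))=B_q(L^{\pm}(z)_{11})\,B_{q}\bigl(L^{\pm}(zq^{2k})_{22}-L^{\pm}(zq^{2k})_{21}\,L^{\pm}(zq^{2k})_{11}^{-1}\,L^{\pm}(zq^{2k})_{12}\bigr)\quad\text{for }k<M,$$ and $$B_q(L^{\pm}(z))=B_q(L^{\pm}(z)_{11})\,B_{q}\bigl(L^{\pm}(zq^{4M-2k})_{22}-L^{\pm}(zq^{4M-2k})_{21}\,L^{\pm}(zq^{4M-2k})_{11}^{-1}\,L^{\pm}(zq^{4M-2k})_{12}\bigr)\quad\text{for }k\ge M.$$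
   Context: Let $M,N\ge 0$ be integers with $M\ne N$. The base field is $\mathbb{C}(q)$ ($q$ is not a root of unity). For $1\le i\le M+N$ put $\bar i=0$ if $i\le M$ and $\bar i=1$ if $i>M$, and $q_i=q^{1-2\bar i}$. $\mathbb{C}^{M|N}$ is the superspace with basis $e_i$ of parity $\bar i$, and $E_{ij}\in\mathrm{End}\,\mathbb{C}^{M|N}$ are the matrix units (of parity $\bar i+\bar j$). Tensor products of superalgebras are graded: $(a\otimes b)(a'\otimes b')=(-1)^{|b||a'|}aa'\otimes bb'$. Put $R(z,w)=\sum_i (zq_i-wq_i^{-1})E_{ii}\otimes E_{ii}+(z-w)\sum_{i\ne j}E_{ii}\otimes E_{jj}+z\sum_{i<j}(q_j-q_j^{-1})E_{ij}\otimes E_{ji}+w\sum_{i>j}(q_j-q_j^{-1})E_{ij}\otimes E_{ji}$, $\overline R(x)=R(x,1)/(xq-q^{-1})$ and $R(x)=f(x)\overline R(x)$, where $f(x)=1+\sum_{k\ge1}f_kx^{-k}$ is the formal series uniquely determined by $f(xq^{2N-2M})=f(x)\frac{(1-xq^{-2})(1-xq^{2N-2M+2})}{(1-x)(1-xq^{2N-2M})}$; $R(x)$ is expanded in powers of $x^{-1}$. $\mathrm{U}_q(\widehat{\mathfrak{gl}}_{M|N})$ is the superalgebra over $\mathbb{C}(q)$ generated by $l_{ij}^{\pm(r)}$ ($1\le i,j\le M+N$, $r\ge 0$, parity $\bar i+\bar j$) and an invertible central even element $q^c$. Put $l_{ij}^{\pm}(z)=\sum_{r\ge0}l_{ij}^{\pm(r)}z^{\mp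 r}$, $L^{\pm}(z)=\sum_{i,j}l^{\pm}_{ij}(z)\otimes E_{ij}$, and let $L_a^\pm(z)$ denote $L^\pm(z)$ acting in the $a$-th copy of $\mathrm{End}\,\mathbb{C}^{M|N}$. The defining relations are: $l_{ji}^{+(0)}=l_{ij}^{-(0)}=0$ for $i<j$; $l_{ii}^{-(0)}l_{ii}^{+(0)}=l_{ii}^{+(0)}l_{ii}^{-(0)}=1$; $R(z/w)L_1^{\pm}(z)L_2^{\pm}(w)=L_2^{\pm}(w)L_1^{\pm}(z)R(z/w)$; $R(zq^{c}/w)L_1^{+}(z)L_2^{-}(w)=L_2^{-}(w)L_1^{+}(z)R(zq^{-c}/w)$. Matrices (including rectangular blocks) are multiplied and inverted with the graded product coming from the graded tensor product with the matrix superalgebra, $(AB)_{ij}=\sum_k(-1)^{(\bar i+\bar k)(\bar k+\bar j)}A_{ik}B_{kj}$; blocks inherit the index parities. Berezinians: for a matrix $A(z)$ of size $m+n$ whose first $m$ indices are even and last $n$ are odd, $$B_q(A(z))=\sum_{\sigma\in S_m}(-q)^{-l(\sigma)}A(z)_{\sigma(1),1}\cdots A(zq^{2m-2})_{\sigma(m),m}\sum_{\tau\in S_n}(-q)^{-l(\tau)}\bigl(A(zq^{2m-2})^{-1}\bigr)_{m+1,m+\tau(1)}\cdots\bigl(A(zq^{2m-2n})^{-1}\bigr)_{m+n,m+\tau(n)},$$ with arguments $zq^{2j-2}$ in the $j$-th factor of the first product and $zq^{2m-2k}$ in the $k$-th factor of the second; $l$ is the length of a permutation, and an empty sum over $S_0$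 equals $1$. Here $(m,n)=(M,N)$ for $L^\pm(z)$. For $k<M$, $(m,n)=(k,0)$ for $L^\pm(z)_{11}$ and $(M-k,N)$ for the second Berezinian; for $k\ge M$, $(m,n)=(M,k-M)$ for $L^\pm(z)_{11}$ and $(0,M+N-k)$ for the second Berezinian. In each case $B_q(A(zq^{a}))$ means $B_q(A(z))$ with $z$ replaced by $zq^{a}$. *)

theory Defs
  imports
    "HOL-Computational_Algebra.Computational_Algebra"
    "HOL-Combinatorics.Permutations"
    "HOL-Library.Poly_Mapping"
    "HOL-Library.Type_Length"
begin

section \<open>The base field, parities and the scalar series \<open>f\<close>\<close>

text \<open>The base field \<open>\<complex>(q)\<close>, with \<open>q\<close> the indeterminate.\<close>

type_synonym cq = "complex poly fract"

definition qv :: cq where "qv = Fract [:0, 1:] 1"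

definition par :: "nat \<Rightarrow> nat \<Rightarrow> nat" where
  "par M i = (if i \<le> M then 0 else 1)"

definition qi :: "nat \<Rightarrow> nat \<Rightarrow> cq" where
  "qi M i = qv powi (1 - 2 * int (par M i))"

text \<open>
  Series in \<open>x\<^sup>-\<^sup>1\<close> are Laurent series in the variable \<open>y = x\<^sup>-\<^sup>1\<close>; so \<open>x\<close> itself is \<open>fls_X_inv\<close>,
  division in the field of Laurent series is expansion in powers of \<open>x\<^sup>-\<^sup>1\<close>, and a series
  \<open>f(x) = 1 + \<Sum> f\<^sub>k x\<^sup>-\<^sup>k\<close> is a power series with coefficients \<open>f\<^sub>k\<close>.
\<close>

definition xv :: "cq fls" where "xv = fls_X_inv"

definition xshift :: "int \<Rightarrow> cq fps \<Rightarrow> cq fps" where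
  "xshift a f = Abs_fps (\<lambda>n. qv powi (- a * int n) * fps_nth f n)" \<comment> \<open>\<open>f(x q\<^sup>a)\<close>\<close>

definition is_fser :: "nat \<Rightarrow> nat \<Rightarrow> cq fps \<Rightarrow> bool" where
  "is_fser M N f \<longleftrightarrow> fps_nth f 0 = 1 \<and>
    (let a = 2 * int N - 2 * int M; Q = (\<lambda>e. fls_const (qv powi e)) in
      fps_to_fls (xshift a f) =
        fps_to_fls f * (((1 - xv * Q (- 2)) * (1 - xv * Q (a + 2))) / ((1 - xv) * (1 - xv * Q a))))"

definition fser :: "nat \<Rightarrow> nat \<Rightarrow> cq fps" where
  "fser M N = (THE f. is_fser M N f)"


section \<open>The \<open>R\<close>-matrix\<close>

text \<open>
  An element \<open>\<Sum> a\<^sub>i\<^sub>j\<^sub>k\<^sub>l \<otimes> E\<^sub>i\<^sub>j \<otimes> E\<^sub>k\<^sub>l\<close> is stored as its coefficient function \<open>i j k l \<mapsto> a\<^sub>i\<^sub>j\<^sub>k\<^sub>l\<close>;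
  only indices in \<open>{1..M+N}\<close> matter.
\<close>

type_synonym 'a tens = "nat \<Rightarrow> nat \<Rightarrow> nat \<Rightarrow> nat \<Rightarrow> 'a"

definition Rzw :: "nat \<Rightarrow> cq fls \<Rightarrow> cq fls \<Rightarrow> cq fls tens" where
  "Rzw M z w i j k l =
    (if i = j \<and> k = l then
       (if i = k then z * fls_const (qi M i) - w * fls_const (inverse (qi M i)) else z - w)
     else if i = l \<and> j = k then
       (if i < j then z else w) * fls_const (qi M j - inverse (qi M j))
     else 0)"

text \<open>\<open>Rcoef M N n\<close> is the coefficient of \<open>x\<^sup>-\<^sup>n\<close> in \<open>R(x) = f(x) R(x,1) / (x q - q\<^sup>-\<^sup>1)\<close>.\<close>

definition Rcoef :: "nat \<Rightarrow> nat \<Rightarrow> nat \<Rightarrow> cq tens" where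
  "Rcoef M N n i j k l =
    fls_nth (fps_to_fls (fser M N) *
      (Rzw M xv 1 i j k l / (xv * fls_const qv - fls_const (inverse qv)))) (int n)"

text \<open>
  The graded product on \<open>A \<otimes> End \<otimes> End\<close>, for even elements: the coefficient of
  \<open>E\<^sub>i\<^sub>j \<otimes> E\<^sub>k\<^sub>l\<close> then has the parity of \<open>E\<^sub>i\<^sub>j \<otimes> E\<^sub>k\<^sub>l\<close>. Hence
  \<open>(a \<otimes> X)(b \<otimes> Y) = (-1)\<^bsup>|X||b|\<^esup> ab \<otimes> XY\<close> with \<open>|b| = |Y|\<close>, and
  \<open>(E\<^sub>i\<^sub>j \<otimes> E\<^sub>k\<^sub>l)(E\<^sub>j\<^sub>m \<otimes> E\<^sub>l\<^sub>n) = (-1)\<^bsup>|E\<^sub>k\<^sub>l||E\<^sub>j\<^sub>m|\<^esup> E\<^sub>i\<^sub>m \<otimes> E\<^sub>k\<^sub>n\<close>.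
\<close>

definition tmul :: "nat \<Rightarrow> nat \<Rightarrow> 'a::ring_1 tens \<Rightarrow> 'a tens \<Rightarrow> 'a tens" where
  "tmul M D A B i m k n = (\<Sum>j = 1..D. \<Sum>l = 1..D.
     (- 1) ^ ((par M i + par M j + par M k + par M l) * (par M j + par M m + par M l + par M n)
              + (par M k + par M l) * (par M j + par M m))
     * A i j k l * B j m l n)"

definition leg1 :: "(nat \<Rightarrow> nat \<Rightarrow> 'a::zero) \<Rightarrow> 'a tens" where
  "leg1 a i j k l = (if k = l then a i j else 0)"

definition leg2 :: "(nat \<Rightarrow> nat \<Rightarrow> 'a::zero) \<Rightarrow> 'a tens" where
  "leg2 a i j k l = (if i = j then a k l else 0)"


section \<open>The free algebra on the generators\<close>

text \<open>The integers \<open>M, N \<ge> 0\<close> are the lengths of the type parameters \<open>'m\<close>, \<open>'n\<close>.\<close>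

datatype pm = Pos | Neg

datatype rawgen = RL pm nat nat nat | RQ | RQinv

typedef (overloaded) ('m::len0, 'n::len0) gen =
  "{RL s i j r | s i j r. i \<in> {1..LENGTH('m) + LENGTH('n)} \<and> j \<in> {1..LENGTH('m) + LENGTH('n)}}
    \<union> {RQ, RQinv}"
  by auto

text \<open>Words, i.e. the free monoid, written additively as required by \<open>Poly_Mapping\<close>.\<close>

datatype 'a fmon = FMon (letters: "'a list")

instantiation fmon :: (type) monoid_add
begin
definition "0 = FMon []"
definition "u + v = FMon (letters u @ letters v)"
instance by standard (simp_all add: zero_fmon_def plus_fmon_def)
end

type_synonym ('m, 'n) free = "('m, 'n) gen fmon \<Rightarrow>\<^sub>0 cq"

definition fsc :: "cq \<Rightarrow> ('m::len0, 'n::len0) free" where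
  "fsc c = Poly_Mapping.single 0 c"

definition fgen :: "rawgen \<Rightarrow> ('m::len0, 'n::len0) free" where
  "fgen g = Poly_Mapping.single (FMon [Abs_gen g]) 1"

abbreviation fl :: "pm \<Rightarrow> nat \<Rightarrow> nat \<Rightarrow> nat \<Rightarrow> ('m::len0, 'n::len0) free" where
  "fl s i j r \<equiv> fgen (RL s i j r)"

text \<open>
  \<open>Lcoef s e i j\<close> is the coefficient of \<open>z\<^sup>e\<close> in \<open>l\<^sub>i\<^sub>j\<^sup>\<plusminus>(z) = \<Sum>\<^sub>r l\<^sub>i\<^sub>j\<^bsup>\<plusminus>(r)\<^esup> z\<^bsup>\<mp>r\<^esup>\<close>.
\<close>

definition Lcoef :: "pm \<Rightarrow> int \<Rightarrow> nat \<Rightarrow> nat \<Rightarrow> ('m::len0, 'n::len0) free" where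
  "Lcoef s e i j =
    (case s of Pos \<Rightarrow> (if e \<le> 0 then fl s i j (nat (- e)) else 0)
             | Neg \<Rightarrow> (if e \<ge> 0 then fl s i j (nat e) else 0))"

text \<open>
  \<open>RLL u s t a b\<close> is the coefficient of \<open>z\<^sup>a w\<^sup>b\<close> in \<open>R(z u\<^sup>-\<^sup>1/w) L\<^sub>1\<^sup>s(z) L\<^sub>2\<^sup>t(w)\<close>, and \<open>LLR u s t a b\<close>
  that in \<open>L\<^sub>2\<^sup>t(w) L\<^sub>1\<^sup>s(z) R(z u\<^sup>-\<^sup>1/w)\<close>, for \<open>u\<close> central; the term \<open>x\<^sup>-\<^sup>n\<close> of \<open>R\<close> contributes
  \<open>u\<^sup>n z\<^sup>-\<^sup>n w\<^sup>n\<close>. For \<open>(s,t) = (+,+), (-,-), (+,-)\<close> the terms with \<open>n > \<bar>a\<bar> + \<bar>b\<bar>\<close> vanish, because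
  \<open>Lcoef Pos (a + n) = 0\<close> or \<open>Lcoef Neg (b - n) = 0\<close>.
\<close>

definition RLL :: "('m::len0, 'n::len0) free \<Rightarrow> pm \<Rightarrow> pm \<Rightarrow> int \<Rightarrow> int \<Rightarrow> ('m, 'n) free tens" where
  "RLL u s t a b i j k l = (let M = LENGTH('m); N = LENGTH('n); D = M + N in
    \<Sum>n \<le> nat (\<bar>a\<bar> + \<bar>b\<bar>).
      tmul M D (\<lambda>i j k l. u ^ n * fsc (Rcoef M N n i j k l))
        (tmul M D (leg1 (Lcoef s (a + int n))) (leg2 (Lcoef t (b - int n)))) i j k l)"

definition LLR :: "('m::len0, 'n::len0) free \<Rightarrow> pm \<Rightarrow> pm \<Rightarrow> int \<Rightarrow> int \<Rightarrow> ('m, 'n) free tens" where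
  "LLR u s t a b i j k l = (let M = LENGTH('m); N = LENGTH('n); D = M + N in
    \<Sum>n \<le> nat (\<bar>a\<bar> + \<bar>b\<bar>).
      tmul M D (tmul M D (leg2 (Lcoef t (b - int n))) (leg1 (Lcoef s (a + int n))))
        (\<lambda>i j k l. u ^ n * fsc (Rcoef M N n i j k l)) i j k l)"


section \<open>The algebra \<open>U\<^sub>q\<close> of affine \<open>gl(M|N)\<close>\<close>

text \<open>
  The congruence generated by the defining relations. The scalars are already central in the free
  algebra, so this is equality modulo the two-sided ideal generated by the relations.
\<close>

inductive uq_eq :: "('m::len0, 'n::len0) free \<Rightarrow> ('m, 'n) free \<Rightarrow> bool" where
  refl: "uq_eq x x"
| sym: "uq_eq x y \<Longrightarrow> uq_eq y x"
| trans: "uq_eq x y \<Longrightarrow> uq_eq y z \<Longrightarrow> uq_eq x z"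
| add: "uq_eq x y \<Longrightarrow> uq_eq x' y' \<Longrightarrow> uq_eq (x + x') (y + y')"
| mult: "uq_eq x y \<Longrightarrow> uq_eq x' y' \<Longrightarrow> uq_eq (x * x') (y * y')"
| Q_Qinv: "uq_eq (fgen RQ * fgen RQinv) 1"
| Qinv_Q: "uq_eq (fgen RQinv * fgen RQ) 1"
| Q_central: "i \<in> {1..LENGTH('m) + LENGTH('n)} \<Longrightarrow> j \<in> {1..LENGTH('m) + LENGTH('n)} \<Longrightarrow>
    uq_eq (fgen RQ * fl s i j r) (fl s i j r * fgen RQ)"
| lower0: "i \<in> {1..LENGTH('m) + LENGTH('n)} \<Longrightarrow> j \<in> {1..LENGTH('m) + LENGTH('n)} \<Longrightarrow> i < j \<Longrightarrow>
    uq_eq (fl Pos j i 0) 0"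
| upper0: "i \<in> {1..LENGTH('m) + LENGTH('n)} \<Longrightarrow> j \<in> {1..LENGTH('m) + LENGTH('n)} \<Longrightarrow> i < j \<Longrightarrow>
    uq_eq (fl Neg i j 0) 0"
| diag_np: "i \<in> {1..LENGTH('m) + LENGTH('n)} \<Longrightarrow> uq_eq (fl Neg i i 0 * fl Pos i i 0) 1"
| diag_pn: "i \<in> {1..LENGTH('m) + LENGTH('n)} \<Longrightarrow> uq_eq (fl Pos i i 0 * fl Neg i i 0) 1"
| RLL_same: "{i, j, k, l} \<subseteq> {1..LENGTH('m) + LENGTH('n)} \<Longrightarrow>
    uq_eq (RLL 1 s s a b i j k l) (LLR 1 s s a b i j k l)"
| RLL_mixed: "{i, j, k, l} \<subseteq> {1..LENGTH('m) + LENGTH('n)} \<Longrightarrow>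
    uq_eq (RLL (fgen RQinv) Pos Neg a b i j k l) (LLR (fgen RQ) Pos Neg a b i j k l)"

lemma equivp_uq_eq: "equivp uq_eq"
  by (rule equivpI) (auto simp: reflp_def symp_def transp_def intro: uq_eq.refl uq_eq.sym uq_eq.trans)

quotient_type (overloaded) ('m, 'n) Uq = "('m::len0, 'n::len0) free" / uq_eq
  by (rule equivp_uq_eq)

text \<open>
  Type class \<open>ring_1\<close> includes \<open>0 \<noteq> 1\<close>, which is shown with the character sending \<open>L\<^sup>\<plusminus>(z)\<close> to the
  identity matrix and \<open>q\<^sup>c\<close> to \<open>1\<close>.
\<close>

definition gen_char :: "('m::len0, 'n::len0) gen \<Rightarrow> cq" where
  "gen_char g = (case Rep_gen g of RL s i j r \<Rightarrow> of_bool (i = j \<and> r = 0) | _ \<Rightarrow> 1)"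

definition free_char :: "('m::len0, 'n::len0) free \<Rightarrow> cq" where
  "free_char p = (\<Sum>w\<in>Poly_Mapping.keys p. Poly_Mapping.lookup p w * prod_list (map gen_char (letters w)))"

lemma free_char_superset:
  assumes "finite S" "Poly_Mapping.keys p \<subseteq> S"
  shows "free_char p = (\<Sum>w\<in>S. Poly_Mapping.lookup p w * prod_list (map gen_char (letters w)))"
  unfolding free_char_def
  by (rule sum.mono_neutral_left) (use assms in \<open>auto simp: in_keys_iff\<close>)

lemma free_char_add: "free_char (p + r) = free_char p + free_char r"
proof -
  let ?S = "Poly_Mapping.keys p \<union> Poly_Mapping.keys r"
  have "Poly_Mapping.keys (p + r) \<subseteq> ?S"
    by (rule Poly_Mapping.keys_add)
  then show ?thesis
    by (simp add: free_char_superset[of ?S] lookup_add distrib_right sum.distrib)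
qed

lemma free_char_0 [simp]: "free_char 0 = 0"
  by (simp add: free_char_def)

lemma free_char_single: "free_char (Poly_Mapping.single w c) = c * prod_list (map gen_char (letters w))"
  by (cases "c = 0") (simp_all add: free_char_def)

lemma free_induct [case_names zero plus]:
  fixes p :: "'b \<Rightarrow>\<^sub>0 'c::ab_group_add"
  assumes "P 0" and "\<And>k v f. P f \<Longrightarrow> P (Poly_Mapping.single k v + f)"
  shows "P p"
proof (induction p rule: update_induct)
  case (update f k v)
  have "Poly_Mapping.update k v f = Poly_Mapping.single k v + f"
    using update
    by (intro poly_mapping_eqI) (auto simp: lookup_update lookup_add lookup_single when_def in_keys_iff)
  then show ?case using assms update by simp
qed (use assms in auto)

lemma free_char_mult: "free_char (p * r) = free_char p * free_char r"
proof (induction p rule: free_induct)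
  case (plus k v f)
  have "free_char (Poly_Mapping.single k v * r) = free_char (Poly_Mapping.single k v) * free_char r"
    by (induction r rule: free_induct)
       (simp_all add: distrib_left free_char_add mult_single free_char_single plus_fmon_def mult_ac)
  then show ?case using plus by (simp add: distrib_right free_char_add)
qed simp

lemma free_char_1 [simp]: "free_char 1 = 1"
  by (simp flip: single_one add: free_char_single zero_fmon_def)

lemma free_char_uminus: "free_char (- p) = - free_char p"
  using free_char_add[of p "- p"] by (simp add: eq_neg_iff_add_eq_0 add.commute)

lemma free_char_power: "free_char (p ^ n) = free_char p ^ n"
  by (induction n) (simp_all add: free_char_mult)

lemma free_char_sum: "free_char (sum g A) = (\<Sum>x\<in>A. free_char (g x))"
  by (induction A rule: infinite_finite_induct) (simp_all add: free_char_add)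

lemma free_char_fsc: "free_char (fsc c) = c"
  by (simp add: fsc_def free_char_single zero_fmon_def)

lemma free_char_fgen:
  fixes g assumes "g \<in> {RL s i j r | s i j r. i \<in> {1..LENGTH('m) + LENGTH('n)} \<and>
    j \<in> {1..LENGTH('m) + LENGTH('n)}} \<union> {RQ, RQinv}"
  shows "free_char (fgen g :: ('m::len0, 'n::len0) free) =
    (case g of RL s i j r \<Rightarrow> of_bool (i = j \<and> r = 0) | _ \<Rightarrow> 1)"
proof -
  have "Rep_gen (Abs_gen g :: ('m, 'n) gen) = g"
    using assms by (rule Abs_gen_inverse)
  then show ?thesis by (simp add: fgen_def free_char_single gen_char_def)
qed

lemma free_char_tmul:
  "free_char (tmul M D A B i m k n) =
     tmul M D (\<lambda>i j k l. free_char (A i j k l)) (\<lambda>i j k l. free_char (B i j k l)) i m k n"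
  by (simp add: tmul_def free_char_sum free_char_mult free_char_power free_char_uminus)

lemma tmul_cong:
  assumes "\<And>i j k l. {i, j, k, l} \<subseteq> {1..D} \<Longrightarrow> A i j k l = A' i j k l"
    and "\<And>i j k l. {i, j, k, l} \<subseteq> {1..D} \<Longrightarrow> B i j k l = B' i j k l"
    and "{i, j, k, l} \<subseteq> {1..D}"
  shows "tmul M D A B i j k l = tmul M D A' B' i j k l"
  unfolding tmul_def using assms by (intro sum.cong) auto

definition tone :: "cq \<Rightarrow> cq tens" where
  "tone c i j k l = (if i = j \<and> k = l then c else 0)"

lemma tmul_tone:
  assumes "{i, j, k, l} \<subseteq> {1..D}"
  shows "tmul M D A (tone c) i j k l = A i j k l * c"
    and "tmul M D (tone c) A i j k l = c * A i j k l"
proof -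
  have ev: "(- 1) ^ ((a::nat) * (x + x + y + y) + b * (x + x)) = (1::cq)"
    "(- 1) ^ (((x::nat) + x + y + y) * a + (y + y) * b) = (1::cq)" for a b x y
    by (auto simp: uminus_power_if)
  have sum_if: "(\<Sum>x\<in>S. if P then h x else 0) = (if P then sum h S else (0::cq))" for S P and h :: "nat \<Rightarrow> cq"
    by simp
  have "tmul M D A (tone c) i j k l =
     (\<Sum>j' = 1..D. \<Sum>l' = 1..D. if j' = j then if l' = l then A i j k l * c else 0 else 0)"
    unfolding tmul_def tone_def
    by (intro sum.cong refl) (use ev in \<open>auto simp: ac_simps mult_2[symmetric]\<close>)
  also have "\<dots> = A i j k l * c" using assms by (simp add: sum_if)
  finally show "tmul M D A (tone c) i j k l = A i j k l * c" .
  have "tmul M D (tone c) A i j k l =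
     (\<Sum>j' = 1..D. \<Sum>l' = 1..D. if j' = i then if l' = k then c * A i j k l else 0 else 0)"
    unfolding tmul_def tone_def
    by (intro sum.cong refl) (use ev in \<open>auto simp: ac_simps mult_2[symmetric]\<close>)
  also have "\<dots> = c * A i j k l" using assms by (simp add: sum_if)
  finally show "tmul M D (tone c) A i j k l = c * A i j k l" .
qed

lemma free_char_Lcoef:
  assumes "i \<in> {1..LENGTH('m) + LENGTH('n)}" "j \<in> {1..LENGTH('m) + LENGTH('n)}"
  shows "free_char (Lcoef s e i j :: ('m::len0, 'n::len0) free) = of_bool (i = j \<and> e = 0)"
  using assms by (cases s) (auto simp: Lcoef_def free_char_fgen)

lemma tmul_legs:
  fixes D :: nat
  assumes "{i, j, k, l} \<subseteq> {1..D}"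
  defines "E c \<equiv> \<lambda>i j. if i = j then c else (0::cq)"
  shows "tmul M D (leg1 (E c)) (leg2 (E d)) i j k l = tone (c * d) i j k l"
    and "tmul M D (leg2 (E d)) (leg1 (E c)) i j k l = tone (c * d) i j k l"
proof -
  have legs: "leg1 (E c) = tone c" "leg2 (E d) = tone d"
    by (auto simp: leg1_def leg2_def tone_def E_def fun_eq_iff)
  show "tmul M D (leg1 (E c)) (leg2 (E d)) i j k l = tone (c * d) i j k l"
    and "tmul M D (leg2 (E d)) (leg1 (E c)) i j k l = tone (c * d) i j k l"
    unfolding legs using assms(1) by (simp_all add: tmul_tone) (simp_all add: tone_def)
qed

lemma free_char_RLL:
  fixes u :: "('m::len0, 'n::len0) free"
  assumes "{i, j, k, l} \<subseteq> {1..LENGTH('m) + LENGTH('n)}" "free_char u = 1"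
  shows "free_char (RLL u s t a b i j k l) =
      (\<Sum>n \<le> nat (\<bar>a\<bar> + \<bar>b\<bar>). Rcoef LENGTH('m) LENGTH('n) n i j k l * of_bool (a + int n = 0 \<and> b = int n))"
    and "free_char (LLR u s t a b i j k l) =
      (\<Sum>n \<le> nat (\<bar>a\<bar> + \<bar>b\<bar>). Rcoef LENGTH('m) LENGTH('n) n i j k l * of_bool (a + int n = 0 \<and> b = int n))"
proof -
  let ?D = "LENGTH('m) + LENGTH('n)" and ?M = "LENGTH('m)"
  let ?E = "\<lambda>c i j. if i = j then c else (0::cq)"
  let ?a = "\<lambda>n. of_bool (a + int n = 0)" and ?b = "\<lambda>n. of_bool (b - int n = 0)"
  have leg: "free_char (leg1 (Lcoef s e :: _ \<Rightarrow> _ \<Rightarrow> ('m, 'n) free) i j k l) =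
      leg1 (?E (of_bool (e = 0))) i j k l"
    "free_char (leg2 (Lcoef s e :: _ \<Rightarrow> _ \<Rightarrow> ('m, 'n) free) i j k l) =
      leg2 (?E (of_bool (e = 0))) i j k l"
    if "{i, j, k, l} \<subseteq> {1..?D}" for s e i j k l
    using that by (auto simp: leg1_def leg2_def free_char_Lcoef)
  have t1: "free_char (tmul ?M ?D (leg1 (Lcoef s (a + int n) :: _ \<Rightarrow> _ \<Rightarrow> ('m, 'n) free))
        (leg2 (Lcoef t (b - int n))) i j k l) = tone (?a n * ?b n) i j k l"
    if "{i, j, k, l} \<subseteq> {1..?D}" for n i j k l
  proof -
    have "free_char (tmul ?M ?D (leg1 (Lcoef s (a + int n) :: _ \<Rightarrow> _ \<Rightarrow> ('m, 'n) free))
        (leg2 (Lcoef t (b - int n))) i j k l) = tmul ?M ?D (leg1 (?E (?a n))) (leg2 (?E (?b n))) i j k l"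
      unfolding free_char_tmul by (rule tmul_cong[OF _ _ that]) (rule leg; assumption)+
    also have "\<dots> = tone (?a n * ?b n) i j k l"
      by (rule tmul_legs(1)[OF that])
    finally show ?thesis .
  qed
  have t2: "free_char (tmul ?M ?D (leg2 (Lcoef t (b - int n) :: _ \<Rightarrow> _ \<Rightarrow> ('m, 'n) free))
        (leg1 (Lcoef s (a + int n))) i j k l) = tone (?a n * ?b n) i j k l"
    if "{i, j, k, l} \<subseteq> {1..?D}" for n i j k l
  proof -
    have "free_char (tmul ?M ?D (leg2 (Lcoef t (b - int n) :: _ \<Rightarrow> _ \<Rightarrow> ('m, 'n) free))
        (leg1 (Lcoef s (a + int n))) i j k l) = tmul ?M ?D (leg2 (?E (?b n))) (leg1 (?E (?a n))) i j k l"
      unfolding free_char_tmul by (rule tmul_cong[OF _ _ that]) (rule leg; assumption)+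
    also have "\<dots> = tone (?a n * ?b n) i j k l"
      by (rule tmul_legs(2)[OF that])
    finally show ?thesis .
  qed
  let ?R = "\<lambda>n. Rcoef LENGTH('m) LENGTH('n) n"
  have R: "free_char (u ^ n * fsc (?R n i j k l)) = ?R n i j k l" for n i j k l
    using assms(2) by (simp add: free_char_mult free_char_power free_char_fsc)
  have "free_char (tmul ?M ?D (\<lambda>i j k l. u ^ n * fsc (?R n i j k l))
      (tmul ?M ?D (leg1 (Lcoef s (a + int n))) (leg2 (Lcoef t (b - int n)))) i j k l) =
      tmul ?M ?D (?R n) (tone (?a n * ?b n)) i j k l" for n
    unfolding free_char_tmul[of _ _ "\<lambda>i j k l. u ^ n * fsc (?R n i j k l)"]
    by (rule tmul_cong[OF _ _ assms(1)]) (simp_all only: R t1)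
  then show "free_char (RLL u s t a b i j k l) =
      (\<Sum>n \<le> nat (\<bar>a\<bar> + \<bar>b\<bar>). ?R n i j k l * of_bool (a + int n = 0 \<and> b = int n))"
    unfolding RLL_def Let_def free_char_sum
    by (intro sum.cong) (use assms(1) in \<open>auto simp: tmul_tone\<close>)
  have "free_char (tmul ?M ?D
      (tmul ?M ?D (leg2 (Lcoef t (b - int n))) (leg1 (Lcoef s (a + int n))))
      (\<lambda>i j k l. u ^ n * fsc (?R n i j k l)) i j k l) =
      tmul ?M ?D (tone (?a n * ?b n)) (?R n) i j k l" for n
    unfolding free_char_tmul[of _ _ _ "\<lambda>i j k l. u ^ n * fsc (?R n i j k l)"]
    by (rule tmul_cong[OF _ _ assms(1)]) (simp_all only: R t2)
  then show "free_char (LLR u s t a b i j k l) =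
      (\<Sum>n \<le> nat (\<bar>a\<bar> + \<bar>b\<bar>). ?R n i j k l * of_bool (a + int n = 0 \<and> b = int n))"
    unfolding LLR_def Let_def free_char_sum
    by (intro sum.cong) (use assms(1) in \<open>auto simp: tmul_tone\<close>)
qed

lemma uq_eq_free_char: "uq_eq x y \<Longrightarrow> free_char x = free_char y"
  by (induction rule: uq_eq.induct)
     (auto simp: free_char_add free_char_mult free_char_fgen free_char_RLL)

instantiation Uq :: (len0, len0) ring_1
begin

lift_definition zero_Uq :: "('a, 'b) Uq" is 0 .
lift_definition one_Uq :: "('a, 'b) Uq" is 1 .
lift_definition plus_Uq :: "('a, 'b) Uq \<Rightarrow> ('a, 'b) Uq \<Rightarrow> ('a, 'b) Uq" is "(+)"
  by (rule uq_eq.add)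
lift_definition times_Uq :: "('a, 'b) Uq \<Rightarrow> ('a, 'b) Uq \<Rightarrow> ('a, 'b) Uq" is "(*)"
  by (rule uq_eq.mult)
lift_definition uminus_Uq :: "('a, 'b) Uq \<Rightarrow> ('a, 'b) Uq" is uminus
proof -
  fix x y :: "('a, 'b) free"
  assume "uq_eq x y"
  then have "uq_eq (- 1 * x) (- 1 * y)" by (intro uq_eq.mult uq_eq.refl)
  then show "uq_eq (- x) (- y)" by simp
qed
lift_definition minus_Uq :: "('a, 'b) Uq \<Rightarrow> ('a, 'b) Uq \<Rightarrow> ('a, 'b) Uq" is "(-)"
proof -
  fix x y x' y' :: "('a, 'b) free"
  assume "uq_eq x y" "uq_eq x' y'"
  then have "uq_eq (x + (- 1 * x')) (y + (- 1 * y'))" by (intro uq_eq.add uq_eq.mult uq_eq.refl)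
  then show "uq_eq (x - x') (y - y')" by simp
qed

instance
proof
  fix a b c :: "('a, 'b) Uq"
  show "a * b * c = a * (b * c)" by transfer (simp add: mult.assoc uq_eq.refl)
  show "1 * a = a" "a * 1 = a" by (transfer, simp add: uq_eq.refl)+
  show "a + b + c = a + (b + c)" by transfer (simp add: add.assoc uq_eq.refl)
  show "a + b = b + a" by transfer (simp add: add.commute uq_eq.refl)
  show "0 + a = a" "- a + a = 0" "a - b = a + - b" by (transfer, simp add: uq_eq.refl)+
  show "(a + b) * c = a * c + b * c" "a * (b + c) = a * b + a * c"
    by (transfer, simp add: distrib_left distrib_right uq_eq.refl)+
  show "(0 :: ('a, 'b) Uq) \<noteq> 1"
    by transfer (auto dest: uq_eq_free_char)
qed

end

text \<open>The structure map of the \<open>\<complex>(q)\<close>-algebra, and the images of the generators.\<close>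

lift_definition usc :: "cq \<Rightarrow> ('m::len0, 'n::len0) Uq" is fsc .

lift_definition ul :: "pm \<Rightarrow> nat \<Rightarrow> nat \<Rightarrow> nat \<Rightarrow> ('m::len0, 'n::len0) Uq" is "\<lambda>s i j r. fl s i j r" .


section \<open>Matrices of series\<close>

text \<open>
  A series \<open>\<Sum>\<^sub>r a\<^sub>r z\<^bsup>\<mp>r\<^esup>\<close> is the power series with coefficients \<open>a\<^sub>r\<close>, in the variable \<open>z\<^sup>-\<^sup>1\<close> for
  \<open>Pos\<close> and \<open>z\<close> for \<open>Neg\<close>. Matrices have indices from \<open>1\<close> upwards, their sizes are passed explicitly.
\<close>

type_synonym ('m, 'n) umat = "nat \<Rightarrow> nat \<Rightarrow> ('m, 'n) Uq fps"

definition Lmat :: "pm \<Rightarrow> ('m::len0, 'n::len0) umat" where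
  "Lmat s i j = Abs_fps (\<lambda>r. ul s i j r)"

text \<open>\<open>zsub s a A\<close> is \<open>A(z q\<^sup>a)\<close>.\<close>

definition zsub :: "pm \<Rightarrow> int \<Rightarrow> ('m::len0, 'n::len0) umat \<Rightarrow> ('m, 'n) umat" where
  "zsub s a A i j =
    Abs_fps (\<lambda>r. usc (qv powi ((case s of Pos \<Rightarrow> - a | Neg \<Rightarrow> a) * int r)) * fps_nth (A i j) r)"

text \<open>
  Graded product of matrices with inner size \<open>d\<close>, where \<open>p\<close>, \<open>p'\<close>, \<open>p''\<close> are the parities of the row,
  inner and column indices.
\<close>

definition gmul :: "nat \<Rightarrow> (nat \<Rightarrow> nat) \<Rightarrow> (nat \<Rightarrow> nat) \<Rightarrow> (nat \<Rightarrow> nat) \<Rightarrow>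
    (nat \<Rightarrow> nat \<Rightarrow> 'a::ring_1) \<Rightarrow> (nat \<Rightarrow> nat \<Rightarrow> 'a) \<Rightarrow> nat \<Rightarrow> nat \<Rightarrow> 'a" where
  "gmul d p p' p'' A B i j =
    (\<Sum>k = 1..d. (- 1) ^ ((p i + p' k) * (p' k + p'' j)) * A i k * B k j)"

definition is_ginv :: "nat \<Rightarrow> (nat \<Rightarrow> nat) \<Rightarrow> (nat \<Rightarrow> nat \<Rightarrow> 'a::ring_1) \<Rightarrow> (nat \<Rightarrow> nat \<Rightarrow> 'a) \<Rightarrow> bool" where
  "is_ginv d p A B \<longleftrightarrow>
    (\<forall>i\<in>{1..d}. \<forall>j\<in>{1..d}. gmul d p p p A B i j = of_bool (i = j) \<and>
                            gmul d p p p B A i j = of_bool (i = j)) \<and>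
    (\<forall>i j. i \<notin> {1..d} \<or> j \<notin> {1..d} \<longrightarrow> B i j = 0)"

definition ginv :: "nat \<Rightarrow> (nat \<Rightarrow> nat) \<Rightarrow> (nat \<Rightarrow> nat \<Rightarrow> 'a::ring_1) \<Rightarrow> nat \<Rightarrow> nat \<Rightarrow> 'a" where
  "ginv d p A = (THE B. is_ginv d p A B)"

text \<open>The block of \<open>A\<close> whose row and column indices start after \<open>r\<close> and \<open>c\<close>.\<close>

definition block :: "nat \<Rightarrow> nat \<Rightarrow> (nat \<Rightarrow> nat \<Rightarrow> 'a) \<Rightarrow> nat \<Rightarrow> nat \<Rightarrow> 'a" where
  "block r c A i j = A (r + i) (c + j)"

text \<open>
  \<open>A\<^sub>2\<^sub>2 - A\<^sub>2\<^sub>1 A\<^sub>1\<^sub>1\<^sup>-\<^sup>1 A\<^sub>1\<^sub>2\<close> for the blocks with \<open>A\<^sub>1\<^sub>1\<close> of size \<open>k \<times> k\<close>, where the first \<open>M\<close> indices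
  of \<open>A\<close> are even.
\<close>

definition schur :: "nat \<Rightarrow> nat \<Rightarrow> (nat \<Rightarrow> nat \<Rightarrow> 'a::ring_1) \<Rightarrow> nat \<Rightarrow> nat \<Rightarrow> 'a" where
  "schur M k A = (let p1 = par M; p2 = (\<lambda>i. par M (k + i));
      A11 = block 0 0 A; A12 = block 0 k A; A21 = block k 0 A; A22 = block k k A in
    (\<lambda>i j. A22 i j - gmul k p2 p1 p2 (gmul k p2 p1 p1 A21 (ginv k p1 A11)) A12 i j))"


section \<open>Berezinians\<close>

definition perm_length :: "nat \<Rightarrow> (nat \<Rightarrow> nat) \<Rightarrow> nat" where
  "perm_length n \<sigma> = card {(i, j). 1 \<le> i \<and> i < j \<and> j \<le> n \<and> \<sigma> j < \<sigma> i}"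

text \<open>
  For \<open>A\<close> of size \<open>m + n\<close> with the first \<open>m\<close> indices even. The \<open>prod_list\<close>s are the ordered products
  from left to right.
\<close>

definition Bq :: "pm \<Rightarrow> nat \<Rightarrow> nat \<Rightarrow> ('m::len0, 'n::len0) umat \<Rightarrow> ('m, 'n) Uq fps" where
  "Bq s m n A =
    (\<Sum>\<sigma> | \<sigma> permutes {1..m}. fps_const (usc ((- qv) powi (- int (perm_length m \<sigma>)))) *
       prod_list (map (\<lambda>j. zsub s (2 * int j - 2) A (\<sigma> j) j) [1..<m + 1])) *
    (\<Sum>\<tau> | \<tau> permutes {1..n}. fps_const (usc ((- qv) powi (- int (perm_length n \<tau>)))) *
       prod_list (map (\<lambda>k. ginv (m + n) (par m) (zsub s (2 * int m - 2 * int k) A) (m + k) (m + \<tau> k))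
         [1..<n + 1]))"


section \<open>Existence and uniqueness of the series \<open>f\<close>\<close>

lemma qv_nonzero [simp]: "qv \<noteq> 0"
  by (simp add: qv_def Zero_fract_def eq_fract)

lemma qv_powi_eq_1_iff [simp]: "qv powi e = 1 \<longleftrightarrow> e = 0"
proof
  assume e: "qv powi e = 1"
  have "qv ^ n = Fract ([:0, 1:] ^ n) 1" for n
    by (induction n) (simp_all add: qv_def One_fract_def)
  then have nat_case: "qv ^ n = 1 \<Longrightarrow> n = 0" for n
    using degree_power_eq[of "[:0, 1 :: complex:]" n]
    by (cases "n = 0") (auto simp: One_fract_def eq_fract)
  show "e = 0"
  proof (cases "e \<ge> 0")
    case True
    then show ?thesis using e nat_case[of "nat e"] by (simp add: power_int_def)
  next
    case False
    then show ?thesis using e nat_case[of "nat (- e)"] by (simp add: power_int_def power_inverse)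
  qed
qed simp

fun fser_rec :: "(nat \<Rightarrow> cq) \<Rightarrow> int \<Rightarrow> nat \<Rightarrow> cq" where
  "fser_rec g a n = (if n = 0 then 1 else
     (\<Sum>i<n. fser_rec g a i * g (n - i)) / (qv powi (- a * int n) - 1))"

declare fser_rec.simps [simp del]

lemma ex1_is_fser:
  assumes "M \<noteq> N"
  shows "\<exists>!f. is_fser M N f"
proof -
  define a where "a = 2 * int N - 2 * int M"
  have a: "a \<noteq> 0" using assms by (simp add: a_def)
  define y where "y = (fps_X :: cq fps)"
  define Q where "Q = (\<lambda>e. fps_const (qv powi e))"
  define num where "num = (y - Q (- 2)) * (y - Q (a + 2))"
  define den where "den = (y - 1) * (y - Q a)"
  define g where "g = num * inverse den"
  have den0: "fps_nth den 0 = qv powi a" and num0: "fps_nth num 0 = qv powi a"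
    by (simp_all add: den_def num_def y_def Q_def power_int_add power_int_minus)
  have g0: "fps_nth g 0 = 1"
    by (simp add: g_def den0 num0)
  have x: "xv * fps_to_fls y = 1"
    by (simp add: xv_def y_def fls_X_inv_times_conv_shift fls_X_conv_shift_1)
  have lin: "xv * fps_to_fls (y - Q e) = 1 - xv * fls_const (qv powi e)" for e
    by (simp add: Q_def right_diff_distrib x)
  have "den \<noteq> 0" using den0 by auto
  have "g * den = num"
    using inverse_mult_eq_1[of den] den0 by (simp add: g_def mult.assoc)
  then have "fps_to_fls g * fps_to_fls den = fps_to_fls num"
    by (metis fls_times_fps_to_fls)
  then have "fps_to_fls g = fps_to_fls num / fps_to_fls den"
    using \<open>den \<noteq> 0\<close> by (simp add: field_simps)
  also have "\<dots> = (xv * xv * fps_to_fls num) / (xv * xv * fps_to_fls den)"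
    by (simp add: xv_def)
  also have "xv * xv * fps_to_fls num =
      (1 - xv * fls_const (qv powi (- 2))) * (1 - xv * fls_const (qv powi (a + 2)))"
    unfolding num_def fls_times_fps_to_fls lin[symmetric] by (simp only: ac_simps)
  also have "xv * xv * fps_to_fls den = (1 - xv) * (1 - xv * fls_const (qv powi a))"
  proof -
    have lin0: "xv * fps_to_fls (y - 1) = 1 - xv"
      using lin[of 0] by (simp add: Q_def)
    have "xv * xv * fps_to_fls den = (xv * fps_to_fls (y - 1)) * (xv * fps_to_fls (y - Q a))"
      unfolding den_def fls_times_fps_to_fls by (simp only: ac_simps)
    then show ?thesis unfolding lin0 lin .
  qed
  finally have G: "fps_to_fls g = ((1 - xv * fls_const (qv powi (- 2))) *
      (1 - xv * fls_const (qv powi (a + 2)))) / ((1 - xv) * (1 - xv * fls_const (qv powi a)))" .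
  have iff1: "is_fser M N f \<longleftrightarrow> fps_nth f 0 = 1 \<and> xshift a f = f * g" for f
    unfolding is_fser_def Let_def a_def[symmetric] G[symmetric]
    by (metis fls_times_fps_to_fls fps_to_fls_eq_iff)
  have iff: "is_fser M N f \<longleftrightarrow> (\<forall>n. fps_nth f n = fser_rec (fps_nth g) a n)" for f
  proof -
    have step: "qv powi (- a * int n) * fps_nth f n = fps_nth (f * g) n \<longleftrightarrow>
        n = 0 \<or> fps_nth f n = (\<Sum>i<n. fps_nth f i * fps_nth g (n - i)) / (qv powi (- a * int n) - 1)" for n
    proof -
      have "fps_nth (f * g) n = (\<Sum>i<n. fps_nth f i * fps_nth g (n - i)) + fps_nth f n"
        by (simp add: fps_mult_nth atLeast0AtMost flip: lessThan_Suc_atMost) (simp add: g0)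
      moreover have "n \<noteq> 0 \<Longrightarrow> qv powi (- a * int n) - 1 \<noteq> 0"
        using a qv_powi_eq_1_iff[of "- a * int n"] by (simp del: qv_powi_eq_1_iff)
      ultimately show ?thesis
        by (cases "n = 0") (auto simp: eq_divide_eq algebra_simps)
    qed
    have "is_fser M N f \<longleftrightarrow> (\<forall>n. fps_nth f n = (if n = 0 then 1 else
        (\<Sum>i<n. fps_nth f i * fps_nth g (n - i)) / (qv powi (- a * int n) - 1)))"
    proof -
      have "xshift a f = f * g \<longleftrightarrow> (\<forall>n. n = 0 \<or>
          fps_nth f n = (\<Sum>i<n. fps_nth f i * fps_nth g (n - i)) / (qv powi (- a * int n) - 1))"
        unfolding fps_eq_iff xshift_def fps_nth_Abs_fps step ..
      moreover have "(c 0 = 1 \<and> (\<forall>n. n = 0 \<or> c n = d n)) = (\<forall>n. c n = (if n = 0 then 1 else d n))"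
        for c d :: "nat \<Rightarrow> cq"
        by metis
      ultimately show ?thesis unfolding iff1 by (simp only:)
    qed
    also have "\<dots> \<longleftrightarrow> (\<forall>n. fps_nth f n = fser_rec (fps_nth g) a n)"
    proof (intro iffI allI)
      fix n
      assume *: "\<forall>n. fps_nth f n = (if n = 0 then 1 else
        (\<Sum>i<n. fps_nth f i * fps_nth g (n - i)) / (qv powi (- a * int n) - 1))"
      show "fps_nth f n = fser_rec (fps_nth g) a n"
      proof (induction n rule: less_induct)
        case (less n)
        have "(\<Sum>i<n. fps_nth f i * fps_nth g (n - i)) =
            (\<Sum>i<n. fser_rec (fps_nth g) a i * fps_nth g (n - i))"
          by (rule sum.cong) (use less in auto)
        then show ?case
          by (simp only: *[rule_format, of n] fser_rec.simps[of _ _ n])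
      qed
    next
      fix n
      assume "\<forall>n. fps_nth f n = fser_rec (fps_nth g) a n"
      then show "fps_nth f n = (if n = 0 then 1 else
        (\<Sum>i<n. fps_nth f i * fps_nth g (n - i)) / (qv powi (- a * int n) - 1))"
        by (simp add: fser_rec.simps[of _ _ n])
    qed
    finally show ?thesis .
  qed
  show ?thesis
    unfolding iff by (intro ex1I[of _ "Abs_fps (fser_rec (fps_nth g) a)"]) (auto simp: fps_eq_iff)
qed

lemma is_fser_fser: "M \<noteq> N \<Longrightarrow> is_fser M N (fser M N)"
  unfolding fser_def by (rule theI'[OF ex1_is_fser])
end

theory Submission
  imports Defs
begin

text \<open>
Why the factorisation holds. Write \<open>A(z)\<close> for \<open>L(z)\<close> restricted to the even indices \<open>1..M\<close>. The
first factor of the Berezinian is the quantum determinant of \<open>A(z), A(zq\<^sup>2), A(zq\<^sup>4), \<dots>\<close>, one matrix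
for each column; the second is a quantum determinant, by rows, of the odd diagonal block of
\<open>L\<^sup>-\<^sup>1\<close> at \<open>zq\<^bsup>2M-2\<^esup>, zq\<^bsup>2M-4\<^esup>, \<dots>\<close>. In both cases the ratio of consecutive arguments is one at
which the diagonal entries \<open>E\<^sub>i\<^sub>i \<otimes> E\<^sub>i\<^sub>i\<close> of the relevant block of the \<open>R\<close>-matrix vanish and that
block degenerates to a q-antisymmetriser. The \<open>RLL\<close> relation (for the second factor, the relation
obtained from it by inverting \<open>L\<^sub>1\<close> and \<open>L\<^sub>2\<close>) then says that the two-row minors built from two
consecutive matrices (in the odd case, from their transposes) are q-antisymmetric in their columns.
This weak property, \<open>qmanin\<close> below, is
all that is used of the \<open>RLL\<close> relations.

A determinant built from consecutive matrices with this property vanishes when a column index is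
repeated (\<open>cdet_repeated_column\<close>): adjacent columns can be exchanged up to a scalar until the two
equal ones meet. So one may subtract from a column combinations of the earlier ones with coefficients
on the right, starting from the last column, or combinations of the later ones with coefficients on the left,
starting from the first column. The first operation turns the matrix of size \<open>M\<close> into a block
triangular one with diagonal blocks \<open>L\<^sub>1\<^sub>1\<close> and the Schur complement (\<open>cdet_schur_right\<close>, for
\<open>k < M\<close>); the second does the same for the odd block of \<open>L\<^sup>-\<^sup>1\<close>, transposed
(\<open>cdet_schur_left\<close>, for \<open>k \<ge> M\<close>). No minors have to commute, because in both cases the factors come
out in the required order.

What remains is block inversion over a noncommutative ring. The inverse of the Schur complement is the
lower right block of \<open>L\<^sup>-\<^sup>1\<close> (\<open>inverse_on_schur\<close>), which for \<open>k < M\<close> makes the second factors of both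
sides literally equal; and the inverse of \<open>L\<^sub>1\<^sub>1\<close> is a Schur complement of \<open>L\<^sup>-\<^sup>1\<close> (\<open>inverse_block_eq\<close>),
which for \<open>k \<ge> M\<close> identifies the result of \<open>cdet_schur_left\<close>. The grading enters only through
signs: both graded products become ordinary matrix products after multiplying the entries by suitable signs (\<open>twist\<close>,
\<open>tensor_mat\<close>), and these signs are trivial between indices of equal parity.
\<close>

section \<open>Quantum column determinants\<close>

definition central :: "'a::ring_1 \<Rightarrow> bool" where
  "central c \<longleftrightarrow> (\<forall>x. c * x = x * c)"

lemma centralD: "central c \<Longrightarrow> c * x = x * c"
  by (simp add: central_def)

lemma central_left_commute:
  assumes "central c"
  shows "x * (c * y) = c * (x * y)"
  by (metis assms centralD mult.assoc)

lemma central_power: "central c \<Longrightarrow> central (c ^ n)"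
proof (induction n)
  case (Suc n)
  then show ?case unfolding central_def power_Suc by (metis mult.assoc)
qed (simp add: central_def)

definition oprod :: "(nat \<Rightarrow> 'a::monoid_mult) \<Rightarrow> nat \<Rightarrow> nat \<Rightarrow> 'a" where
  "oprod f a b = prod_list (map f [a..<b])"

lemma oprod_cong:
  assumes "\<And>j. a \<le> j \<Longrightarrow> j < b \<Longrightarrow> f j = g j"
  shows "oprod f a b = oprod g a b"
  unfolding oprod_def by (rule arg_cong[where f = prod_list], rule map_cong) (use assms in auto)

lemma oprod_append:
  assumes "a \<le> b" "b \<le> c"
  shows "oprod f a c = oprod f a b * oprod f b c"
  unfolding oprod_def using upt_add_eq_append[of a b "c - b"] assms by simp

lemma oprod_single: "oprod f a (Suc a) = f a"
  by (simp add: oprod_def)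

lemma oprod_shift: "oprod f (k + a) (k + b) = oprod (\<lambda>j. f (k + j)) a b"
proof -
  have "[k + a..<k + b] = map ((+) k) [a..<b]"
    by (induction b) auto
  then show ?thesis by (simp add: oprod_def comp_def)
qed

text \<open>
\<open>G j\<close> is the \<open>j\<close>-th column. Columns rather than a matrix are the data because the \<open>j\<close>-th column
will be taken from a matrix that depends on \<open>j\<close>, namely \<open>L(zq\<^bsup>2j-2\<^esup>)\<close>. For \<open>t = -q\<^sup>-\<^sup>1\<close> this is the
quantum determinant.
\<close>

definition cdet :: "'a::ring_1 \<Rightarrow> nat \<Rightarrow> (nat \<Rightarrow> nat \<Rightarrow> 'a) \<Rightarrow> 'a" where
  "cdet t n G = (\<Sum>\<sigma> | \<sigma> permutes {1..n}.
     t ^ perm_length n \<sigma> * oprod (\<lambda>j. G j (\<sigma> j)) 1 (n + 1))"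

lemma oprod_split_at:
  fixes f :: "nat \<Rightarrow> 'a::ring_1"
  assumes "1 \<le> p" "p \<le> n"
  shows "oprod f 1 (n + 1) = oprod f 1 p * f p * oprod f (Suc p) (n + 1)"
  using oprod_append[of 1 p "n + 1" f] oprod_append[of p "Suc p" "n + 1" f] assms
  by (simp add: oprod_single mult.assoc)

lemma oprod_split_at2:
  fixes f :: "nat \<Rightarrow> 'a::ring_1"
  assumes "1 \<le> p" "Suc p \<le> n"
  shows "oprod f 1 (n + 1) = oprod f 1 p * (f p * f (Suc p)) * oprod f (Suc (Suc p)) (n + 1)"
  using oprod_split_at[of p n f] oprod_append[of "Suc p" "Suc (Suc p)" "n + 1" f] assms
  by (simp add: oprod_single mult.assoc)

lemma cdet_cong:
  assumes "\<And>j i. 1 \<le> j \<Longrightarrow> j \<le> n \<Longrightarrow> 1 \<le> i \<Longrightarrow> i \<le> n \<Longrightarrow> G j i = G' j i"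
  shows "cdet t n G = cdet t n G'"
proof -
  have "oprod (\<lambda>j. G j (\<sigma> j)) 1 (n + 1) = oprod (\<lambda>j. G' j (\<sigma> j)) 1 (n + 1)"
    if "\<sigma> permutes {1..n}" for \<sigma>
  proof (rule oprod_cong)
    fix j :: nat assume j: "1 \<le> j" "j < n + 1"
    then have "\<sigma> j \<in> {1..n}" using permutes_in_image[OF that, of j] by auto
    then show "G j (\<sigma> j) = G' j (\<sigma> j)" using j assms by auto
  qed
  then show ?thesis unfolding cdet_def by (intro sum.cong HOL.refl) simp
qed

lemma cdet_sum_column:
  assumes "finite S" "1 \<le> p" "p \<le> n"
  shows "cdet t n (G(p := \<lambda>i. u i + (\<Sum>l\<in>S. v l i))) =
    cdet t n (G(p := u)) + (\<Sum>l\<in>S. cdet t n (G(p := v l)))"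
proof -
  let ?pre = "\<lambda>\<sigma>. oprod (\<lambda>j. G j (\<sigma> j)) 1 p"
  let ?post = "\<lambda>\<sigma>. oprod (\<lambda>j. G j (\<sigma> j)) (Suc p) (n + 1)"
  have eq: "oprod (\<lambda>j. (G(p := w)) j (\<sigma> j)) 1 (n + 1) = ?pre \<sigma> * w (\<sigma> p) * ?post \<sigma>"
    for w \<sigma>
  proof -
    have "oprod (\<lambda>j. (G(p := w)) j (\<sigma> j)) 1 p = oprod (\<lambda>j. G j (\<sigma> j)) 1 p"
      "oprod (\<lambda>j. (G(p := w)) j (\<sigma> j)) (Suc p) (n + 1) = oprod (\<lambda>j. G j (\<sigma> j)) (Suc p) (n + 1)"
      by (auto intro: oprod_cong)
    then show ?thesis
      using oprod_split_at[OF assms(2,3), of "\<lambda>j. (G(p := w)) j (\<sigma> j)"] by simp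
  qed
  show ?thesis
    unfolding cdet_def eq
    by (simp add: distrib_left distrib_right sum.distrib sum_distrib_left sum_distrib_right)
       (rule sum.swap)
qed

lemma perm_length_transpose_adjacent:
  assumes "1 \<le> p" "Suc p \<le> n" "\<sigma> p < \<sigma> (Suc p)"
  shows "perm_length n (\<sigma> \<circ> transpose p (Suc p)) = Suc (perm_length n \<sigma>)"
proof -
  let ?\<tau> = "transpose p (Suc p)"
  let ?I = "\<lambda>\<sigma>. {(i, j). 1 \<le> i \<and> i < j \<and> j \<le> n \<and> \<sigma> j < (\<sigma> i :: nat)}"
  have fin: "finite (?I \<sigma>)"
    by (rule finite_subset[of _ "{0..n} \<times> {0..n}"]) auto
  have "?I (\<sigma> \<circ> ?\<tau>) = insert (p, Suc p) (map_prod ?\<tau> ?\<tau> ` ?I \<sigma>)"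
  proof (intro set_eqI iffI; clarsimp split: prod.splits)
    fix i j assume *: "Suc 0 \<le> i" "i < j" "j \<le> n" "\<sigma> (?\<tau> j) < \<sigma> (?\<tau> i)"
      and ne: "(i, j) \<notin> map_prod ?\<tau> ?\<tau> ` {(i, j). Suc 0 \<le> i \<and> i < j \<and> j \<le> n \<and> \<sigma> j < \<sigma> i}"
    show "i = p \<and> j = Suc p"
    proof (rule ccontr)
      assume n2: "\<not> (i = p \<and> j = Suc p)"
      have "(?\<tau> i, ?\<tau> j) \<in> ?I \<sigma>"
        using * n2 assms by (auto simp: transpose_def split: if_splits)
      then have "map_prod ?\<tau> ?\<tau> (?\<tau> i, ?\<tau> j) \<in> map_prod ?\<tau> ?\<tau> ` ?I \<sigma>" by (rule imageI)
      then show False using ne by simp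
    qed
  next
    fix i j
    assume "i = p \<and> j = Suc p \<or>
      (i, j) \<in> map_prod ?\<tau> ?\<tau> ` {(i, j). Suc 0 \<le> i \<and> i < j \<and> j \<le> n \<and> \<sigma> j < \<sigma> i}"
    then show "Suc 0 \<le> i \<and> i < j \<and> j \<le> n \<and> \<sigma> (?\<tau> j) < \<sigma> (?\<tau> i)"
    proof
      assume "i = p \<and> j = Suc p" then show ?thesis using assms by auto
    next
      assume "(i, j) \<in> map_prod ?\<tau> ?\<tau> ` {(i, j). Suc 0 \<le> i \<and> i < j \<and> j \<le> n \<and> \<sigma> j < \<sigma> i}"
      then obtain a b where ab: "1 \<le> a" "a < b" "b \<le> n" "\<sigma> b < \<sigma> a" "i = ?\<tau> a" "j = ?\<tau> b" by auto
      then have "\<not> (a = p \<and> b = Suc p)" using assms by auto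
      then show ?thesis using ab assms by (auto simp: transpose_def split: if_splits)
    qed
  qed
  moreover have "(p, Suc p) \<notin> map_prod ?\<tau> ?\<tau> ` ?I \<sigma>"
    by (auto simp: transpose_def split: if_splits)
  moreover have "card (map_prod ?\<tau> ?\<tau> ` ?I \<sigma>) = card (?I \<sigma>)"
    by (intro card_image inj_onI) (auto simp: transpose_eq_iff)
  ultimately show ?thesis using fin by (simp add: perm_length_def)
qed

text \<open>
The quantum minor of the columns \<open>u\<close>, \<open>v\<close> in the rows \<open>i < j\<close>.
\<close>

definition pairdet :: "'a::ring_1 \<Rightarrow> (nat \<Rightarrow> 'a) \<Rightarrow> (nat \<Rightarrow> 'a) \<Rightarrow> nat \<Rightarrow> nat \<Rightarrow> 'a" where
  "pairdet t u v i j = u i * v j + t * (u j * v i)"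

text \<open>
Pairing \<open>\<sigma>\<close> with \<open>\<sigma> \<circ> (p p+1)\<close> shows that a determinant depends on two adjacent columns only through
their two-row minors.
\<close>

lemma cdet_pairs:
  assumes t: "central t" and p: "1 \<le> p" "Suc p \<le> n"
  shows "cdet t n G = (\<Sum>\<sigma> | \<sigma> permutes {1..n} \<and> \<sigma> p < \<sigma> (Suc p). t ^ perm_length n \<sigma> *
     (oprod (\<lambda>j. G j (\<sigma> j)) 1 p * pairdet t (G p) (G (Suc p)) (\<sigma> p) (\<sigma> (Suc p)) *
      oprod (\<lambda>j. G j (\<sigma> j)) (Suc (Suc p)) (n + 1)))"
proof -
  let ?\<tau> = "transpose p (Suc p)"
  let ?P = "{\<sigma>. \<sigma> permutes {1..n}}"
  let ?U = "{\<sigma>. \<sigma> permutes {1..n} \<and> \<sigma> p < \<sigma> (Suc p)}"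
  let ?V = "{\<sigma>. \<sigma> permutes {1..n} \<and> \<not> \<sigma> p < \<sigma> (Suc p)}"
  let ?F = "\<lambda>\<sigma>. t ^ perm_length n \<sigma> * oprod (\<lambda>j. G j (\<sigma> j)) 1 (n + 1)"
  let ?pre = "\<lambda>\<sigma>. oprod (\<lambda>j. G j (\<sigma> j)) 1 p"
  let ?post = "\<lambda>\<sigma>. oprod (\<lambda>j. G j (\<sigma> j)) (Suc (Suc p)) (n + 1)"
  have tau: "?\<tau> permutes {1..n}" using p by (intro permutes_swap_id) auto
  have fin: "finite ?P" by (simp add: finite_permutations)
  have neq: "\<sigma> p \<noteq> \<sigma> (Suc p)" if "\<sigma> permutes {1..n}" for \<sigma>
    using permutes_inj[OF that] by (metis inj_eq n_not_Suc_n)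
  have P: "?P = ?U \<union> ?V" and disj: "?U \<inter> ?V = {}" by auto
  have finU: "finite ?U" "finite ?V" by (auto intro: finite_subset[OF _ fin])
  have "cdet t n G = sum ?F (?U \<union> ?V)"
    unfolding cdet_def by (rule arg_cong[where f = "sum ?F"]) (rule P)
  also have "\<dots> = sum ?F ?U + sum ?F ?V"
    by (rule sum.union_disjoint[OF finU disj])
  also have "sum ?F ?V = (\<Sum>\<sigma>\<in>?U. ?F (\<sigma> \<circ> ?\<tau>))"
  proof (rule sum.reindex_bij_witness[of _ "\<lambda>\<sigma>. \<sigma> \<circ> ?\<tau>" "\<lambda>\<sigma>. \<sigma> \<circ> ?\<tau>"])
    fix \<sigma> assume "\<sigma> \<in> ?V"
    moreover from this have "\<sigma> \<circ> ?\<tau> permutes {1..n}" by (intro permutes_compose[OF tau]) simp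
    ultimately show "\<sigma> \<circ> ?\<tau> \<in> ?U" using neq[of \<sigma>] by auto
  qed (auto simp: comp_assoc intro: permutes_compose[OF tau[unfolded One_nat_def]])
  also have "sum ?F ?U + \<dots> = (\<Sum>\<sigma>\<in>?U. ?F \<sigma> + ?F (\<sigma> \<circ> ?\<tau>))"
    by (simp add: sum.distrib)
  also have "\<dots> = (\<Sum>\<sigma>\<in>?U. t ^ perm_length n \<sigma> *
      (?pre \<sigma> * pairdet t (G p) (G (Suc p)) (\<sigma> p) (\<sigma> (Suc p)) * ?post \<sigma>))"
  proof (rule sum.cong[OF HOL.refl])
    fix \<sigma> assume "\<sigma> \<in> ?U"
    then have len: "perm_length n (\<sigma> \<circ> ?\<tau>) = Suc (perm_length n \<sigma>)"
      using perm_length_transpose_adjacent p by auto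
    have m: "?pre (\<sigma> \<circ> ?\<tau>) = ?pre \<sigma>" "?post (\<sigma> \<circ> ?\<tau>) = ?post \<sigma>"
      by (intro oprod_cong; auto simp: transpose_def)+
    have "?F (\<sigma> \<circ> ?\<tau>) = t ^ perm_length n \<sigma> * (t *
        (?pre \<sigma> * (G p (\<sigma> (Suc p)) * G (Suc p) (\<sigma> p)) * ?post \<sigma>))"
      using oprod_split_at2[OF p, of "\<lambda>j. G j ((\<sigma> \<circ> ?\<tau>) j)"] m len
      by (simp add: power_Suc2 mult.assoc del: power_Suc)
    moreover have "?F \<sigma> = t ^ perm_length n \<sigma> *
        (?pre \<sigma> * (G p (\<sigma> p) * G (Suc p) (\<sigma> (Suc p))) * ?post \<sigma>)"
      using oprod_split_at2[OF p, of "\<lambda>j. G j (\<sigma> j)"] by simp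
    ultimately show "?F \<sigma> + ?F (\<sigma> \<circ> ?\<tau>) = t ^ perm_length n \<sigma> *
      (?pre \<sigma> * pairdet t (G p) (G (Suc p)) (\<sigma> p) (\<sigma> (Suc p)) * ?post \<sigma>)"
      by (simp add: pairdet_def distrib_left distrib_right mult.assoc central_left_commute[OF t])
  qed
  finally show ?thesis .
qed

lemma cdet_pair_scale:
  assumes t: "central t" and k: "central \<kappa>" and p: "1 \<le> p" "Suc p \<le> n"
    and pair: "\<And>i j. 1 \<le> i \<Longrightarrow> i < j \<Longrightarrow> j \<le> n \<Longrightarrow>
      pairdet t (G p) (G (Suc p)) i j = \<kappa> * pairdet t (G' p) (G' (Suc p)) i j"
    and other: "\<And>j. j \<noteq> p \<Longrightarrow> j \<noteq> Suc p \<Longrightarrow> G' j = G j"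
  shows "cdet t n G = \<kappa> * cdet t n G'"
proof -
  have "oprod (\<lambda>j. G' j (\<sigma> j)) 1 p = oprod (\<lambda>j. G j (\<sigma> j)) 1 p"
    "oprod (\<lambda>j. G' j (\<sigma> j)) (Suc (Suc p)) (n + 1) =
     oprod (\<lambda>j. G j (\<sigma> j)) (Suc (Suc p)) (n + 1)" for \<sigma> :: "nat \<Rightarrow> nat"
    by (intro oprod_cong; simp add: other)+
  moreover have "pairdet t (G p) (G (Suc p)) (\<sigma> p) (\<sigma> (Suc p)) =
      \<kappa> * pairdet t (G' p) (G' (Suc p)) (\<sigma> p) (\<sigma> (Suc p))"
    if "\<sigma> permutes {1..n}" "\<sigma> p < \<sigma> (Suc p)" for \<sigma>
    using that p permutes_in_image[OF that(1), of p] permutes_in_image[OF that(1), of "Suc p"]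
    by (intro pair) auto
  ultimately show ?thesis
    unfolding cdet_pairs[OF t p] sum_distrib_left
    by (intro sum.cong HOL.refl) (simp add: mult.assoc central_left_commute[OF k])
qed

text \<open>
For \<open>B p = L(zq\<^bsup>2p-2\<^esup>)\<close> this is the part of the \<open>RLL\<close> relation that matters here: two-row minors of
consecutive matrices vanish for equal columns, and exchanging the columns costs a central factor \<open>\<kappa>\<close>.
It is the defining property of a q-Manin matrix, with the shift of the spectral parameter made
explicit by the index \<open>p\<close>.
\<close>

section \<open>Vanishing for a repeated column\<close>

definition qmanin :: "'a::ring_1 \<Rightarrow> (nat \<Rightarrow> nat \<Rightarrow> 'a) \<Rightarrow> nat \<Rightarrow> (nat \<Rightarrow> nat \<Rightarrow> nat \<Rightarrow> 'a) \<Rightarrow> bool" where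
  "qmanin t \<kappa> n B \<longleftrightarrow> central t \<and> (\<forall>a b. central (\<kappa> a b)) \<and>
    (\<forall>p i j a b. 1 \<le> p \<and> Suc p \<le> n \<and> 1 \<le> i \<and> i < j \<and> j \<le> n \<and> a \<in> {1..n} \<and> b \<in> {1..n} \<longrightarrow>
      (a = b \<longrightarrow> pairdet t (\<lambda>i. B p i a) (\<lambda>i. B (Suc p) i b) i j = 0) \<and>
      (a \<noteq> b \<longrightarrow> pairdet t (\<lambda>i. B p i a) (\<lambda>i. B (Suc p) i b) i j =
        \<kappa> a b * pairdet t (\<lambda>i. B p i b) (\<lambda>i. B (Suc p) i a) i j))"

lemma pairdet_coeffs:
  "central t \<Longrightarrow> pairdet t (\<lambda>i. Y * u i) (\<lambda>i. v i * X) i j = Y * pairdet t u v i j * X"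
  "central t \<Longrightarrow> pairdet t (\<lambda>i. Y * u i) v i j = Y * pairdet t u v i j"
  by (simp_all add: pairdet_def distrib_left distrib_right mult.assoc) (metis centralD mult.assoc)+

text \<open>
Columns \<open>c p, \<dots>, c r\<close> of consecutive matrices stand at the positions \<open>p, \<dots>, r\<close>, and \<open>c p = c r\<close>.
Exchanging neighbours moves the index \<open>c p\<close> to the right, at the cost of central factors, until
it stands next to \<open>c r\<close>, where the minor vanishes. The coefficients \<open>Y\<close> and \<open>X\<close> are allowed only at
the outer ends: a coefficient between two columns would obstruct the exchange. The columns outside the
run are arbitrary.
\<close>

lemma cdet_repeated_column:
  assumes B: "qmanin t \<kappa> n B"
    and "1 \<le> p" "p < r" "r \<le> n" "c p = c r"
    and "\<And>j. p \<le> j \<Longrightarrow> j \<le> r \<Longrightarrow> c j \<in> {1..n}"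
    and "G p = (\<lambda>i. Y * B p i (c p))"
    and "\<And>j. p < j \<Longrightarrow> j < r \<Longrightarrow> G j = (\<lambda>i. B j i (c j))"
    and "G r = (\<lambda>i. B r i (c r) * X)"
  shows "cdet t n G = 0"
  using assms(2-)
proof (induction "r - p" arbitrary: p c G Y)
  case 0
  then show ?case by simp
next
  case (Suc d)
  have t: "central t" using B by (simp add: qmanin_def)
  have p: "1 \<le> p" "Suc p \<le> n" using Suc.prems by auto
  note Gs = Suc.prems(6-8)
  have zero: "cdet t n G = 0"
    if "\<And>i j. 1 \<le> i \<Longrightarrow> i < j \<Longrightarrow> j \<le> n \<Longrightarrow> pairdet t (G p) (G (Suc p)) i j = 0"
    using cdet_pair_scale[OF t _ p, of 0 G G] that by (simp add: central_def)
  have cin: "c p \<in> {1..n}" "c (Suc p) \<in> {1..n}" using Suc.prems(2,5) by auto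
  show ?case
  proof (cases "r = Suc p")
    case True
    show ?thesis
    proof (rule zero)
      fix i j :: nat assume "1 \<le> i" "i < j" "j \<le> n"
      then have "pairdet t (\<lambda>i. B p i (c p)) (\<lambda>i. B (Suc p) i (c p)) i j = 0"
        using B p cin unfolding qmanin_def by blast
      then show "pairdet t (G p) (G (Suc p)) i j = 0"
        unfolding Gs(1) Gs(3)[unfolded True] Suc.prems(4)[unfolded True, symmetric] by (simp add: pairdet_coeffs[OF t])
    qed
  next
    case False
    then have lt: "Suc p < r" using Suc.prems by auto
    have G2: "G (Suc p) = (\<lambda>i. B (Suc p) i (c (Suc p)))" using Gs(2) lt by simp
    show ?thesis
    proof (cases "c p = c (Suc p)")
      case True
      show ?thesis
      proof (rule zero)
        fix i j :: nat assume "1 \<le> i" "i < j" "j \<le> n"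
        then have "pairdet t (\<lambda>i. B p i (c p)) (\<lambda>i. B (Suc p) i (c (Suc p))) i j = 0"
          using B p cin True unfolding qmanin_def by blast
        then show "pairdet t (G p) (G (Suc p)) i j = 0"
          unfolding Gs(1) G2 by (simp add: pairdet_coeffs[OF t])
      qed
    next
      case ne: False
      \<comment> \<open>Exchange the indices at \<open>p\<close> and \<open>p + 1\<close>; the coefficient \<open>Y\<close> stays at position \<open>p\<close>.\<close>
      define G' where "G' = G(p := (\<lambda>i. Y * B p i (c (Suc p))), Suc p := (\<lambda>i. B (Suc p) i (c p)))"
      define c' where "c' = c(p := c (Suc p), Suc p := c p)"
      let ?k = "\<kappa> (c p) (c (Suc p))"
      have kc: "central ?k" using B by (simp add: qmanin_def)
      have "cdet t n G = ?k * cdet t n G'"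
      proof (rule cdet_pair_scale[OF t kc p])
        fix i j :: nat assume "1 \<le> i" "i < j" "j \<le> n"
        then have "pairdet t (\<lambda>i. B p i (c p)) (\<lambda>i. B (Suc p) i (c (Suc p))) i j =
            ?k * pairdet t (\<lambda>i. B p i (c (Suc p))) (\<lambda>i. B (Suc p) i (c p)) i j"
          using B p cin ne unfolding qmanin_def by blast
        then show "pairdet t (G p) (G (Suc p)) i j = ?k * pairdet t (G' p) (G' (Suc p)) i j"
          unfolding Gs(1) G2 by (simp add: G'_def pairdet_coeffs[OF t] central_left_commute[OF kc])
      qed (auto simp: G'_def)
      moreover have "cdet t n G' = 0"
      proof (rule Suc.hyps(1)[where p = "Suc p" and c = c' and Y = 1])
        show "c' (Suc p) = c' r" using lt Suc.prems(4) by (auto simp: c'_def)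
        show "G' r = (\<lambda>i. B r i (c' r) * X)" using lt Gs(3) by (auto simp: c'_def G'_def)
        show "G' j = (\<lambda>i. B j i (c' j))" if "Suc p < j" "j < r" for j
          using that Gs(2)[of j] by (auto simp: c'_def G'_def)
        show "c' j \<in> {1..n}" if "Suc p \<le> j" "j \<le> r" for j
          using that cin Suc.prems(5)[of j] by (auto simp: c'_def)
      qed (use lt Suc in \<open>auto simp: c'_def G'_def\<close>)
      ultimately show ?thesis by simp
    qed
  qed
qed

section \<open>Block triangular matrices and Schur complements\<close>

lemma permutes_finiteI:
  assumes "finite S" "\<And>x. x \<in> S \<Longrightarrow> f x \<in> S" "inj_on f S" "\<And>x. x \<notin> S \<Longrightarrow> f x = x"
  shows "f permutes S"
  using assms endo_inj_surj[of S f] by (intro bij_imp_permutes) (auto simp: bij_betw_def)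

text \<open>
The block permutation \<open>\<alpha> \<times> \<beta>\<close> of \<open>{1..k} \<union> {k+1..n}\<close>.
\<close>

definition perm_join :: "nat \<Rightarrow> (nat \<Rightarrow> nat) \<Rightarrow> (nat \<Rightarrow> nat) \<Rightarrow> nat \<Rightarrow> nat" where
  "perm_join k \<alpha> \<beta> x = (if x \<le> k then \<alpha> x else k + \<beta> (x - k))"

lemma perm_length_join:
  assumes a: "\<alpha> permutes {1..k}" and b: "\<beta> permutes {1..n - k}" and k: "k \<le> n"
  shows "perm_length n (perm_join k \<alpha> \<beta>) = perm_length k \<alpha> + perm_length (n - k) \<beta>"
proof -
  let ?I = "\<lambda>n \<sigma>. {(i, j). 1 \<le> i \<and> i < j \<and> j \<le> n \<and> \<sigma> j < (\<sigma> i :: nat)}"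
  let ?s = "map_prod ((+) k) ((+) k)"
  have fin: "finite (?I n \<sigma>)" for n and \<sigma> :: "nat \<Rightarrow> nat"
    by (rule finite_subset[of _ "{0..n} \<times> {0..n}"]) auto
  have ain: "\<alpha> x \<le> k" if "x \<le> k" for x
  proof (cases "x = 0")
    case True
    then show ?thesis using permutes_not_in[OF a, of 0] by simp
  next
    case False
    then show ?thesis using permutes_in_image[OF a, of x] that by auto
  qed
  have "?I n (perm_join k \<alpha> \<beta>) = ?I k \<alpha> \<union> ?s ` ?I (n - k) \<beta>"
  proof (intro set_eqI iffI)
    fix z assume z: "z \<in> ?I n (perm_join k \<alpha> \<beta>)"
    obtain i j where ij: "z = (i, j)" by (cases z)
    with z have *: "1 \<le> i" "i < j" "j \<le> n" "perm_join k \<alpha> \<beta> j < perm_join k \<alpha> \<beta> i" by auto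
    show "z \<in> ?I k \<alpha> \<union> ?s ` ?I (n - k) \<beta>"
    proof (cases "i \<le> k")
      case True
      then have "j \<le> k" using * ain[of i] by (auto simp: perm_join_def split: if_splits)
      then show ?thesis using * True ij by (auto simp: perm_join_def)
    next
      case False
      then have "(i - k, j - k) \<in> ?I (n - k) \<beta>" using * by (auto simp: perm_join_def)
      then have "?s (i - k, j - k) \<in> ?s ` ?I (n - k) \<beta>" by (rule imageI)
      then show ?thesis using False * ij by simp
    qed
  next
    fix z assume z: "z \<in> ?I k \<alpha> \<union> ?s ` ?I (n - k) \<beta>"
    then show "z \<in> ?I n (perm_join k \<alpha> \<beta>)" using k by (auto simp: perm_join_def)
  qed
  moreover have "?I k \<alpha> \<inter> ?s ` ?I (n - k) \<beta> = {}" by auto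
  moreover have "card (?s ` ?I (n - k) \<beta>) = card (?I (n - k) \<beta>)"
    by (intro card_image inj_onI) auto
  ultimately show ?thesis using fin by (simp add: perm_length_def card_Un_disjoint)
qed

lemma permutes_stable_complement:
  assumes s: "\<sigma> permutes S" and T: "finite T" "\<sigma> ` T \<subseteq> T" and x: "x \<notin> T"
  shows "\<sigma> x \<notin> T"
proof
  assume "\<sigma> x \<in> T"
  moreover have "\<sigma> ` T = T"
    using T permutes_inj_on[OF s] by (intro endo_inj_surj) auto
  ultimately obtain y where y: "y \<in> T" "\<sigma> x = \<sigma> y" by (metis imageE)
  have "x = y" by (rule injD[OF permutes_inj[OF s] y(2)])
  then show False using x y(1) by simp
qed

lemma bij_betw_perm_join:
  assumes "k \<le> n"
  shows "bij_betw (\<lambda>(\<alpha>, \<beta>). perm_join k \<alpha> \<beta>)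
    ({\<alpha>. \<alpha> permutes {1..k}} \<times> {\<beta>. \<beta> permutes {1..n - k}})
    {\<sigma>. \<sigma> permutes {1..n} \<and> \<sigma> ` {1..k} \<subseteq> {1..k}}"
proof (rule bij_betwI[where g = "\<lambda>\<sigma>. (\<lambda>x. if x \<in> {1..k} then \<sigma> x else x,
    \<lambda>x. if x \<in> {1..n - k} then \<sigma> (k + x) - k else x)"])
  show "(\<lambda>(\<alpha>, \<beta>). perm_join k \<alpha> \<beta>) \<in>
    {\<alpha>. \<alpha> permutes {1..k}} \<times> {\<beta>. \<beta> permutes {1..n - k}} \<rightarrow>
    {\<sigma>. \<sigma> permutes {1..n} \<and> \<sigma> ` {1..k} \<subseteq> {1..k}}"
  proof clarsimp
    fix \<alpha> \<beta> assume a: "\<alpha> permutes {Suc 0..k}" and b: "\<beta> permutes {Suc 0..n - k}"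
    have ain: "\<alpha> x \<in> {1..k}" if "x \<in> {1..k}" for x using permutes_in_image[OF a] that by auto
    have bin: "\<beta> x \<in> {1..n - k}" if "x \<in> {1..n - k}" for x using permutes_in_image[OF b] that by auto
    have "perm_join k \<alpha> \<beta> permutes {Suc 0..n}"
    proof (rule permutes_finiteI)
      fix x assume x: "x \<in> {Suc 0..n}"
      then show "perm_join k \<alpha> \<beta> x \<in> {Suc 0..n}"
      proof (cases "x \<le> k")
        case True
        then show ?thesis using ain[of x] x assms by (auto simp: perm_join_def)
      next
        case False
        then have "x - k \<in> {1..n - k}" using x by auto
        from bin[OF this] show ?thesis using False assms by (auto simp: perm_join_def)
      qed
    next
      fix x assume x: "x \<notin> {Suc 0..n}"
      then show "perm_join k \<alpha> \<beta> x = x"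
        using permutes_not_in[OF a, of x] permutes_not_in[OF b, of "x - k"] assms
        by (auto simp: perm_join_def not_less_eq_eq)
    next
      show "inj_on (perm_join k \<alpha> \<beta>) {Suc 0..n}"
      proof (rule inj_onI)
        fix x y assume xy: "x \<in> {Suc 0..n}" "y \<in> {Suc 0..n}" "perm_join k \<alpha> \<beta> x = perm_join k \<alpha> \<beta> y"
        have cross: "\<alpha> x \<noteq> k + \<beta> (y - k)" if "x \<in> {Suc 0..k}" "y \<in> {Suc k..n}" for x y
        proof -
          have "y - k \<in> {1..n - k}" using that by auto
          then show ?thesis using ain[of x] bin[of "y - k"] that by auto
        qed
        have "x = y" if "\<alpha> x = \<alpha> y"
          by (rule injD[OF permutes_inj[OF a] that])
        moreover have "x - k = y - k" if "\<beta> (x - k) = \<beta> (y - k)"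
          by (rule injD[OF permutes_inj[OF b] that])
        ultimately show "x = y"
          using xy cross[of x y] cross[of y x] by (auto simp: perm_join_def split: if_splits)
      qed
    qed simp
    moreover have "perm_join k \<alpha> \<beta> ` {Suc 0..k} \<subseteq> {Suc 0..k}"
      using ain by (auto simp: perm_join_def)
    ultimately show "perm_join k \<alpha> \<beta> permutes {Suc 0..n} \<and>
      perm_join k \<alpha> \<beta> ` {Suc 0..k} \<subseteq> {Suc 0..k}" by simp
  qed
  have high: "\<sigma> x \<in> {Suc k..n}"
    if s: "\<sigma> permutes {1..n}" and "\<sigma> ` {1..k} \<subseteq> {1..k}" and x: "x \<in> {Suc k..n}" for \<sigma> x
  proof -
    have "\<sigma> x \<notin> {1..k}"
      by (rule permutes_stable_complement[OF s _ that(2)]) (use x in auto)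
    then show ?thesis using permutes_in_image[OF s, of x] x by auto
  qed
  show "(\<lambda>\<sigma>. (\<lambda>x. if x \<in> {1..k} then \<sigma> x else x,
      \<lambda>x. if x \<in> {1..n - k} then \<sigma> (k + x) - k else x)) \<in>
    {\<sigma>. \<sigma> permutes {1..n} \<and> \<sigma> ` {1..k} \<subseteq> {1..k}} \<rightarrow>
    {\<alpha>. \<alpha> permutes {1..k}} \<times> {\<beta>. \<beta> permutes {1..n - k}}"
  proof (rule Pi_I)
    fix \<sigma> assume "\<sigma> \<in> {\<sigma>. \<sigma> permutes {1..n} \<and> \<sigma> ` {1..k} \<subseteq> {1..k}}"
    then have s: "\<sigma> permutes {1..n}" and sk: "\<sigma> ` {1..k} \<subseteq> {1..k}" by auto
    have "(\<lambda>x. if x \<in> {1..k} then \<sigma> x else x) permutes {1..k}"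
    proof (rule permutes_finiteI)
      show "inj_on (\<lambda>x. if x \<in> {1..k} then \<sigma> x else x) {1..k}"
        by (rule inj_onI, rule injD[OF permutes_inj[OF s]]) auto
    qed (use sk in \<open>auto simp: image_subset_iff\<close>)
    moreover have "(\<lambda>x. if x \<in> {1..n - k} then \<sigma> (k + x) - k else x) permutes {1..n - k}"
    proof (rule permutes_finiteI)
      fix x assume x: "x \<in> {1..n - k}"
      then have "k + x \<in> {Suc k..n}" by auto
      with x show "(if x \<in> {1..n - k} then \<sigma> (k + x) - k else x) \<in> {1..n - k}"
        using high[OF s sk, of "k + x"] by auto
    next
      show "inj_on (\<lambda>x. if x \<in> {1..n - k} then \<sigma> (k + x) - k else x) {1..n - k}"
      proof (rule inj_onI)
        fix x y assume xy: "x \<in> {1..n - k}" "y \<in> {1..n - k}"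
          "(if x \<in> {1..n - k} then \<sigma> (k + x) - k else x) = (if y \<in> {1..n - k} then \<sigma> (k + y) - k else y)"
        then have "k + x \<in> {Suc k..n}" "k + y \<in> {Suc k..n}" by auto
        with xy have "\<sigma> (k + x) = \<sigma> (k + y)"
          using high[OF s sk, of "k + x"] high[OF s sk, of "k + y"] by auto
        then have "k + x = k + y" by (rule injD[OF permutes_inj[OF s]])
        then show "x = y" by simp
      qed
    qed auto
    ultimately show "(\<lambda>x. if x \<in> {1..k} then \<sigma> x else x,
        \<lambda>x. if x \<in> {1..n - k} then \<sigma> (k + x) - k else x) \<in>
      {\<alpha>. \<alpha> permutes {1..k}} \<times> {\<beta>. \<beta> permutes {1..n - k}}" by simp
  qed
  fix \<alpha>\<beta> assume "\<alpha>\<beta> \<in> {\<alpha>. \<alpha> permutes {1..k}} \<times> {\<beta>. \<beta> permutes {1..n - k}}"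
  then obtain \<alpha> \<beta> where ab: "\<alpha>\<beta> = (\<alpha>, \<beta>)" "\<alpha> permutes {1..k}" "\<beta> permutes {1..n - k}" by auto
  show "(\<lambda>x. if x \<in> {1..k} then (case \<alpha>\<beta> of (\<alpha>, \<beta>) \<Rightarrow> perm_join k \<alpha> \<beta>) x else x,
      \<lambda>x. if x \<in> {1..n - k} then (case \<alpha>\<beta> of (\<alpha>, \<beta>) \<Rightarrow> perm_join k \<alpha> \<beta>) (k + x) - k else x) = \<alpha>\<beta>"
    unfolding ab(1) using permutes_not_in[OF ab(2)] permutes_not_in[OF ab(3)]
    by (auto simp: perm_join_def fun_eq_iff not_less_eq_eq)
next
  fix \<sigma> assume "\<sigma> \<in> {\<sigma>. \<sigma> permutes {1..n} \<and> \<sigma> ` {1..k} \<subseteq> {1..k}}"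
  then have s: "\<sigma> permutes {1..n}" and sk: "\<sigma> ` {1..k} \<subseteq> {1..k}" by auto
  have "k \<le> \<sigma> x" if "Suc k \<le> x" for x
  proof (cases "x \<le> n")
    case True
    have "\<sigma> x \<notin> {1..k}"
      by (rule permutes_stable_complement[OF s _ sk]) (use that in auto)
    then show ?thesis using permutes_in_image[OF s, of x] that True by auto
  next
    case False
    then show ?thesis using permutes_not_in[OF s, of x] that by auto
  qed
  then show "(case (\<lambda>x. if x \<in> {1..k} then \<sigma> x else x,
      \<lambda>x. if x \<in> {1..n - k} then \<sigma> (k + x) - k else x) of (\<alpha>, \<beta>) \<Rightarrow> perm_join k \<alpha> \<beta>) = \<sigma>"
    using permutes_not_in[OF s] assms
    by (auto simp: perm_join_def fun_eq_iff not_less_eq_eq not_le)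
qed

text \<open>
A zero block forces \<open>\<sigma>\<close> to preserve \<open>{1..k}\<close>, whichever of the two off-diagonal blocks is zero, and
the length is additive on block permutations.
\<close>

lemma cdet_block_triangular:
  assumes t: "central t" and k: "k \<le> n"
    and zero: "(\<forall>p\<in>{k + 1..n}. \<forall>i\<in>{1..k}. G p i = 0) \<or> (\<forall>p\<in>{1..k}. \<forall>i\<in>{k + 1..n}. G p i = 0)"
  shows "cdet t n G = cdet t k G * cdet t (n - k) (\<lambda>j i. G (k + j) (k + i))"
proof -
  let ?U = "{\<sigma>. \<sigma> permutes {1..n}}"
  let ?S = "{\<sigma>. \<sigma> permutes {1..n} \<and> \<sigma> ` {1..k} \<subseteq> {1..k}}"
  let ?F = "\<lambda>\<sigma>. t ^ perm_length n \<sigma> * oprod (\<lambda>j. G j (\<sigma> j)) 1 (n + 1)"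
  let ?A = "\<lambda>\<sigma>. t ^ perm_length k \<sigma> * oprod (\<lambda>j. G j (\<sigma> j)) 1 (k + 1)"
  let ?B = "\<lambda>\<sigma>. t ^ perm_length (n - k) \<sigma> * oprod (\<lambda>j. G (k + j) (k + \<sigma> j)) 1 (n - k + 1)"
  have van: "?F \<sigma> = 0" if "\<sigma> \<in> ?U - ?S" for \<sigma>
  proof -
    have s: "\<sigma> permutes {1..n}" using that by auto
    have "\<exists>p\<in>{1..n}. G p (\<sigma> p) = 0"
      using zero
    proof
      assume z: "\<forall>p\<in>{k + 1..n}. \<forall>i\<in>{1..k}. G p i = 0"
      have "\<exists>p\<in>{k + 1..n}. \<sigma> p \<in> {1..k}"
      proof (rule ccontr)
        assume "\<not> (\<exists>p\<in>{k + 1..n}. \<sigma> p \<in> {1..k})"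
        moreover have "\<sigma> p \<in> {1..n}" if "p \<in> {1..n}" for p
          using permutes_in_image[OF s] that by blast
        ultimately have st: "\<sigma> ` {k + 1..n} \<subseteq> {k + 1..n}" by force
        have "\<sigma> x \<notin> {k + 1..n}" if "x \<in> {1..k}" for x
          by (rule permutes_stable_complement[OF s _ st]) (use that in auto)
        moreover have "\<sigma> x \<in> {1..n}" if "x \<in> {1..k}" for x
          using permutes_in_image[OF s, of x] that k by auto
        ultimately have "\<sigma> ` {1..k} \<subseteq> {1..k}" by force
        then show False using that by auto
      qed
      then show ?thesis using z k by fastforce
    next
      assume z: "\<forall>p\<in>{1..k}. \<forall>i\<in>{k + 1..n}. G p i = 0"
      have "\<not> \<sigma> ` {1..k} \<subseteq> {1..k}" using that s by blast
      then obtain p where p: "p \<in> {1..k}" "\<sigma> p \<notin> {1..k}" by blast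
      moreover have "\<sigma> p \<in> {1..n}" using permutes_in_image[OF s, of p] p k by auto
      ultimately show ?thesis using z k by (intro bexI[of _ p]) auto
    qed
    then obtain p where p: "1 \<le> p" "p \<le> n" "G p (\<sigma> p) = 0" by auto
    have "oprod (\<lambda>j. G j (\<sigma> j)) 1 (n + 1) = 0"
      using oprod_split_at[OF p(1,2), of "\<lambda>j. G j (\<sigma> j)"] p(3) by simp
    then show ?thesis by simp
  qed
  have "cdet t n G = sum ?F ?S"
    unfolding cdet_def
  proof (rule sum.mono_neutral_right)
    show "\<forall>\<sigma>\<in>?U - ?S. ?F \<sigma> = 0" using van by blast
  qed (auto simp: finite_permutations)
  also have "\<dots> = (\<Sum>(\<alpha>, \<beta>)\<in>{\<alpha>. \<alpha> permutes {1..k}} \<times> {\<beta>. \<beta> permutes {1..n - k}}. ?F (perm_join k \<alpha> \<beta>))"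
    using sum.reindex_bij_betw[OF bij_betw_perm_join[OF k], of ?F] by (simp add: case_prod_unfold)
  also have "\<dots> = (\<Sum>(\<alpha>, \<beta>)\<in>{\<alpha>. \<alpha> permutes {1..k}} \<times> {\<beta>. \<beta> permutes {1..n - k}}. ?A \<alpha> * ?B \<beta>)"
  proof (rule sum.cong[OF HOL.refl], clarify)
    fix \<alpha> \<beta> :: "nat \<Rightarrow> nat" assume a: "\<alpha> permutes {1..k}" and b: "\<beta> permutes {1..n - k}"
    let ?\<sigma> = "perm_join k \<alpha> \<beta>"
    have "oprod (\<lambda>j. G j (?\<sigma> j)) 1 (n + 1) =
        oprod (\<lambda>j. G j (?\<sigma> j)) 1 (k + 1) * oprod (\<lambda>j. G j (?\<sigma> j)) (k + 1) (k + (n - k + 1))"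
      using oprod_append[of 1 "k + 1" "n + 1" "\<lambda>j. G j (?\<sigma> j)"] k by simp
    also have "oprod (\<lambda>j. G j (?\<sigma> j)) 1 (k + 1) = oprod (\<lambda>j. G j (\<alpha> j)) 1 (k + 1)"
      by (rule oprod_cong) (simp add: perm_join_def)
    also have "oprod (\<lambda>j. G j (?\<sigma> j)) (k + 1) (k + (n - k + 1)) =
        oprod (\<lambda>j. G (k + j) (k + \<beta> j)) 1 (n - k + 1)"
      unfolding oprod_shift by (rule oprod_cong) (simp add: perm_join_def)
    finally have "?F ?\<sigma> = t ^ perm_length k \<alpha> * t ^ perm_length (n - k) \<beta> *
        (oprod (\<lambda>j. G j (\<alpha> j)) 1 (k + 1) * oprod (\<lambda>j. G (k + j) (k + \<beta> j)) 1 (n - k + 1))"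
      using perm_length_join[OF a b k] by (simp add: power_add)
    also have "\<dots> = ?A \<alpha> * ?B \<beta>"
      by (simp only: mult.assoc central_left_commute[OF central_power[OF t], of "oprod (\<lambda>j. G j (\<alpha> j)) 1 (k + 1)"])
    finally show "?F ?\<sigma> = ?A \<alpha> * ?B \<beta>" .
  qed
  also have "\<dots> = cdet t k G * cdet t (n - k) (\<lambda>j i. G (k + j) (k + i))"
    unfolding cdet_def sum_product sum.cartesian_product ..
  finally show ?thesis .
qed

text \<open>
From the last column down to column \<open>k + 1\<close>, the combination of the columns \<open>1..k\<close> with coefficients
\<open>X\<close> is subtracted. When column \<open>p\<close> is treated, the columns before it are still the original ones,
so each of the terms subtracted repeats a column index in the run from \<open>l \<le> k\<close> to \<open>p\<close> and vanishes.
The choice of \<open>X\<close> clears the upper right block.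
\<close>

lemma cdet_schur_right:
  assumes B: "qmanin t \<kappa> n B" and k: "k \<le> n"
    and X: "\<And>p i. p \<in> {k + 1..n} \<Longrightarrow> i \<in> {1..k} \<Longrightarrow> (\<Sum>l = 1..k. B p i l * X p l) = B p i p"
  shows "cdet t n (\<lambda>j i. B j i j) = cdet t k (\<lambda>j i. B j i j) *
    cdet t (n - k) (\<lambda>j i. B (k + j) (k + i) (k + j) - (\<Sum>l = 1..k. B (k + j) (k + i) l * X (k + j) l))"
proof -
  define S where "S = (\<lambda>p i. B p i p - (\<Sum>l = 1..k. B p i l * X p l))"
  \<comment> \<open>Only the columns after position \<open>q\<close> have been replaced.\<close>
  define H where "H = (\<lambda>q j. if j \<le> q then (\<lambda>i. B j i j) else S j)"
  have t: "central t" using B by (simp add: qmanin_def)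
  have step: "cdet t n (H (Suc q)) = cdet t n (H q)" if q: "k \<le> q" "q < n" for q
  proof -
    let ?r = "Suc q"
    have "H ?r = (H q)(?r := \<lambda>i. S ?r i + (\<Sum>l\<in>{1..k}. B ?r i l * X ?r l))"
      by (auto simp: H_def S_def fun_eq_iff)
    then have "cdet t n (H ?r) = cdet t n ((H q)(?r := S ?r)) +
        (\<Sum>l\<in>{1..k}. cdet t n ((H q)(?r := \<lambda>i. B ?r i l * X ?r l)))"
      using cdet_sum_column[of "{1..k}" ?r n t "H q" "S ?r" "\<lambda>l i. B ?r i l * X ?r l"] q by simp
    also have "(H q)(?r := S ?r) = H q"
      by (auto simp: H_def)
    also have "(\<Sum>l\<in>{1..k}. cdet t n ((H q)(?r := \<lambda>i. B ?r i l * X ?r l))) = 0"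
    proof (rule sum.neutral, rule ballI)
      fix l assume l: "l \<in> {1..k}"
      show "cdet t n ((H q)(?r := \<lambda>i. B ?r i l * X ?r l)) = 0"
        by (rule cdet_repeated_column[OF B, where p = l and r = ?r and Y = 1
              and X = "X ?r l" and c = "\<lambda>j. if j = ?r then l else j"])
           (use q l in \<open>auto simp: H_def fun_eq_iff\<close>)
    qed
    finally show ?thesis by simp
  qed
  have "cdet t n (H q) = cdet t n (H k)" if "k \<le> q" "q \<le> n" for q
    using that by (induction q rule: dec_induct) (auto simp: step)
  from this[of n] have "cdet t n (H n) = cdet t n (H k)"
    using k by simp
  moreover have "cdet t n (H n) = cdet t n (\<lambda>j i. B j i j)" "cdet t k (H k) = cdet t k (\<lambda>j i. B j i j)"
    by (rule cdet_cong; simp add: H_def)+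
  moreover have "cdet t (n - k) (\<lambda>j i. H k (k + j) (k + i)) =
      cdet t (n - k) (\<lambda>j i. B (k + j) (k + i) (k + j) - (\<Sum>l = 1..k. B (k + j) (k + i) l * X (k + j) l))"
    by (rule cdet_cong) (simp add: H_def S_def)
  moreover have "cdet t n (H k) = cdet t k (H k) * cdet t (n - k) (\<lambda>j i. H k (k + j) (k + i))"
    by (rule cdet_block_triangular[OF t k]) (use X in \<open>auto simp: H_def S_def\<close>)
  ultimately show ?thesis by simp
qed

text \<open>
The mirror image: from the first column up to column \<open>k\<close>, combinations of the columns \<open>k+1..n\<close> are
subtracted. The columns after the current one are still the original ones, and now the
coefficients \<open>Y\<close> have to stand on the left.
\<close>

lemma cdet_schur_left:
  assumes B: "qmanin t \<kappa> n B" and k: "k \<le> n"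
    and Y: "\<And>p i. p \<in> {1..k} \<Longrightarrow> i \<in> {k + 1..n} \<Longrightarrow> (\<Sum>l = k + 1..n. Y p l * B p i l) = B p i p"
  shows "cdet t n (\<lambda>j i. B j i j) =
    cdet t k (\<lambda>j i. B j i j - (\<Sum>l = k + 1..n. Y j l * B j i l)) *
    cdet t (n - k) (\<lambda>j i. B (k + j) (k + i) (k + j))"
proof -
  define S where "S = (\<lambda>p i. B p i p - (\<Sum>l = k + 1..n. Y p l * B p i l))"
  \<comment> \<open>Only the columns up to position \<open>q\<close> have been replaced.\<close>
  define H where "H = (\<lambda>q j. if j \<le> q then S j else (\<lambda>i. B j i j))"
  have t: "central t" using B by (simp add: qmanin_def)
  have step: "cdet t n (H q) = cdet t n (H (Suc q))" if q: "q < k" for q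
  proof -
    let ?r = "Suc q"
    have "H q = (H ?r)(?r := \<lambda>i. S ?r i + (\<Sum>l\<in>{k + 1..n}. Y ?r l * B ?r i l))"
      by (auto simp: H_def S_def fun_eq_iff)
    then have "cdet t n (H q) = cdet t n ((H ?r)(?r := S ?r)) +
        (\<Sum>l\<in>{k + 1..n}. cdet t n ((H ?r)(?r := \<lambda>i. Y ?r l * B ?r i l)))"
      using cdet_sum_column[of "{k + 1..n}" ?r n t "H ?r" "S ?r" "\<lambda>l i. Y ?r l * B ?r i l"] q k by simp
    also have "(H ?r)(?r := S ?r) = H ?r"
      by (auto simp: H_def)
    also have "(\<Sum>l\<in>{k + 1..n}. cdet t n ((H ?r)(?r := \<lambda>i. Y ?r l * B ?r i l))) = 0"
    proof (rule sum.neutral, rule ballI)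
      fix l assume l: "l \<in> {k + 1..n}"
      show "cdet t n ((H ?r)(?r := \<lambda>i. Y ?r l * B ?r i l)) = 0"
        by (rule cdet_repeated_column[OF B, where p = ?r and r = l and X = 1
              and Y = "Y ?r l" and c = "\<lambda>j. if j = ?r then l else j"])
           (use q l in \<open>auto simp: H_def fun_eq_iff\<close>)
    qed
    finally show ?thesis by simp
  qed
  have "cdet t n (H 0) = cdet t n (H q)" if "q \<le> k" for q
    using that by (induction q) (auto simp: step)
  from this[of k] have "cdet t n (H 0) = cdet t n (H k)"
    by simp
  moreover have "cdet t n (H 0) = cdet t n (\<lambda>j i. B j i j)"
    "cdet t k (H k) = cdet t k (\<lambda>j i. B j i j - (\<Sum>l = k + 1..n. Y j l * B j i l))"
    by (rule cdet_cong; simp add: H_def S_def)+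
  moreover have "cdet t (n - k) (\<lambda>j i. H k (k + j) (k + i)) =
      cdet t (n - k) (\<lambda>j i. B (k + j) (k + i) (k + j))"
    by (rule cdet_cong) (simp add: H_def)
  moreover have "cdet t n (H k) = cdet t k (H k) * cdet t (n - k) (\<lambda>j i. H k (k + j) (k + i))"
    by (rule cdet_block_triangular[OF t k]) (use Y in \<open>auto simp: H_def S_def\<close>)
  ultimately show ?thesis by simp
qed

section \<open>Block inversion over a noncommutative ring\<close>

lemma sum_mult_assoc:
  fixes a :: "'b \<Rightarrow> 'a::ring_1"
  shows "(\<Sum>k\<in>T. (\<Sum>l\<in>S. a l * b l k) * c k) = (\<Sum>l\<in>S. a l * (\<Sum>k\<in>T. b l k * c k))"
  unfolding sum_distrib_left sum_distrib_right by (subst sum.swap) (simp add: mult.assoc)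

lemma sum_delta_left: "finite S \<Longrightarrow> i \<in> S \<Longrightarrow> (\<Sum>k\<in>S. of_bool (i = k) * (x k :: 'a::ring_1)) = x i"
  by (simp add: of_bool_def if_distrib[of "\<lambda>y. y * _"] sum.delta cong: if_cong)

lemma sum_delta_right: "finite S \<Longrightarrow> j \<in> S \<Longrightarrow> (\<Sum>k\<in>S. (x k :: 'a::ring_1) * of_bool (k = j)) = x j"
  by (simp add: of_bool_def if_distrib[of "\<lambda>y. _ * y"] sum.delta' cong: if_cong)

text \<open>
A two-sided inverse for the ungraded product. Allowing an arbitrary index set \<open>S\<close> avoids
reindexing when blocks are cut out.
\<close>

definition inverse_on :: "'b set \<Rightarrow> ('b \<Rightarrow> 'b \<Rightarrow> 'a::ring_1) \<Rightarrow> ('b \<Rightarrow> 'b \<Rightarrow> 'a) \<Rightarrow> bool" where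
  "inverse_on S A B \<longleftrightarrow> (\<forall>i\<in>S. \<forall>j\<in>S.
     (\<Sum>k\<in>S. A i k * B k j) = of_bool (i = j) \<and> (\<Sum>k\<in>S. B i k * A k j) = of_bool (i = j))"

lemma inverse_onD:
  assumes "inverse_on S A B" "i \<in> S" "j \<in> S"
  shows "(\<Sum>k\<in>S. A i k * B k j) = of_bool (i = j)" "(\<Sum>k\<in>S. B i k * A k j) = of_bool (i = j)"
  using assms by (auto simp: inverse_on_def)

lemma inverse_on_unique:
  assumes "finite S" "inverse_on S A B" "inverse_on S A C" "i \<in> S" "j \<in> S"
  shows "B i j = C i j"
proof -
  have "B i j = (\<Sum>k\<in>S. B i k * (\<Sum>l\<in>S. A k l * C l j))"
    using assms by (simp add: inverse_onD sum_delta_right)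
  also have "\<dots> = (\<Sum>l\<in>S. (\<Sum>k\<in>S. B i k * A k l) * C l j)"
    by (rule sum_mult_assoc[symmetric])
  also have "\<dots> = C i j"
    using assms by (simp add: inverse_onD sum_delta_left)
  finally show ?thesis .
qed

text \<open>
\<open>Y\<close> stands for the inverse of the block with indices in \<open>I\<close>.
\<close>

definition schur_on :: "'b set \<Rightarrow> ('b \<Rightarrow> 'b \<Rightarrow> 'a::ring_1) \<Rightarrow> ('b \<Rightarrow> 'b \<Rightarrow> 'a) \<Rightarrow> 'b \<Rightarrow> 'b \<Rightarrow> 'a" where
  "schur_on I A Y i j = A i j - (\<Sum>b\<in>I. (\<Sum>a\<in>I. A i a * Y a b) * A b j)"

text \<open>
In block form with \<open>A\<^sub>1\<^sub>1 X\<^sub>1\<^sub>2 = - A\<^sub>1\<^sub>2 X\<^sub>2\<^sub>2\<close>: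
\<open>(A\<^sub>2\<^sub>2 - A\<^sub>2\<^sub>1 Y A\<^sub>1\<^sub>2) X\<^sub>2\<^sub>2 = A\<^sub>2\<^sub>2 X\<^sub>2\<^sub>2 + A\<^sub>2\<^sub>1 X\<^sub>1\<^sub>2 = 1\<close>, and symmetrically on the other side.
\<close>

lemma inverse_on_schur:
  fixes A X Y :: "'b \<Rightarrow> 'b \<Rightarrow> 'a::ring_1"
  assumes fin: "finite I" "finite J" and dis: "I \<inter> J = {}"
    and X: "inverse_on (I \<union> J) A X" and Y: "inverse_on I A Y"
  shows "inverse_on J (schur_on I A Y) X"
  unfolding inverse_on_def
proof (intro ballI conjI)
  fix i j assume i: "i \<in> J" and j: "j \<in> J"
  have split: "(\<Sum>k\<in>I \<union> J. f k) = (\<Sum>k\<in>I. f k) + (\<Sum>k\<in>J. f k)" for f :: "'b \<Rightarrow> 'a"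
    using fin dis by (rule sum.union_disjoint)
  have AX: "(\<Sum>c\<in>J. A b c * X c j) = - (\<Sum>c\<in>I. A b c * X c j)" if "b \<in> I" for b
    using inverse_onD(1)[OF X, of b j] that j dis by (auto simp: split eq_neg_iff_add_eq_0 add.commute)
  have XA: "(\<Sum>c\<in>J. X i c * A c a) = - (\<Sum>c\<in>I. X i c * A c a)" if "a \<in> I" for a
    using inverse_onD(2)[OF X, of i a] that i dis by (auto simp: split eq_neg_iff_add_eq_0 add.commute)
  have "(\<Sum>c\<in>J. (\<Sum>b\<in>I. (\<Sum>a\<in>I. A i a * Y a b) * A b c) * X c j) = - (\<Sum>a\<in>I. A i a * X a j)"
  proof -
    have "(\<Sum>c\<in>J. (\<Sum>b\<in>I. (\<Sum>a\<in>I. A i a * Y a b) * A b c) * X c j) =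
        (\<Sum>b\<in>I. (\<Sum>a\<in>I. A i a * Y a b) * (\<Sum>c\<in>J. A b c * X c j))"
      by (rule sum_mult_assoc)
    also have "\<dots> = (\<Sum>b\<in>I. (\<Sum>a\<in>I. A i a * Y a b) * - (\<Sum>c\<in>I. A b c * X c j))"
      by (rule sum.cong) (simp_all add: AX)
    also have "\<dots> = - (\<Sum>b\<in>I. (\<Sum>a\<in>I. A i a * Y a b) * (\<Sum>c\<in>I. A b c * X c j))"
      by (simp add: sum_negf)
    also have "\<dots> = - (\<Sum>a\<in>I. A i a * (\<Sum>c\<in>I. (\<Sum>b\<in>I. Y a b * A b c) * X c j))"
      by (simp only: sum_mult_assoc)
    also have "\<dots> = - (\<Sum>a\<in>I. A i a * X a j)"
      using fin by (simp add: inverse_onD[OF Y] sum_delta_left)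
    finally show ?thesis .
  qed
  then have "(\<Sum>c\<in>J. schur_on I A Y i c * X c j) = (\<Sum>c\<in>I \<union> J. A i c * X c j)"
    by (simp add: schur_on_def left_diff_distrib sum_subtractf split)
  then show "(\<Sum>c\<in>J. schur_on I A Y i c * X c j) = of_bool (i = j)"
    using inverse_onD(1)[OF X, of i j] i j by simp
  have "(\<Sum>c\<in>J. X i c * (\<Sum>b\<in>I. (\<Sum>a\<in>I. A c a * Y a b) * A b j)) = - (\<Sum>b\<in>I. X i b * A b j)"
  proof -
    have "(\<Sum>c\<in>J. X i c * (\<Sum>b\<in>I. (\<Sum>a\<in>I. A c a * Y a b) * A b j)) =
        (\<Sum>b\<in>I. (\<Sum>c\<in>J. X i c * (\<Sum>a\<in>I. A c a * Y a b)) * A b j)"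
      by (rule sum_mult_assoc[symmetric])
    also have "\<dots> = (\<Sum>b\<in>I. (\<Sum>a\<in>I. (\<Sum>c\<in>J. X i c * A c a) * Y a b) * A b j)"
      by (simp only: sum_mult_assoc)
    also have "\<dots> = (\<Sum>b\<in>I. (\<Sum>a\<in>I. - (\<Sum>c\<in>I. X i c * A c a) * Y a b) * A b j)"
      by (simp add: XA)
    also have "\<dots> = - (\<Sum>b\<in>I. (\<Sum>a\<in>I. (\<Sum>c\<in>I. X i c * A c a) * Y a b) * A b j)"
      by (simp add: sum_negf)
    also have "\<dots> = - (\<Sum>b\<in>I. (\<Sum>c\<in>I. X i c * (\<Sum>a\<in>I. A c a * Y a b)) * A b j)"
      by (simp only: sum_mult_assoc)
    also have "\<dots> = - (\<Sum>b\<in>I. X i b * A b j)"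
      using fin by (simp add: inverse_onD[OF Y] sum_delta_right)
    finally show ?thesis .
  qed
  then have "(\<Sum>c\<in>J. X i c * schur_on I A Y c j) = (\<Sum>c\<in>I \<union> J. X i c * A c j)"
    by (simp add: schur_on_def right_diff_distrib sum_subtractf split)
  then show "(\<Sum>c\<in>J. X i c * schur_on I A Y c j) = of_bool (i = j)"
    using inverse_onD(2)[OF X, of i j] i j by simp
qed

text \<open>
The inverse of the upper left block is the Schur complement of \<open>X\<close> with respect to its lower right
block, whose inverse is the Schur complement of \<open>A\<close>: from \<open>X\<^sub>1\<^sub>2 = - Y A\<^sub>1\<^sub>2 X\<^sub>2\<^sub>2\<close> one gets
\<open>X\<^sub>1\<^sub>2 S = - Y A\<^sub>1\<^sub>2\<close>, and \<open>- Y A\<^sub>1\<^sub>2 X\<^sub>2\<^sub>1 = X\<^sub>1\<^sub>1 - Y\<close>.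
\<close>

lemma inverse_block_eq:
  fixes A X Y :: "'b \<Rightarrow> 'b \<Rightarrow> 'a::ring_1"
  assumes fin: "finite I" "finite J" and dis: "I \<inter> J = {}"
    and X: "inverse_on (I \<union> J) A X" and Y: "inverse_on I A Y" and i: "i \<in> I" and j: "j \<in> I"
  shows "Y i j = X i j - (\<Sum>b\<in>J. (\<Sum>a\<in>J. X i a * schur_on I A Y a b) * X b j)"
proof -
  have split: "(\<Sum>k\<in>I \<union> J. f k) = (\<Sum>k\<in>I. f k) + (\<Sum>k\<in>J. f k)" for f :: "'b \<Rightarrow> 'a"
    using fin dis by (rule sum.union_disjoint)
  have S: "inverse_on J (schur_on I A Y) X"
    by (rule inverse_on_schur[OF fin dis X Y])
  have X12: "X i a = - (\<Sum>c\<in>J. (\<Sum>b\<in>I. Y i b * A b c) * X c a)" if a: "a \<in> J" for a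
  proof -
    have AX: "(\<Sum>c\<in>I. A b c * X c a) = - (\<Sum>c\<in>J. A b c * X c a)" if "b \<in> I" for b
      using inverse_onD(1)[OF X, of b a] that a dis by (auto simp: split eq_neg_iff_add_eq_0)
    have "X i a = (\<Sum>c\<in>I. (\<Sum>b\<in>I. Y i b * A b c) * X c a)"
      using fin i by (simp add: inverse_onD[OF Y] sum_delta_left)
    also have "\<dots> = (\<Sum>b\<in>I. Y i b * (\<Sum>c\<in>I. A b c * X c a))"
      by (rule sum_mult_assoc)
    also have "\<dots> = - (\<Sum>b\<in>I. Y i b * (\<Sum>c\<in>J. A b c * X c a))"
      by (simp add: AX sum_negf)
    also have "\<dots> = - (\<Sum>c\<in>J. (\<Sum>b\<in>I. Y i b * A b c) * X c a)"
      by (simp only: sum_mult_assoc)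
    finally show ?thesis .
  qed
  have XS: "(\<Sum>a\<in>J. X i a * schur_on I A Y a b) = - (\<Sum>a\<in>I. Y i a * A a b)" if b: "b \<in> J" for b
  proof -
    have "(\<Sum>a\<in>J. X i a * schur_on I A Y a b) =
        - (\<Sum>a\<in>J. (\<Sum>c\<in>J. (\<Sum>d\<in>I. Y i d * A d c) * X c a) * schur_on I A Y a b)"
      by (simp add: X12 sum_negf)
    also have "\<dots> = - (\<Sum>c\<in>J. (\<Sum>d\<in>I. Y i d * A d c) * (\<Sum>a\<in>J. X c a * schur_on I A Y a b))"
      by (simp only: sum_mult_assoc)
    also have "\<dots> = - (\<Sum>a\<in>I. Y i a * A a b)"
      using fin b by (simp add: inverse_onD[OF S] sum_delta_right)
    finally show ?thesis .
  qed
  have AX: "(\<Sum>b\<in>J. A a b * X b j) = of_bool (a = j) - (\<Sum>b\<in>I. A a b * X b j)" if "a \<in> I" for a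
    using inverse_onD(1)[OF X, of a j] that j by (simp add: split algebra_simps)
  have "(\<Sum>b\<in>J. (\<Sum>a\<in>J. X i a * schur_on I A Y a b) * X b j) =
      - (\<Sum>b\<in>J. (\<Sum>a\<in>I. Y i a * A a b) * X b j)"
    by (simp add: XS sum_negf)
  also have "\<dots> = - (\<Sum>a\<in>I. Y i a * (\<Sum>b\<in>J. A a b * X b j))"
    by (simp only: sum_mult_assoc)
  also have "\<dots> = - (\<Sum>a\<in>I. Y i a * of_bool (a = j)) + (\<Sum>a\<in>I. Y i a * (\<Sum>b\<in>I. A a b * X b j))"
    by (simp add: AX right_diff_distrib sum_subtractf)
  also have "(\<Sum>a\<in>I. Y i a * (\<Sum>b\<in>I. A a b * X b j)) = (\<Sum>b\<in>I. (\<Sum>a\<in>I. Y i a * A a b) * X b j)"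
    by (simp only: sum_mult_assoc)
  also have "\<dots> = X i j"
    using fin i by (simp add: inverse_onD[OF Y] sum_delta_left)
  finally show ?thesis
    using fin j by (simp add: sum_delta_right)
qed

text \<open>
The converse step, for one additional index: the block \<open>LDU\<close> decomposition gives the inverse once
the \<open>1 \<times> 1\<close> Schur complement is invertible.
\<close>

lemma inverse_on_insert:
  assumes fin: "finite I" and n: "n \<notin> I" and Y: "inverse_on I A Y"
    and w: "schur_on I A Y n n * w = 1" "w * schur_on I A Y n n = 1"
  shows "\<exists>X. inverse_on (insert n I) A X"
proof -
  define U where "U i = (\<Sum>a\<in>I. Y i a * A a n)" for i
  define V where "V j = (\<Sum>b\<in>I. A n b * Y b j)" for j
  define X where "X i j = (if i = n then if j = n then w else - (w * V j)
      else if j = n then - (U i * w) else Y i j + U i * w * V j)" for i j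
  have sV: "A n n = schur_on I A Y n n + (\<Sum>b\<in>I. V b * A b n)"
    by (simp add: schur_on_def V_def)
  have sU: "(\<Sum>a\<in>I. A n a * U a) = (\<Sum>b\<in>I. V b * A b n)"
    unfolding U_def V_def by (simp only: sum_mult_assoc)
  have AU: "(\<Sum>a\<in>I. A i a * U a) = A i n" if "i \<in> I" for i
  proof -
    have "(\<Sum>a\<in>I. A i a * U a) = (\<Sum>b\<in>I. (\<Sum>a\<in>I. A i a * Y a b) * A b n)"
      unfolding U_def by (simp only: sum_mult_assoc)
    also have "\<dots> = A i n"
      using fin that by (simp add: inverse_onD[OF Y] sum_delta_left)
    finally show ?thesis .
  qed
  have VA: "(\<Sum>b\<in>I. V b * A b j) = A n j" if "j \<in> I" for j
  proof -
    have "(\<Sum>b\<in>I. V b * A b j) = (\<Sum>a\<in>I. A n a * (\<Sum>b\<in>I. Y a b * A b j))"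
      unfolding V_def by (simp only: sum_mult_assoc)
    also have "\<dots> = A n j"
      using fin that by (simp add: inverse_onD[OF Y] sum_delta_right)
    finally show ?thesis .
  qed
  have ne: "i \<noteq> n" if "i \<in> I" for i using that n by auto
  have c1: "(\<Sum>k\<in>I. f k * X k j) = (\<Sum>k\<in>I. f k * Y k j) + (\<Sum>k\<in>I. f k * U k) * (w * V j)"
    if "j \<in> I" for f j
    using that by (simp add: X_def ne distrib_left sum.distrib sum_distrib_right mult.assoc)
  have c2: "(\<Sum>k\<in>I. f k * X k n) = - ((\<Sum>k\<in>I. f k * U k) * w)" for f
    by (simp add: X_def ne sum_negf sum_distrib_right mult.assoc)
  have c3: "(\<Sum>k\<in>I. X i k * f k) = (\<Sum>k\<in>I. Y i k * f k) + U i * w * (\<Sum>k\<in>I. V k * f k)"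
    if "i \<in> I" for f i
    using that by (simp add: X_def ne distrib_right sum.distrib sum_distrib_left mult.assoc)
  have c4: "(\<Sum>k\<in>I. X n k * f k) = - (w * (\<Sum>k\<in>I. V k * f k))" for f
    by (simp add: X_def ne sum_negf sum_distrib_left mult.assoc)
  have w1: "A n n * w = 1 + (\<Sum>b\<in>I. V b * A b n) * w" "w * A n n = 1 + w * (\<Sum>b\<in>I. V b * A b n)"
    by (simp_all add: sV distrib_left distrib_right w)
  have "inverse_on (insert n I) A X"
    unfolding inverse_on_def
  proof (intro ballI conjI)
    fix i j assume "i \<in> insert n I" "j \<in> insert n I"
    then consider "i = n" "j = n" | "i = n" "j \<in> I" | "i \<in> I" "j = n" | "i \<in> I" "j \<in> I" by auto
    then show "(\<Sum>k\<in>insert n I. A i k * X k j) = of_bool (i = j)"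
    proof cases
      case 1
      then show ?thesis using fin n by (simp add: c2 sU X_def[of n n] w1)
    next
      case 2
      have "A n n * w * V j = V j + (\<Sum>b\<in>I. V b * A b n) * w * V j"
        by (simp add: w1 distrib_right)
      then show ?thesis using 2 fin n ne[of j]
        by (simp add: c1 sU X_def[of n j] mult.assoc flip: V_def)
    next
      case 3
      then show ?thesis using fin n ne[of i] by (simp add: c2 AU X_def[of n n])
    next
      case 4
      then show ?thesis using fin n ne[of j]
        by (simp add: c1 AU X_def[of n j] inverse_onD[OF Y])
    qed
    from \<open>i \<in> insert n I\<close> \<open>j \<in> insert n I\<close>
    consider "i = n" "j = n" | "i = n" "j \<in> I" | "i \<in> I" "j = n" | "i \<in> I" "j \<in> I" by auto
    then show "(\<Sum>k\<in>insert n I. X i k * A k j) = of_bool (i = j)"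
    proof cases
      case 1
      then show ?thesis using fin n by (simp add: c4 X_def[of n n] w1)
    next
      case 2
      then show ?thesis using fin n ne[of j]
        by (simp add: c4 VA X_def[of n n])
    next
      case 3
      have "U i * (w * A n n) = U i + U i * (w * (\<Sum>b\<in>I. V b * A b n))"
        by (simp add: w1 distrib_left)
      then show ?thesis using 3 fin n ne[of i]
        by (simp add: c3 X_def[of i n] mult.assoc flip: U_def)
    next
      case 4
      then show ?thesis using fin n ne[of i]
        by (simp add: c3 VA X_def[of i n] inverse_onD[OF Y])
    qed
  qed
  then show ?thesis by blast
qed

lemma fps_unitI:
  fixes f :: "'a::ring_1 fps"
  assumes "fps_nth f 0 * u = 1" "u * fps_nth f 0 = 1"
  shows "\<exists>g. f * g = 1 \<and> g * f = 1"
proof -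
  have l: "fps_left_inverse f u * f = 1" and r: "f * fps_right_inverse f u = 1"
    using assms by (auto intro: fps_left_inverse fps_right_inverse)
  have "fps_left_inverse f u = fps_left_inverse f u * (f * fps_right_inverse f u)"
    by (simp add: r)
  also have "\<dots> = fps_right_inverse f u"
    by (simp add: l flip: mult.assoc)
  finally show ?thesis using l r by metis
qed

text \<open>
By induction on the size: the new row or the new column has constant terms zero off the diagonal, so the
\<open>1 \<times> 1\<close> Schur complement has the constant term of the new diagonal entry. The alternative in the second
hypothesis covers both triangular shapes, hence both \<open>L\<^sup>+(z)\<close> and \<open>L\<^sup>-(z)\<close>.
\<close>

lemma fps_matrix_invertible:
  fixes A :: "nat \<Rightarrow> nat \<Rightarrow> 'a::ring_1 fps"
  assumes "\<And>i. i \<in> {1..d} \<Longrightarrow> \<exists>u. fps_nth (A i i) 0 * u = 1 \<and> u * fps_nth (A i i) 0 = 1"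
    and "\<And>i. i \<in> {1..d} \<Longrightarrow> (\<forall>a\<in>{1..<i}. fps_nth (A i a) 0 = 0) \<or> (\<forall>a\<in>{1..<i}. fps_nth (A a i) 0 = 0)"
  shows "\<exists>X. inverse_on {1..d} A X"
  using assms
proof (induction d)
  case 0
  then show ?case by (simp add: inverse_on_def)
next
  case (Suc d)
  have "\<exists>Y. inverse_on {1..d} A Y"
    by (rule Suc.IH; rule Suc.prems; simp)
  then obtain Y where Y: "inverse_on {1..d} A Y" ..
  let ?n = "Suc d"
  obtain u where u: "fps_nth (A ?n ?n) 0 * u = 1" "u * fps_nth (A ?n ?n) 0 = 1"
    using Suc.prems(1)[of ?n] by auto
  have "(\<Sum>b = 1..d. (\<Sum>a = 1..d. fps_nth (A ?n a) 0 * fps_nth (Y a b) 0) * fps_nth (A b ?n) 0) = 0"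
    using Suc.prems(2)[of ?n] by auto
  then have "fps_nth (schur_on {1..d} A Y ?n ?n) 0 = fps_nth (A ?n ?n) 0"
    by (simp add: schur_on_def fps_sum_nth)
  then obtain w where "schur_on {1..d} A Y ?n ?n * w = 1" "w * schur_on {1..d} A Y ?n ?n = 1"
    using fps_unitI[of "schur_on {1..d} A Y ?n ?n" u] u by auto
  then have "\<exists>X. inverse_on (insert ?n {1..d}) A X"
    by (intro inverse_on_insert[OF _ _ Y]) auto
  then show ?case by (simp add: atLeastAtMostSuc_conv)
qed

lemma inverse_on_shift:
  fixes A X :: "nat \<Rightarrow> nat \<Rightarrow> 'a::ring_1"
  assumes "inverse_on {k + 1..k + d} A X"
  shows "inverse_on {1..d} (\<lambda>i j. A (k + i) (k + j)) (\<lambda>i j. X (k + i) (k + j))"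
proof -
  have s: "(\<Sum>l = k + 1..k + d. f l) = (\<Sum>l = 1..d. f (k + l))" for f :: "nat \<Rightarrow> 'a"
    using sum.shift_bounds_cl_nat_ivl[of f 1 k d] by (simp add: add.commute)
  show ?thesis
    unfolding inverse_on_def
  proof (intro ballI)
    fix i j assume "i \<in> {1..d}" "j \<in> {1..d}"
    then show "(\<Sum>l = 1..d. A (k + i) (k + l) * X (k + l) (k + j)) = of_bool (i = j) \<and>
        (\<Sum>l = 1..d. X (k + i) (k + l) * A (k + l) (k + j)) = of_bool (i = j)"
      using inverse_onD[OF assms, of "k + i" "k + j"] unfolding s by simp
  qed
qed

text \<open>
The sign \<open>(-1)\<^bsup>(p\<^sub>i + p\<^sub>k)(p\<^sub>k + p\<^sub>j)\<^esup>\<close> of the graded product is the coboundary of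
\<open>(-1)\<^bsup>p\<^sub>i p\<^sub>j + p\<^sub>j\<^esup>\<close>. The latter is \<open>1\<close> whenever \<open>p\<^sub>i = p\<^sub>j\<close>, so the twist is invisible in the even
and in the odd diagonal block.
\<close>

section \<open>The graded product as an ordinary matrix product\<close>

definition twist :: "(nat \<Rightarrow> nat) \<Rightarrow> (nat \<Rightarrow> nat) \<Rightarrow> (nat \<Rightarrow> nat \<Rightarrow> 'a::ring_1) \<Rightarrow> nat \<Rightarrow> nat \<Rightarrow> 'a" where
  "twist p p' A i j = (- 1) ^ (p i * p' j + p' j) * A i j"

lemma twist_twist [simp]: "twist p p' (twist p p' A) = A"
  by (intro ext) (simp add: twist_def minus_one_power_iff)

lemma twist_eq_same_parity: "p i = p' j \<Longrightarrow> twist p p' A i j = A i j"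
  by (simp add: twist_def minus_one_power_iff)

lemma twist_gmul:
  "twist p p'' (gmul d p p' p'' A B) i j = (\<Sum>k = 1..d. twist p p' A i k * twist p' p'' B k j)"
proof -
  have "(- 1) ^ (p i * p'' j + p'' j) * ((- 1) ^ ((p i + p' k) * (p' k + p'' j)) * A i k * B k j) =
      twist p p' A i k * twist p' p'' B k j" for k
    by (simp add: twist_def minus_one_power_iff)
  then show ?thesis
    by (simp add: twist_def[of p p'' "gmul d p p' p'' A B"] gmul_def sum_distrib_left)
qed

lemma is_ginv_iff:
  fixes A B :: "nat \<Rightarrow> nat \<Rightarrow> 'a::ring_1"
  shows "is_ginv d p A B \<longleftrightarrow> inverse_on {1..d} (twist p p A) (twist p p B) \<and>
     (\<forall>i j. i \<notin> {1..d} \<or> j \<notin> {1..d} \<longrightarrow> B i j = 0)"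
proof -
  have "gmul d p p p A B i j = of_bool (i = j) \<longleftrightarrow>
      (\<Sum>k = 1..d. twist p p A i k * twist p p B k j) = of_bool (i = j)" for A B :: "nat \<Rightarrow> nat \<Rightarrow> 'a" and i j
    unfolding twist_gmul[symmetric] by (auto simp: twist_def minus_one_power_iff)
  then show ?thesis unfolding is_ginv_def inverse_on_def by simp
qed

lemma twist_ginv:
  assumes X: "inverse_on {1..d} (twist p p A) X" and ij: "i \<in> {1..d}" "j \<in> {1..d}"
  shows "twist p p (ginv d p A) i j = X i j"
proof -
  \<comment> \<open>\<open>ginv\<close> asks for zeros outside the index range, which makes the inverse unique.\<close>
  define B where "B i j = (if i \<in> {1..d} \<and> j \<in> {1..d} then twist p p X i j else 0)" for i j
  have tB: "twist p p B i j = X i j" if "i \<in> {1..d}" "j \<in> {1..d}" for i j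
    using that by (simp add: B_def twist_def minus_one_power_iff)
  have "inverse_on {1..d} (twist p p A) (twist p p B)"
    using X by (simp add: inverse_on_def tB)
  then have gB: "is_ginv d p A B" unfolding is_ginv_iff by (auto simp: B_def)
  have uniq: "C = B" if "is_ginv d p A C" for C
  proof (intro ext)
    fix i j
    have "twist p p C i j = twist p p B i j" if "i \<in> {1..d}" "j \<in> {1..d}"
      using inverse_on_unique[of "{1..d}" "twist p p A" "twist p p C" "twist p p B" i j]
        \<open>is_ginv d p A C\<close> gB that unfolding is_ginv_iff by simp
    then show "C i j = B i j"
      using that gB unfolding is_ginv_iff
      by (cases "i \<in> {1..d} \<and> j \<in> {1..d}") (auto simp: twist_def minus_one_power_iff split: if_splits)
  qed
  have "ginv d p A = B"
    unfolding ginv_def by (rule the_equality[where P = "is_ginv d p A", OF gB uniq])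
  then show ?thesis using tB ij by simp
qed

text \<open>
The graded Schur complement becomes the ungraded one, because its indices keep the parities that they
have in the original matrix.
\<close>

lemma twist_schur:
  assumes Y: "inverse_on {1..k} (twist (par M) (par M) A) Y"
  shows "twist (\<lambda>i. par M (k + i)) (\<lambda>i. par M (k + i)) (schur M k A) i j =
    schur_on {1..k} (twist (par M) (par M) A) Y (k + i) (k + j)"
proof -
  let ?p2 = "\<lambda>i. par M (k + i)" and ?p1 = "par M"
  let ?G = "gmul k ?p2 ?p1 ?p2 (gmul k ?p2 ?p1 ?p1 (block k 0 A) (ginv k ?p1 (block 0 0 A))) (block 0 k A)"
  have A11: "block 0 0 A = A" by (simp add: block_def fun_eq_iff)
  have "twist ?p2 ?p2 (schur M k A) i j = twist ?p2 ?p2 (block k k A) i j - twist ?p2 ?p2 ?G i j"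
    by (simp add: schur_def Let_def twist_def right_diff_distrib)
  also have "twist ?p2 ?p2 ?G i j =
      (\<Sum>b = 1..k. (\<Sum>a = 1..k. twist ?p1 ?p1 A (k + i) a * Y a b) * twist ?p1 ?p1 A b (k + j))"
    unfolding twist_gmul A11
  proof (intro sum.cong HOL.refl arg_cong2[where f = "(*)"])
    fix a b assume "a \<in> {1..k}" "b \<in> {1..k}"
    then show "twist ?p1 ?p1 (ginv k ?p1 A) a b = Y a b" by (rule twist_ginv[OF Y])
  qed (simp_all add: twist_def block_def)
  also have "twist ?p2 ?p2 (block k k A) i j = twist ?p1 ?p1 A (k + i) (k + j)"
    by (simp add: twist_def block_def)
  finally show ?thesis by (simp add: schur_on_def)
qed

section \<open>The RLL relations without the scalar prefactor\<close>

lemma abs_Uq_simps: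
  "abs_Uq 0 = 0" "abs_Uq 1 = 1" "abs_Uq (x + y) = abs_Uq x + abs_Uq y"
  "abs_Uq (x * y) = abs_Uq x * abs_Uq y" "abs_Uq (- x) = - abs_Uq x"
  "abs_Uq (fsc c) = usc c" "abs_Uq (fl s i j r) = ul s i j r"
  by (simp_all add: zero_Uq.abs_eq one_Uq.abs_eq plus_Uq.abs_eq times_Uq.abs_eq uminus_Uq.abs_eq
      usc.abs_eq ul.abs_eq)

lemma abs_Uq_power: "abs_Uq (x ^ n) = abs_Uq x ^ n"
  by (induction n) (simp_all add: abs_Uq_simps)

lemma abs_Uq_sum: "abs_Uq (sum f S) = (\<Sum>x\<in>S. abs_Uq (f x))"
  by (induction S rule: infinite_finite_induct) (simp_all add: abs_Uq_simps)

text \<open>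
The scalars are the multiples of the empty word.
\<close>

lemma fsc_central: "fsc c * p = p * fsc c"
  by (induction p rule: free_induct)
     (simp_all add: fsc_def distrib_left distrib_right mult_single mult.commute)

lemma usc_simps:
  "usc 0 = 0" "usc 1 = 1" "usc (c + d) = usc c + usc d" "usc (c * d) = usc c * usc d"
  by (simp_all add: fsc_def mult_single single_add flip: abs_Uq_simps)

lemma usc_central: "usc c * x = x * usc c"
proof (induction x rule: Uq.abs_induct)
  case (1 x)
  then show ?case by (metis abs_Uq_simps(4,6) fsc_central)
qed

lemma usc_left_commute: "x * (usc c * y) = usc c * (x * y)"
  by (metis usc_central mult.assoc)

lemma usc_cancel: "c \<noteq> 0 \<Longrightarrow> usc c * x = 0 \<Longrightarrow> x = 0"
proof -
  assume "c \<noteq> 0" "usc c * x = 0"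
  then have "usc (inverse c * c) * x = 0" by (simp only: usc_simps mult.assoc mult_zero_right)
  then show "x = 0" using \<open>c \<noteq> 0\<close> by (simp add: usc_simps)
qed

lemma abs_Uq_tmul:
  "abs_Uq (tmul M D A B i j k l) =
     tmul M D (\<lambda>i j k l. abs_Uq (A i j k l)) (\<lambda>i j k l. abs_Uq (B i j k l)) i j k l"
  by (simp add: tmul_def abs_Uq_simps abs_Uq_sum abs_Uq_power)

lemma tmul_scale:
  fixes c :: "'a::ring_1"
  assumes "\<And>x. c * x = x * c"
  shows "tmul M D (\<lambda>i j k l. c * A i j k l) B i j k l = c * tmul M D A B i j k l"
    and "tmul M D A (\<lambda>i j k l. c * B i j k l) i j k l = c * tmul M D A B i j k l"
proof -
  have "(- 1) ^ e * (c * x) * y = c * ((- 1) ^ e * x * y)" "x * (c * y) = c * (x * y)" for e x y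
    by (metis assms mult.assoc)+
  then show "tmul M D (\<lambda>i j k l. c * A i j k l) B i j k l = c * tmul M D A B i j k l"
    and "tmul M D A (\<lambda>i j k l. c * B i j k l) i j k l = c * tmul M D A B i j k l"
    unfolding tmul_def sum_distrib_left by (simp_all only:)
qed

text \<open>
The image of \<open>Lcoef\<close> in the algebra.
\<close>

definition lcoef :: "pm \<Rightarrow> int \<Rightarrow> nat \<Rightarrow> nat \<Rightarrow> ('m::len0, 'n::len0) Uq" where
  "lcoef s e i j = (case s of Pos \<Rightarrow> (if e \<le> 0 then ul s i j (nat (- e)) else 0)
                         | Neg \<Rightarrow> (if e \<ge> 0 then ul s i j (nat e) else 0))"

lemma abs_Uq_Lcoef: "abs_Uq (Lcoef s e i j) = lcoef s e i j"
  by (cases s) (simp_all add: Lcoef_def lcoef_def abs_Uq_simps)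

lemma abs_Uq_legs:
  "abs_Uq (leg1 (Lcoef s e) i j k l) = leg1 (lcoef s e) i j k l"
  "abs_Uq (leg2 (Lcoef s e) i j k l) = leg2 (lcoef s e) i j k l"
  by (simp_all add: leg1_def leg2_def abs_Uq_Lcoef abs_Uq_simps)

text \<open>
\<open>R_z\<close> and \<open>R_w\<close> are the coefficients of \<open>z\<close> and of \<open>w\<close> in the polynomial matrix \<open>R(z,w)\<close>.
\<close>

definition R_z :: "nat \<Rightarrow> cq tens" where
  "R_z M i j k l = (if i = j \<and> k = l then (if i = k then qi M i else 1)
     else if i = l \<and> j = k then (if i < j then qi M j - inverse (qi M j) else 0) else 0)"

definition R_w :: "nat \<Rightarrow> cq tens" where
  "R_w M i j k l = (if i = j \<and> k = l then (if i = k then - inverse (qi M i) else - 1)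
     else if i = l \<and> j = k then (if i < j then 0 else qi M j - inverse (qi M j)) else 0)"

lemma Rzw_eq: "Rzw M z w i j k l = z * fls_const (R_z M i j k l) + w * fls_const (R_w M i j k l)"
proof (cases "i = j \<and> k = l")
  case True
  show ?thesis unfolding Rzw_def R_z_def R_w_def if_P[OF True] by simp
next
  case no: False
  show ?thesis
  proof (cases "i = l \<and> j = k")
    case True
    show ?thesis unfolding Rzw_def R_z_def R_w_def if_not_P[OF no] if_P[OF True] by simp
  next
    case False
    show ?thesis unfolding Rzw_def R_z_def R_w_def if_not_P[OF no] if_not_P[OF False] by simp
  qed
qed

text \<open>
The series \<open>x f(x) / (xq - q\<^sup>-\<^sup>1)\<close> in the variable \<open>x\<^sup>-\<^sup>1\<close>. The factor \<open>x\<close> makes its constant term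
nonzero, so that it can be cancelled from the \<open>RLL\<close> relation.
\<close>

definition R_prefactor :: "nat \<Rightarrow> nat \<Rightarrow> cq fps" where
  "R_prefactor M N = fser M N * inverse (fps_const qv - fps_const (inverse qv) * fps_X)"

lemma R_prefactor_0: "M \<noteq> N \<Longrightarrow> fps_nth (R_prefactor M N) 0 \<noteq> 0"
  using is_fser_fser[of M N] by (simp add: R_prefactor_def is_fser_def)

lemma Rcoef_eq:
  "Rcoef M N n i j k l = fps_nth (R_prefactor M N) n * R_z M i j k l +
     (if n = 0 then 0 else fps_nth (R_prefactor M N) (n - 1)) * R_w M i j k l"
proof -
  define den where "den = fps_const qv - fps_const (inverse qv) * fps_X"
  have d0: "fps_nth den 0 \<noteq> 0" by (simp add: den_def)
  then have "den \<noteq> 0" by auto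
  have x: "xv * fls_X = 1"
    by (simp add: xv_def fls_X_inv_times_conv_shift fls_X_conv_shift_1)
  have x0: "xv \<noteq> 0" by (simp add: xv_def)
  let ?P = "R_z M i j k l" and ?Q = "R_w M i j k l"
  have den: "xv * fps_to_fls den = xv * fls_const qv - fls_const (inverse qv)"
    using x by (simp add: den_def right_diff_distrib fls_times_fps_to_fls mult.left_commute)
  have num: "xv * fps_to_fls (fps_const ?P + fps_const ?Q * fps_X) = Rzw M xv 1 i j k l"
    using x by (simp add: Rzw_eq distrib_left fls_times_fps_to_fls mult.left_commute)
  have "fps_to_fls (inverse den) * fps_to_fls den = 1"
    using inverse_mult_eq_1[OF d0] by (metis fls_times_fps_to_fls fps_one_to_fls)
  then have inv: "fps_to_fls (inverse den) = 1 / fps_to_fls den"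
    using \<open>den \<noteq> 0\<close> by (simp add: eq_divide_eq)
  have "Rzw M xv 1 i j k l / (xv * fls_const qv - fls_const (inverse qv)) =
      fps_to_fls (fps_const ?P + fps_const ?Q * fps_X) / fps_to_fls den"
    unfolding den[symmetric] num[symmetric] using x0 by simp
  also have "\<dots> = fps_to_fls (inverse den) * fps_to_fls (fps_const ?P + fps_const ?Q * fps_X)"
    by (simp add: inv)
  finally have "fps_to_fls (fser M N) * (Rzw M xv 1 i j k l / (xv * fls_const qv - fls_const (inverse qv))) =
      fps_to_fls (R_prefactor M N * (fps_const ?P + fps_const ?Q * fps_X))"
    by (simp add: R_prefactor_def den_def fls_times_fps_to_fls mult.assoc)
  then have "Rcoef M N n i j k l = fps_nth (R_prefactor M N * (fps_const ?P + fps_const ?Q * fps_X)) n"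
    by (simp add: Rcoef_def)
  also have "R_prefactor M N * (fps_const ?P + fps_const ?Q * fps_X) =
      fps_const ?P * R_prefactor M N + fps_const ?Q * (fps_X * R_prefactor M N)"
    by (simp add: algebra_simps)
  finally show ?thesis by (simp add: mult.commute)
qed

text \<open>
The coefficient of \<open>z\<^sup>a w\<^sup>b\<close> in \<open>t L\<^sub>1(z) L\<^sub>2(w) - L\<^sub>2(w) L\<^sub>1(z) t\<close>, for a constant tensor \<open>t\<close>.
\<close>

definition RLL_defect :: "nat \<Rightarrow> nat \<Rightarrow> pm \<Rightarrow> cq tens \<Rightarrow> int \<Rightarrow> int \<Rightarrow> ('m::len0, 'n::len0) Uq tens" where
  "RLL_defect M D s t a b i j k l =
     tmul M D (\<lambda>i j k l. usc (t i j k l)) (tmul M D (leg1 (lcoef s a)) (leg2 (lcoef s b))) i j k l -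
     tmul M D (tmul M D (leg2 (lcoef s b)) (leg1 (lcoef s a))) (\<lambda>i j k l. usc (t i j k l)) i j k l"

lemma RLL_defect_add:
  "RLL_defect M D s (\<lambda>i j k l. t i j k l + t' i j k l) a b i j k l =
     RLL_defect M D s t a b i j k l + RLL_defect M D s t' a b i j k l"
  by (simp add: RLL_defect_def tmul_def usc_simps distrib_left distrib_right sum.distrib)

lemma RLL_defect_scale:
  "RLL_defect M D s (\<lambda>i j k l. c * t i j k l) a b i j k l =
     usc c * RLL_defect M D s t a b i j k l"
  unfolding RLL_defect_def usc_simps(4) tmul_scale(1)[OF usc_central] tmul_scale(2)[OF usc_central]
  by (rule right_diff_distrib[symmetric])

lemma RLL_defect_eq_0:
  assumes "case s of Pos \<Rightarrow> a > 0 \<or> b > 0 | Neg \<Rightarrow> a < 0 \<or> b < 0"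
  shows "RLL_defect M D s t a b i j k l = (0 :: ('c::len0, 'd::len0) Uq)"
proof -
  have "(\<forall>i j k l. leg1 (lcoef s a) i j k l = (0 :: ('c::len0, 'd::len0) Uq)) \<or>
      (\<forall>i j k l. leg2 (lcoef s b) i j k l = (0 :: ('c, 'd) Uq))"
    using assms by (cases s) (auto simp: lcoef_def leg1_def leg2_def)
  then show ?thesis by (auto simp: RLL_defect_def tmul_def)
qed

text \<open>
A power series with invertible constant term can be cancelled. The sums are finite because \<open>g\<close>
vanishes far out, and the induction runs downwards from there.
\<close>

lemma triangular_system_zero:
  fixes g :: "nat \<Rightarrow> ('m::len0, 'n::len0) Uq"
  assumes h: "h 0 \<noteq> 0" and zero: "\<And>n. n \<ge> n0 \<Longrightarrow> g n = 0"
    and eq: "\<And>n. \<exists>K. (\<Sum>m\<le>K. usc (h m) * g (n + m)) = 0"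
  shows "g n = 0"
proof (induction "n0 - n" arbitrary: n rule: less_induct)
  case less
  show ?case
  proof (cases "n \<ge> n0")
    case True
    then show ?thesis by (rule zero)
  next
    case False
    obtain K where K: "(\<Sum>m\<le>K. usc (h m) * g (n + m)) = 0" using eq by blast
    have "g (n + m) = 0" if "m \<noteq> 0" for m
      using that False by (intro less) auto
    then have "(\<Sum>m\<le>K. usc (h m) * g (n + m)) = (\<Sum>m\<in>{0}. usc (h m) * g (n + m))"
      by (intro sum.mono_neutral_right) auto
    then have "usc (h 0) * g n = 0" using K by simp
    then show ?thesis by (rule usc_cancel[OF h])
  qed
qed

text \<open>
The relation \<open>R(z,w) L\<^sub>1(z) L\<^sub>2(w) = L\<^sub>2(w) L\<^sub>1(z) R(z,w)\<close> with the polynomial \<open>R\<close>-matrix: the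
defining relation is this one multiplied by a scalar series in \<open>w/z\<close>, which is cancelled by
\<open>triangular_system_zero\<close> along the line \<open>(a + n, b - n)\<close>.
\<close>

lemma RLL_coefficients:
  fixes s :: pm
  assumes ijkl: "{i, j, k, l} \<subseteq> {1..LENGTH('m) + LENGTH('n)}" and MN: "LENGTH('m) \<noteq> LENGTH('n)"
  defines "G \<equiv> RLL_defect LENGTH('m) (LENGTH('m) + LENGTH('n)) s"
  shows "G (R_z LENGTH('m)) a b i j k l + G (R_w LENGTH('m)) (a + 1) (b - 1) i j k l
    = (0 :: ('m::len0, 'n::len0) Uq)"
proof -
  let ?M = "LENGTH('m)" and ?N = "LENGTH('n)"
  let ?h = "fps_nth (R_prefactor ?M ?N)"
  define F :: "int \<Rightarrow> int \<Rightarrow> ('m, 'n) Uq" where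
    "F = (\<lambda>a b. G (R_z ?M) a b i j k l + G (R_w ?M) (a + 1) (b - 1) i j k l)"
  have far: "G t (a + int n) (b - int n) i j k l = 0" if "n > nat (\<bar>a\<bar> + \<bar>b\<bar>)" for t a b n
    unfolding G_def by (rule RLL_defect_eq_0) (use that in \<open>auto split: pm.splits\<close>)
  have "(\<Sum>n\<le>nat (\<bar>a\<bar> + \<bar>b\<bar>). usc (?h n) * F (a + int n) (b - int n)) = 0" for a b
  proof -
    let ?B = "nat (\<bar>a\<bar> + \<bar>b\<bar>)"
    have "abs_Uq (RLL 1 s s a b i j k l) = (abs_Uq (LLR 1 s s a b i j k l) :: ('m, 'n) Uq)"
      using RLL_same[OF ijkl, of s a b] by (simp add: Uq.abs_eq_iff)
    then have "0 = (\<Sum>n\<le>?B. G (Rcoef ?M ?N n) (a + int n) (b - int n) i j k l)"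
      unfolding RLL_def LLR_def Let_def G_def RLL_defect_def sum_subtractf
      by (simp add: abs_Uq_sum abs_Uq_tmul abs_Uq_simps abs_Uq_legs)
    also have "\<dots> = (\<Sum>n\<le>?B. usc (?h n) * G (R_z ?M) (a + int n) (b - int n) i j k l) +
        (\<Sum>n\<le>?B. usc (if n = 0 then 0 else ?h (n - 1)) * G (R_w ?M) (a + int n) (b - int n) i j k l)"
      unfolding G_def Rcoef_eq RLL_defect_add RLL_defect_scale sum.distrib ..
    also have "(\<Sum>n\<le>?B. usc (if n = 0 then 0 else ?h (n - 1)) * G (R_w ?M) (a + int n) (b - int n) i j k l) =
        (\<Sum>n\<le>Suc ?B. usc (if n = 0 then 0 else ?h (n - 1)) * G (R_w ?M) (a + int n) (b - int n) i j k l)"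
      using far[of a b "Suc ?B"] by simp
    also have "\<dots> = (\<Sum>n\<le>?B. usc (?h n) * G (R_w ?M) (a + int n + 1) (b - int n - 1) i j k l)"
      unfolding sum.atMost_Suc_shift by (simp add: usc_simps algebra_simps)
    finally show ?thesis by (simp add: F_def distrib_left sum.distrib)
  qed
  note sys = this
  have "F (a + int 0) (b - int 0) = 0"
  proof (rule triangular_system_zero[where h = ?h and g = "\<lambda>n. F (a + int n) (b - int n)"
        and ?n0.0 = "Suc (nat (\<bar>a\<bar> + \<bar>b\<bar>))"])
    show "?h 0 \<noteq> 0" by (rule R_prefactor_0[OF MN])
    show "F (a + int n) (b - int n) = 0" if "n \<ge> Suc (nat (\<bar>a\<bar> + \<bar>b\<bar>))" for n
      using far[of a b n] far[of a b "Suc n"] that by (simp add: F_def algebra_simps)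
    show "\<exists>K. (\<Sum>m\<le>K. usc (?h m) * F (a + int (n + m)) (b - int (n + m))) = 0" for n
      using sys[of "a + int n" "b - int n"] by (auto simp: algebra_simps)
  qed
  then show ?thesis by (simp add: F_def)
qed

section \<open>Series over the algebra, and the substitution of the spectral parameter\<close>

definition zshift :: "pm \<Rightarrow> int \<Rightarrow> ('m::len0, 'n::len0) Uq fps \<Rightarrow> ('m, 'n) Uq fps" where
  "zshift s a f = Abs_fps (\<lambda>r. usc (qv powi ((case s of Pos \<Rightarrow> - a | Neg \<Rightarrow> a) * int r)) * fps_nth f r)"

lemma zsub_eq: "zsub s a A i j = zshift s a (A i j)"
  by (simp add: zsub_def zshift_def)

lemma zshift_nth:
  "fps_nth (zshift s a f) r = usc (qv powi ((case s of Pos \<Rightarrow> - a | Neg \<Rightarrow> a) * int r)) * fps_nth f r"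
  by (simp add: zshift_def)

definition scal :: "cq \<Rightarrow> ('m::len0, 'n::len0) Uq fps" where
  "scal c = fps_const (usc c)"

lemma scal_simps: "scal 0 = 0" "scal 1 = 1" "scal (c + d) = scal c + scal d" "scal (c * d) = scal c * scal d"
  by (simp_all add: scal_def usc_simps)

lemma scal_central: "scal c * x = x * scal c"
  by (simp add: scal_def fps_eq_iff usc_central)

lemma scal_power: "scal (c ^ n) = scal c ^ n"
  by (induction n) (simp_all add: scal_simps)

lemma central_scal: "central (scal c)"
  by (simp add: central_def scal_central)

text \<open>
The scalars of \<open>\<complex>(q)\<close> act on the series as a field, so nonzero ones cancel.
\<close>

lemma scal_cancel: "c \<noteq> 0 \<Longrightarrow> scal c * x = scal c * y \<Longrightarrow> x = y"
proof -
  assume c: "c \<noteq> 0" and "scal c * x = scal c * y"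
  then have "scal (inverse c) * (scal c * x) = scal (inverse c) * (scal c * y)" by simp
  then show "x = y" using c by (simp add: scal_simps(2) flip: mult.assoc scal_simps(4))
qed

lemma zshift_add: "zshift s a (f + g) = zshift s a f + zshift s a g"
  by (simp add: fps_eq_iff zshift_nth distrib_left)

lemma zshift_mult: "zshift s a (f * g) = zshift s a f * zshift s a g"
proof (rule fps_ext)
  fix r
  let ?e = "case s of Pos \<Rightarrow> - a | Neg \<Rightarrow> a"
  have "fps_nth (zshift s a (f * g)) r = (\<Sum>i = 0..r. usc (qv powi (?e * int r)) * (fps_nth f i * fps_nth g (r - i)))"
    by (simp add: zshift_nth fps_mult_nth sum_distrib_left)
  also have "\<dots> = (\<Sum>i = 0..r. usc (qv powi (?e * int i)) * fps_nth f i *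
      (usc (qv powi (?e * int (r - i))) * fps_nth g (r - i)))"
  proof (rule sum.cong[OF HOL.refl])
    fix i assume "i \<in> {0..r}"
    then have "?e * int r = ?e * int i + ?e * int (r - i)" by (simp add: algebra_simps of_nat_diff)
    then have "usc (qv powi (?e * int r)) =
        (usc (qv powi (?e * int i)) * usc (qv powi (?e * int (r - i))) :: ('a, 'b) Uq)"
      by (simp add: power_int_add usc_simps)
    then show "usc (qv powi (?e * int r)) * (fps_nth f i * fps_nth g (r - i)) =
        usc (qv powi (?e * int i)) * fps_nth f i * (usc (qv powi (?e * int (r - i))) * fps_nth g (r - i))"
      by (simp only: mult.assoc usc_left_commute[of "fps_nth f i"])
  qed
  also have "\<dots> = fps_nth (zshift s a f * zshift s a g) r"
    by (simp add: fps_mult_nth zshift_nth)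
  finally show "fps_nth (zshift s a (f * g)) r = fps_nth (zshift s a f * zshift s a g) r" .
qed

lemma zshift_scal [simp]: "zshift s a (scal c) = scal c"
  by (auto simp: fps_eq_iff zshift_nth scal_def usc_simps)

lemma zshift_0 [simp]: "zshift s a 0 = 0"
  and zshift_1 [simp]: "zshift s a 1 = 1"
  using zshift_scal[of s a 0] zshift_scal[of s a 1] by (simp_all add: scal_simps)

lemma zshift_uminus: "zshift s a (- f) = - zshift s a f"
  by (simp add: fps_eq_iff zshift_nth)

lemma zshift_diff: "zshift s a (f - g) = zshift s a f - zshift s a g"
  by (simp add: fps_eq_iff zshift_nth right_diff_distrib)

lemma zshift_sum: "zshift s a (sum f S) = (\<Sum>x\<in>S. zshift s a (f x))"
  by (induction S rule: infinite_finite_induct) (simp_all add: zshift_add)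

lemma zshift_zshift: "zshift s a (zshift s b f) = zshift s (a + b) f"
proof (rule fps_ext)
  fix r
  let ?e = "\<lambda>a. case s of Pos \<Rightarrow> - a | Neg \<Rightarrow> (a :: int)"
  have "?e (a + b) * int r = ?e a * int r + ?e b * int r"
    by (cases s) (simp_all add: algebra_simps)
  then have "usc (qv powi (?e (a + b) * int r)) =
      (usc (qv powi (?e a * int r)) * usc (qv powi (?e b * int r)) :: ('a, 'b) Uq)"
    by (simp add: power_int_add usc_simps)
  then show "fps_nth (zshift s a (zshift s b f)) r = fps_nth (zshift s (a + b) f) r"
    by (simp add: zshift_nth mult.assoc)
qed

section \<open>The RLL relation at a fixed ratio of the spectral parameters\<close>

lemma sum_if_const: "(\<Sum>x\<in>S. if P then h x else 0) = (if P then sum h S else (0 :: 'a::ring_1))"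
  by simp

lemma tmul_leg12:
  assumes "m \<in> {1..D}" "k \<in> {1..D}"
  shows "tmul M D (leg1 A) (leg2 B) i m k n =
    (- 1) ^ ((par M i + par M m) * (par M k + par M n)) * A i m * B k n"
proof -
  have "tmul M D (leg1 A) (leg2 B) i m k n = (\<Sum>j = 1..D. \<Sum>l = 1..D.
      if j = m then if l = k then (- 1) ^ ((par M i + par M m) * (par M k + par M n)) * A i m * B k n else 0 else 0)"
    unfolding tmul_def leg1_def leg2_def
    by (intro sum.cong HOL.refl) (auto simp: minus_one_power_iff)
  then show ?thesis using assms by (simp add: sum_if_const)
qed

lemma tmul_leg21:
  assumes "i \<in> {1..D}" "n \<in> {1..D}"
  shows "tmul M D (leg2 B) (leg1 A) i m k n = B k n * A i m"
proof -
  have "tmul M D (leg2 B) (leg1 A) i m k n = (\<Sum>j = 1..D. \<Sum>l = 1..D.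
      if j = i then if l = n then B k n * A i m else 0 else 0)"
    unfolding tmul_def leg1_def leg2_def
    by (intro sum.cong HOL.refl) (auto simp: minus_one_power_iff)
  then show ?thesis using assms by (simp add: sum_if_const)
qed

lemma tmul_sum:
  "tmul M D (\<lambda>i j k l. \<Sum>x\<in>S. A x i j k l) B i j k l = (\<Sum>x\<in>S. tmul M D (A x) B i j k l)"
  "tmul M D B (\<lambda>i j k l. \<Sum>x\<in>S. A x i j k l) i j k l = (\<Sum>x\<in>S. tmul M D B (A x) i j k l)"
proof -
  have "(\<Sum>j\<in>U. \<Sum>l\<in>V. \<Sum>x\<in>S. f j l x) = (\<Sum>x\<in>S. \<Sum>j\<in>U. \<Sum>l\<in>V. f j l x)"
    for f :: "nat \<Rightarrow> nat \<Rightarrow> 'b \<Rightarrow> 'a" and U V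
    by (simp add: sum.swap[of _ S])
  then show "tmul M D (\<lambda>i j k l. \<Sum>x\<in>S. A x i j k l) B i j k l = (\<Sum>x\<in>S. tmul M D (A x) B i j k l)"
    and "tmul M D B (\<lambda>i j k l. \<Sum>x\<in>S. A x i j k l) i j k l = (\<Sum>x\<in>S. tmul M D B (A x) i j k l)"
    unfolding tmul_def sum_distrib_left sum_distrib_right by (simp_all only:)
qed

lemma tmul_const_nth:
  "fps_nth (tmul M D (\<lambda>i j k l. fps_const (t i j k l)) W i j k l) r =
    tmul M D t (\<lambda>i j k l. fps_nth (W i j k l) r) i j k l"
  "fps_nth (tmul M D W (\<lambda>i j k l. fps_const (t i j k l)) i j k l) r =
    tmul M D (\<lambda>i j k l. fps_nth (W i j k l) r) t i j k l"
  by (simp_all add: tmul_def fps_sum_nth minus_one_power_iff if_distrib[of "\<lambda>x. x * _"]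
      if_distrib[of "\<lambda>x. fps_nth x r"] cong: if_cong)

text \<open>
\<open>R(1, q\<^sup>e)\<close>, that is \<open>R(z,w)/z\<close> at \<open>w = zq\<^sup>e\<close>.
\<close>

definition R_at :: "nat \<Rightarrow> int \<Rightarrow> cq tens" where
  "R_at M e i j k l = R_z M i j k l + qv powi e * R_w M i j k l"

lemma Lmat_nth: "fps_nth (Lmat s i j) r = lcoef s ((case s of Pos \<Rightarrow> - 1 | Neg \<Rightarrow> 1) * int r) i j"
  by (cases s) (simp_all add: Lmat_def lcoef_def)

lemma fps_nth_sign_mult:
  fixes f g :: "'a::ring_1 fps"
  shows "fps_nth ((- 1) ^ p * f * g) r = (\<Sum>x\<le>r. (- 1) ^ p * fps_nth f x * fps_nth g (r - x))"
  by (cases "even p") (simp_all add: fps_mult_nth atLeast0AtMost sum_negf)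

text \<open>
Substituting \<open>w = zq\<^sup>e\<close> in the polynomial relation. A coefficient of the result sums those of the
polynomial relation over a line \<open>a + b = const\<close>; the \<open>w\<close>-part at one point of the line cancels the
\<open>z\<close>-part at the next one, so the sum telescopes.
\<close>

lemma RLL_specialised:
  fixes s :: pm and e :: int
  assumes ijkl: "{i, j, k, l} \<subseteq> {1..LENGTH('m) + LENGTH('n)}" and MN: "LENGTH('m) \<noteq> LENGTH('n)"
  defines "L \<equiv> (Lmat s :: ('m::len0, 'n::len0) umat)" and "M \<equiv> LENGTH('m)" and "D \<equiv> LENGTH('m) + LENGTH('n)"
  defines "L' \<equiv> zsub s e L" and "T \<equiv> \<lambda>i j k l. scal (R_at LENGTH('m) e i j k l)"
  shows "tmul M D T (tmul M D (leg1 L) (leg2 L')) i j k l = tmul M D (tmul M D (leg2 L') (leg1 L)) T i j k l"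
proof (rule fps_ext)
  fix r
  define \<epsilon> :: int where "\<epsilon> = (case s of Pos \<Rightarrow> - 1 | Neg \<Rightarrow> 1)"
  let ?c = "\<lambda>x. usc (qv powi (e * (\<epsilon> * int (r - x)))) :: ('m, 'n) Uq"
  let ?A = "\<lambda>x. leg1 (lcoef s (\<epsilon> * int x)) :: ('m, 'n) Uq tens"
  let ?B = "\<lambda>x. leg2 (lcoef s (\<epsilon> * int (r - x))) :: ('m, 'n) Uq tens"
  let ?t = "\<lambda>i j k l. usc (R_at M e i j k l) :: ('m, 'n) Uq"
  let ?G = "\<lambda>t a b. RLL_defect M D s t a b i j k l :: ('m, 'n) Uq"
  have L'nth: "fps_nth (L' i j) y = usc (qv powi (e * (\<epsilon> * int y))) * lcoef s (\<epsilon> * int y) i j" for i j y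
    by (cases s) (simp_all add: L'_def zsub_def L_def Lmat_nth \<epsilon>_def)
  have Lnth: "fps_nth (L i j) y = lcoef s (\<epsilon> * int y) i j" for i j y
    by (simp add: L_def Lmat_nth \<epsilon>_def)
  have W: "fps_nth (tmul M D (leg1 L) (leg2 L') i j k l) r = (\<Sum>x\<le>r. ?c x * tmul M D (?A x) (?B x) i j k l)"
    if "{i, j, k, l} \<subseteq> {1..D}" for i j k l
    using that by (simp add: tmul_leg12 fps_nth_sign_mult Lnth L'nth usc_left_commute)
  have V: "fps_nth (tmul M D (leg2 L') (leg1 L) i j k l) r = (\<Sum>x\<le>r. ?c x * tmul M D (?B x) (?A x) i j k l)"
    if "{i, j, k, l} \<subseteq> {1..D}" for i j k l
  proof -
    have "fps_nth (tmul M D (leg2 L') (leg1 L) i j k l) r =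
        (\<Sum>x = 0..r. fps_nth (L' k l) x * fps_nth (L i j) (r - x))"
      using that by (simp add: tmul_leg21 fps_mult_nth)
    also have "\<dots> = (\<Sum>x = 0..r. fps_nth (L' k l) (r - x) * fps_nth (L i j) (r - (r - x)))"
      by (rule sum.atLeastAtMost_rev[of _ 0 r, simplified])
    also have "\<dots> = (\<Sum>x\<le>r. ?c x * tmul M D (?B x) (?A x) i j k l)"
      unfolding atLeast0AtMost using that
      by (intro sum.cong) (auto simp: tmul_leg21 Lnth L'nth mult.assoc)
    finally show ?thesis .
  qed
  have lhs: "fps_nth (tmul M D T (tmul M D (leg1 L) (leg2 L')) i j k l) r =
      (\<Sum>x\<le>r. ?c x * tmul M D ?t (tmul M D (?A x) (?B x)) i j k l)"
  proof -
    have "fps_nth (tmul M D T (tmul M D (leg1 L) (leg2 L')) i j k l) r =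
        tmul M D ?t (\<lambda>i j k l. fps_nth (tmul M D (leg1 L) (leg2 L') i j k l) r) i j k l"
      unfolding T_def scal_def M_def by (rule tmul_const_nth)
    also have "\<dots> = tmul M D ?t (\<lambda>i j k l. \<Sum>x\<le>r. ?c x * tmul M D (?A x) (?B x) i j k l) i j k l"
      by (rule tmul_cong) (use ijkl W in \<open>auto simp: D_def\<close>)
    finally show ?thesis by (simp only: tmul_sum tmul_scale(2)[OF usc_central])
  qed
  have rhs: "fps_nth (tmul M D (tmul M D (leg2 L') (leg1 L)) T i j k l) r =
      (\<Sum>x\<le>r. ?c x * tmul M D (tmul M D (?B x) (?A x)) ?t i j k l)"
  proof -
    have "fps_nth (tmul M D (tmul M D (leg2 L') (leg1 L)) T i j k l) r =
        tmul M D (\<lambda>i j k l. fps_nth (tmul M D (leg2 L') (leg1 L) i j k l) r) ?t i j k l"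
      unfolding T_def scal_def M_def by (rule tmul_const_nth)
    also have "\<dots> = tmul M D (\<lambda>i j k l. \<Sum>x\<le>r. ?c x * tmul M D (?B x) (?A x) i j k l) ?t i j k l"
      by (rule tmul_cong) (use ijkl V in \<open>auto simp: D_def\<close>)
    finally show ?thesis by (simp only: tmul_sum tmul_scale(1)[OF usc_central])
  qed
  \<comment> \<open>The telescoping term. It vanishes at both ends of the range: at one end a series has no such
    coefficient, at the other end this holds for the \<open>z\<close>-part that would have to cancel it.\<close>
  define g where "g = (\<lambda>a. usc (qv powi (e * (\<epsilon> * int r - a + 1))) * ?G (R_w M) a (\<epsilon> * int r - a))"
  have summand: "?c x * ?G (R_at M e) (\<epsilon> * int x) (\<epsilon> * int (r - x)) = g (\<epsilon> * int x) - g (\<epsilon> * int x + 1)"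
    if "x \<le> r" for x
  proof -
    have b: "\<epsilon> * int (r - x) = \<epsilon> * int r - \<epsilon> * int x"
      using that by (simp add: of_nat_diff right_diff_distrib)
    have "?G (R_at M e) a b = ?G (R_z M) a b + usc (qv powi e) * ?G (R_w M) a b" for a b
      unfolding R_at_def RLL_defect_add RLL_defect_scale ..
    moreover have "?G (R_z M) a b = - ?G (R_w M) (a + 1) (b - 1)" for a b
      using RLL_coefficients[OF ijkl MN, of s a b] by (simp add: M_def D_def eq_neg_iff_add_eq_0)
    moreover have "usc (qv powi (e * (c + 1))) = (usc (qv powi (e * c)) * usc (qv powi e) :: ('m, 'n) Uq)" for c
      by (simp add: distrib_left power_int_add usc_simps)
    ultimately have "usc (qv powi (e * c)) * ?G (R_at M e) a c =
        usc (qv powi (e * (c + 1))) * ?G (R_w M) a c - usc (qv powi (e * c)) * ?G (R_w M) (a + 1) (c - 1)" for a c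
      by (simp only: distrib_left mult.assoc mult_minus_right) simp
    from this[of "\<epsilon> * int (r - x)" "\<epsilon> * int x"] show ?thesis
      by (simp add: b g_def diff_diff_eq)
  qed
  have z: "?G t a b = 0" if "case s of Pos \<Rightarrow> a > 0 \<or> b > 0 | Neg \<Rightarrow> a < 0 \<or> b < 0" for t a b
    by (rule RLL_defect_eq_0[OF that])
  have zW: "?G (R_w M) a b = 0" if "case s of Pos \<Rightarrow> a - 1 > 0 \<or> b + 1 > 0 | Neg \<Rightarrow> a - 1 < 0 \<or> b + 1 < 0" for a b
    using RLL_coefficients[OF ijkl MN, of s "a - 1" "b + 1"] z[OF that, of "R_z M"] by (simp add: M_def D_def)
  have "(\<Sum>x\<le>r. g (\<epsilon> * int x) - g (\<epsilon> * int x + 1)) = 0"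
  proof (cases s)
    case Neg
    have "(\<Sum>x\<le>r. g (\<epsilon> * int x) - g (\<epsilon> * int x + 1)) = (\<Sum>x\<le>r. g (int x) - g (int (Suc x)))"
      by (simp add: \<epsilon>_def Neg add.commute)
    also have "\<dots> = g (int 0) - g (int (Suc r))"
      by (rule sum_telescope)
    also have "\<dots> = 0"
      using zW[of 0 "int r"] z[of "int (Suc r)" "- 1" "R_w M"] by (simp add: g_def \<epsilon>_def Neg)
    finally show ?thesis .
  next
    case Pos
    have "(\<Sum>x\<le>r. g (\<epsilon> * int x) - g (\<epsilon> * int x + 1)) =
        (\<Sum>x\<le>r. (- g (1 - int x)) - (- g (1 - int (Suc x))))"
      by (simp add: \<epsilon>_def Pos add.commute)
    also have "\<dots> = - g (1 - int 0) - - g (1 - int (Suc r))"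
      by (rule sum_telescope)
    also have "\<dots> = 0"
      using z[of 1 "- int r - 1" "R_w M"] zW[of "- int r" 0] by (simp add: g_def \<epsilon>_def Pos)
    finally show ?thesis .
  qed
  then have "(\<Sum>x\<le>r. ?c x * ?G (R_at M e) (\<epsilon> * int x) (\<epsilon> * int (r - x))) = 0"
    using sum.cong[OF HOL.refl, of "{..r}", OF summand] by simp
  then show "fps_nth (tmul M D T (tmul M D (leg1 L) (leg2 L')) i j k l) r =
      fps_nth (tmul M D (tmul M D (leg2 L') (leg1 L)) T i j k l) r"
    unfolding lhs rhs RLL_defect_def right_diff_distrib sum_subtractf by simp
qed

section \<open>The RLL relation for the inverse matrix\<close>

definition mat_mult_on :: "'b set \<Rightarrow> ('b \<Rightarrow> 'b \<Rightarrow> 'a::ring_1) \<Rightarrow> ('b \<Rightarrow> 'b \<Rightarrow> 'a) \<Rightarrow> 'b \<Rightarrow> 'b \<Rightarrow> 'a" where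
  "mat_mult_on S A B i j = (\<Sum>k\<in>S. A i k * B k j)"

lemma mat_mult_on_assoc: "mat_mult_on S (mat_mult_on S A B) C = mat_mult_on S A (mat_mult_on S B C)"
  by (intro ext) (simp add: mat_mult_on_def sum_mult_assoc)

lemma mat_mult_on_cong:
  "(\<And>k. k \<in> S \<Longrightarrow> A i k = A' i k) \<Longrightarrow> (\<And>k. k \<in> S \<Longrightarrow> B k j = B' k j) \<Longrightarrow> mat_mult_on S A B i j = mat_mult_on S A' B' i j"
  by (simp add: mat_mult_on_def)

lemma mat_mult_on_inverse:
  assumes "finite S" "inverse_on S A X" "j \<in> S"
  shows "mat_mult_on S B (mat_mult_on S A X) i j = B i j" "mat_mult_on S (mat_mult_on S X A) B j i = B j i"
    "mat_mult_on S (mat_mult_on S A X) B j i = B j i"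
  using assms by (simp_all add: mat_mult_on_def inverse_onD sum_delta_left sum_delta_right)

lemma inverse_on_mat_mult:
  assumes fin: "finite S" and A: "inverse_on S A X" and B: "inverse_on S B Y"
  shows "inverse_on S (mat_mult_on S A B) (mat_mult_on S Y X)"
proof -
  have "mat_mult_on S (mat_mult_on S A B) (mat_mult_on S Y X) i j = of_bool (i = j)"
    "mat_mult_on S (mat_mult_on S Y X) (mat_mult_on S A B) i j = of_bool (i = j)" if ij: "i \<in> S" "j \<in> S" for i j
  proof -
    have "mat_mult_on S (mat_mult_on S A B) (mat_mult_on S Y X) i j = mat_mult_on S A (mat_mult_on S (mat_mult_on S B Y) X) i j"
      by (simp only: mat_mult_on_assoc)
    also have "\<dots> = mat_mult_on S A X i j"
      by (rule mat_mult_on_cong) (simp_all add: mat_mult_on_inverse[OF fin B])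
    also have "\<dots> = of_bool (i = j)" using inverse_onD(1)[OF A ij] by (simp add: mat_mult_on_def)
    finally show "mat_mult_on S (mat_mult_on S A B) (mat_mult_on S Y X) i j = of_bool (i = j)" .
    have "mat_mult_on S (mat_mult_on S Y X) (mat_mult_on S A B) i j = mat_mult_on S Y (mat_mult_on S (mat_mult_on S X A) B) i j"
      by (simp only: mat_mult_on_assoc)
    also have "\<dots> = mat_mult_on S Y B i j"
      by (rule mat_mult_on_cong) (simp_all add: mat_mult_on_inverse[OF fin A])
    also have "\<dots> = of_bool (i = j)" using inverse_onD(2)[OF B ij] by (simp add: mat_mult_on_def)
    finally show "mat_mult_on S (mat_mult_on S Y X) (mat_mult_on S A B) i j = of_bool (i = j)" .
  qed
  then show ?thesis unfolding inverse_on_def mat_mult_on_def by blast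
qed

text \<open>
From \<open>T A = B T\<close> one gets \<open>B\<^sup>-\<^sup>1 T = T A\<^sup>-\<^sup>1\<close>.
\<close>

lemma intertwine_inverse:
  assumes fin: "finite S" and A: "inverse_on S A X" and B: "inverse_on S B Y"
    and eq: "\<And>i j. i \<in> S \<Longrightarrow> j \<in> S \<Longrightarrow> mat_mult_on S T A i j = mat_mult_on S B T i j" and ij: "i \<in> S" "j \<in> S"
  shows "mat_mult_on S Y T i j = mat_mult_on S T X i j"
proof -
  have "mat_mult_on S Y T i j = mat_mult_on S (mat_mult_on S Y T) (mat_mult_on S A X) i j"
    by (simp only: mat_mult_on_inverse[OF fin A ij(2)])
  also have "\<dots> = mat_mult_on S Y (mat_mult_on S (mat_mult_on S T A) X) i j"
    by (simp only: mat_mult_on_assoc)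
  also have "\<dots> = mat_mult_on S Y (mat_mult_on S (mat_mult_on S B T) X) i j"
  proof (rule mat_mult_on_cong[OF HOL.refl])
    fix k assume "k \<in> S"
    then show "mat_mult_on S (mat_mult_on S T A) X k j = mat_mult_on S (mat_mult_on S B T) X k j"
      by (intro mat_mult_on_cong[OF _ HOL.refl] eq)
  qed
  also have "\<dots> = mat_mult_on S (mat_mult_on S Y B) (mat_mult_on S T X) i j"
    by (simp only: mat_mult_on_assoc)
  also have "\<dots> = mat_mult_on S T X i j"
    by (rule mat_mult_on_inverse(2)[OF fin B ij(1)])
  finally show ?thesis .
qed

text \<open>
An element of the graded tensor product as a matrix with rows \<open>(i, k)\<close> and columns \<open>(j, l)\<close>. The
sign is the product of the one that identifies \<open>E\<^sub>i\<^sub>j \<otimes> E\<^sub>k\<^sub>l\<close> with a matrix unit of the tensor product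
of the two superspaces, and of the twist for the total parities of the pairs.
\<close>

definition tensor_mat :: "nat \<Rightarrow> 'a::ring_1 tens \<Rightarrow> nat \<times> nat \<Rightarrow> nat \<times> nat \<Rightarrow> 'a" where
  "tensor_mat M A x y = (case x of (i, k) \<Rightarrow> case y of (j, l) \<Rightarrow>
     (- 1) ^ ((par M k + par M l) * par M j +
       ((par M i + par M k) * (par M j + par M l) + (par M j + par M l))) * A i j k l)"

lemma tensor_mat_cancel: "tensor_mat M A (i, k) (j, l) = tensor_mat M B (i, k) (j, l) \<longleftrightarrow> A i j k l = B i j k l"
  by (auto simp: tensor_mat_def minus_one_power_iff split: if_splits)

lemma tensor_mat_tmul:
  "tensor_mat M (tmul M D A B) x y =
     mat_mult_on ({1..D} \<times> {1..D}) (tensor_mat M A) (tensor_mat M B) x y"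
proof -
  obtain i k m n where xy: "x = (i, k)" "y = (m, n)" by (cases x; cases y) auto
  have sign: "even ((pk + pn) * pm + ((pi + pk) * (pm + pn) + (pm + pn)) +
      ((pi + pj + pk + pl) * (pj + pm + pl + pn) + (pk + pl) * (pj + pm))) =
    even (((pk + pl) * pj + ((pi + pk) * (pj + pl) + (pj + pl))) +
      ((pl + pn) * pm + ((pj + pl) * (pm + pn) + (pm + pn))))" for pi pj pk pl pm pn :: nat
    unfolding even_add even_mult_iff by blast
  have pull: "(- 1) ^ a * ((- 1) ^ b * x * y) = (- 1) ^ c * x * ((- 1) ^ d * y)"
    if "even (a + b) = even (c + d)" for a b c d and x y :: 'a
    using that by (auto simp: minus_one_power_iff)
  show ?thesis
    unfolding xy tensor_mat_def tmul_def mat_mult_on_def sum_distrib_left sum.cartesian_product' prod.case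
    by (intro sum.cong HOL.refl pull sign)
qed

lemma tensor_mat_legs:
  "tensor_mat M (leg1 A) (i, k) (j, l) =
     (if k = l then (- 1) ^ (par M k * (par M i + par M j)) * twist (par M) (par M) A i j else 0)"
  "tensor_mat M (leg2 A) (i, k) (j, l) = (if i = j then twist (par M) (par M) A k l else 0)"
  by (auto simp: tensor_mat_def leg1_def leg2_def twist_def minus_one_power_iff)

lemma inverse_on_tensor_mat_legs:
  assumes X: "inverse_on {1..D} (twist (par M) (par M) A) (twist (par M) (par M) X)"
  shows "inverse_on ({1..D} \<times> {1..D}) (tensor_mat M (leg1 A)) (tensor_mat M (leg1 X))"
    and "inverse_on ({1..D} \<times> {1..D}) (tensor_mat M (leg2 A)) (tensor_mat M (leg2 X))"
proof -
  let ?t = "twist (par M) (par M)"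
  have l1: "(\<Sum>z\<in>{1..D} \<times> {1..D}. tensor_mat M (leg1 A) (i, k) z * tensor_mat M (leg1 B) z (j, l)) =
      (if k = l then (- 1) ^ (par M k * (par M i + par M j)) * (\<Sum>a = 1..D. ?t A i a * ?t B a j) else 0)"
    if k: "k \<in> {1..D}" for A B :: "nat \<Rightarrow> nat \<Rightarrow> 'a" and i j k l
  proof -
    have "(\<Sum>z\<in>{1..D} \<times> {1..D}. tensor_mat M (leg1 A) (i, k) z * tensor_mat M (leg1 B) z (j, l)) =
        (\<Sum>a = 1..D. \<Sum>b = 1..D. if b = k then if k = l then
          (- 1) ^ (par M k * (par M i + par M j)) * (?t A i a * ?t B a j) else 0 else 0)"
      unfolding sum.cartesian_product'
      by (intro sum.cong HOL.refl) (auto simp: tensor_mat_legs minus_one_power_iff)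
    then show ?thesis using k by (simp add: sum_distrib_left)
  qed
  have l2: "(\<Sum>z\<in>{1..D} \<times> {1..D}. tensor_mat M (leg2 A) (i, k) z * tensor_mat M (leg2 B) z (j, l)) =
      (if i = j then (\<Sum>b = 1..D. ?t A k b * ?t B b l) else 0)"
    if i: "i \<in> {1..D}" for A B :: "nat \<Rightarrow> nat \<Rightarrow> 'a" and i j k l
  proof -
    have "(\<Sum>z\<in>{1..D} \<times> {1..D}. tensor_mat M (leg2 A) (i, k) z * tensor_mat M (leg2 B) z (j, l)) =
        (\<Sum>a = 1..D. if a = i then if i = j then \<Sum>b = 1..D. ?t A k b * ?t B b l else 0 else 0)"
      unfolding sum.cartesian_product'
      by (intro sum.cong HOL.refl) (auto simp: tensor_mat_legs)
    then show ?thesis using i by simp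
  qed
  have sq: "inverse_on ({1..D} \<times> {1..D}) P Q"
    if "\<And>i k j l. {i, k, j, l} \<subseteq> {1..D} \<Longrightarrow>
      (\<Sum>z\<in>{1..D} \<times> {1..D}. P (i, k) z * Q z (j, l)) = of_bool (i = j \<and> k = l) \<and>
      (\<Sum>z\<in>{1..D} \<times> {1..D}. Q (i, k) z * P z (j, l)) = of_bool (i = j \<and> k = l)"
    for P Q :: "nat \<times> nat \<Rightarrow> nat \<times> nat \<Rightarrow> 'a"
    unfolding inverse_on_def
  proof (intro ballI)
    fix x y assume "x \<in> {1..D} \<times> {1..D}" "y \<in> {1..D} \<times> {1..D}"
    moreover obtain i k j l where "x = (i, k)" "y = (j, l)" by (cases x; cases y) auto
    ultimately show "(\<Sum>z\<in>{1..D} \<times> {1..D}. P x z * Q z y) = of_bool (x = y) \<and>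
        (\<Sum>z\<in>{1..D} \<times> {1..D}. Q x z * P z y) = of_bool (x = y)"
      using that[of i k j l] by simp
  qed
  show "inverse_on ({1..D} \<times> {1..D}) (tensor_mat M (leg1 A)) (tensor_mat M (leg1 X))"
  proof (rule sq)
    fix i k j l assume "{i, k, j, l} \<subseteq> {1..D}"
    then have r: "i \<in> {1..D}" "k \<in> {1..D}" "j \<in> {1..D}" by auto
    show "(\<Sum>z\<in>{1..D} \<times> {1..D}. tensor_mat M (leg1 A) (i, k) z * tensor_mat M (leg1 X) z (j, l)) =
        of_bool (i = j \<and> k = l) \<and>
      (\<Sum>z\<in>{1..D} \<times> {1..D}. tensor_mat M (leg1 X) (i, k) z * tensor_mat M (leg1 A) z (j, l)) =
        of_bool (i = j \<and> k = l)"
      unfolding l1[OF r(2)] inverse_onD[OF X r(1,3)] by (auto simp: minus_one_power_iff)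
  qed
  show "inverse_on ({1..D} \<times> {1..D}) (tensor_mat M (leg2 A)) (tensor_mat M (leg2 X))"
  proof (rule sq)
    fix i k j l assume "{i, k, j, l} \<subseteq> {1..D}"
    then have r: "k \<in> {1..D}" "l \<in> {1..D}" "i \<in> {1..D}" by auto
    show "(\<Sum>z\<in>{1..D} \<times> {1..D}. tensor_mat M (leg2 A) (i, k) z * tensor_mat M (leg2 X) z (j, l)) =
        of_bool (i = j \<and> k = l) \<and>
      (\<Sum>z\<in>{1..D} \<times> {1..D}. tensor_mat M (leg2 X) (i, k) z * tensor_mat M (leg2 A) z (j, l)) =
        of_bool (i = j \<and> k = l)"
      unfolding l2[OF r(3)] inverse_onD[OF X r(1,2)] by auto
  qed
qed

text \<open>
The relation \<open>T L\<^sub>1 L\<^sub>2 = L\<^sub>2 L\<^sub>1 T\<close> intertwines \<open>L\<^sub>1 L\<^sub>2\<close> and \<open>L\<^sub>2 L\<^sub>1\<close>, whose inverses are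
\<open>X\<^sub>2 X\<^sub>1\<close> and \<open>X\<^sub>1 X\<^sub>2\<close>.
\<close>

lemma RLL_inverse:
  assumes rel: "\<And>i j k l. {i, j, k, l} \<subseteq> {1..D} \<Longrightarrow>
      tmul M D T (tmul M D (leg1 A) (leg2 B)) i j k l = tmul M D (tmul M D (leg2 B) (leg1 A)) T i j k l"
    and X: "inverse_on {1..D} (twist (par M) (par M) A) (twist (par M) (par M) X)"
    and Y: "inverse_on {1..D} (twist (par M) (par M) B) (twist (par M) (par M) Y)"
    and ijkl: "{i, j, k, l} \<subseteq> {1..D}"
  shows "tmul M D (tmul M D (leg1 X) (leg2 Y)) T i j k l = tmul M D T (tmul M D (leg2 Y) (leg1 X)) i j k l"
proof -
  let ?S = "{1..D} \<times> {1..D}"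
  let ?A = "tensor_mat M (leg1 A)" and ?B = "tensor_mat M (leg2 B)" and ?X = "tensor_mat M (leg1 X)"
    and ?Y = "tensor_mat M (leg2 Y)" and ?T = "tensor_mat M T"
  note tm = tensor_mat_tmul[abs_def]
  have "mat_mult_on ?S (mat_mult_on ?S ?X ?Y) ?T (i, k) (j, l) = mat_mult_on ?S ?T (mat_mult_on ?S ?Y ?X) (i, k) (j, l)"
  proof (rule intertwine_inverse)
    show "inverse_on ?S (mat_mult_on ?S ?A ?B) (mat_mult_on ?S ?Y ?X)" "inverse_on ?S (mat_mult_on ?S ?B ?A) (mat_mult_on ?S ?X ?Y)"
      by (intro inverse_on_mat_mult inverse_on_tensor_mat_legs X Y; simp)+
    show "mat_mult_on ?S ?T (mat_mult_on ?S ?A ?B) x y = mat_mult_on ?S (mat_mult_on ?S ?B ?A) ?T x y" if "x \<in> ?S" "y \<in> ?S" for x y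
    proof -
      obtain i k j l where xy: "x = (i, k)" "y = (j, l)" by (cases x; cases y) auto
      have "tensor_mat M (tmul M D T (tmul M D (leg1 A) (leg2 B))) x y =
          tensor_mat M (tmul M D (tmul M D (leg2 B) (leg1 A)) T) x y"
        unfolding xy tensor_mat_cancel by (rule rel) (use that xy in auto)
      then show ?thesis by (simp only: tm)
    qed
  qed (use ijkl in auto)
  then have "tensor_mat M (tmul M D (tmul M D (leg1 X) (leg2 Y)) T) (i, k) (j, l) =
      tensor_mat M (tmul M D T (tmul M D (leg2 Y) (leg1 X))) (i, k) (j, l)"
    by (simp only: tm)
  then show ?thesis by (simp only: tensor_mat_cancel)
qed

text \<open>
In a row or column with indices of equal parity, the product with a tensor supported on
\<open>E\<^sub>i\<^sub>i \<otimes> E\<^sub>k\<^sub>k\<close> and \<open>E\<^sub>i\<^sub>k \<otimes> E\<^sub>k\<^sub>i\<close> has at most two terms, and both signs are trivial.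
\<close>

section \<open>Quadratic relations in the even and in the odd block\<close>

lemma tmul_two_terms:
  assumes T: "\<And>i j k l. \<not> (i = j \<and> k = l) \<Longrightarrow> \<not> (i = l \<and> j = k) \<Longrightarrow> T i j k l = 0"
    and ikmn: "{i, k, m, n} \<subseteq> {1..D}" and par: "par M k = par M i" "par M n = par M m"
  shows "tmul M D T W i m k n = T i i k k * W i m k n + (if i = k then 0 else T i k k i * W k m i n)"
    and "tmul M D W T i m k n = W i m k n * T m m n n + (if m = n then 0 else W i n k m * T n m m n)"
proof -
  let ?S = "{1..D} \<times> {1..D}"
  have "tmul M D T W i m k n = (\<Sum>(j, l)\<in>?S. (- 1) ^ ((par M i + par M j + par M k + par M l) *
      (par M j + par M m + par M l + par M n) + (par M k + par M l) * (par M j + par M m)) *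
      T i j k l * W j m l n)"
    unfolding tmul_def sum.cartesian_product ..
  also have "\<dots> = (\<Sum>(j, l)\<in>{(i, k), (k, i)}. (- 1) ^ ((par M i + par M j + par M k + par M l) *
      (par M j + par M m + par M l + par M n) + (par M k + par M l) * (par M j + par M m)) *
      T i j k l * W j m l n)"
  proof (intro sum.mono_neutral_right ballI)
    fix z assume z: "z \<in> ?S - {(i, k), (k, i)}"
    obtain j l where "z = (j, l)" by (cases z)
    with z T[of i j k l] show "(case z of (j, l) \<Rightarrow> (- 1) ^ ((par M i + par M j + par M k + par M l) *
      (par M j + par M m + par M l + par M n) + (par M k + par M l) * (par M j + par M m)) *
      T i j k l * W j m l n) = 0" by auto
  qed (use ikmn in auto)
  also have "\<dots> = T i i k k * W i m k n + (if i = k then 0 else T i k k i * W k m i n)"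
    using par by (cases "i = k") (auto simp: minus_one_power_iff)
  finally show "tmul M D T W i m k n = T i i k k * W i m k n + (if i = k then 0 else T i k k i * W k m i n)" .
  have "tmul M D W T i m k n = (\<Sum>(j, l)\<in>?S. (- 1) ^ ((par M i + par M j + par M k + par M l) *
      (par M j + par M m + par M l + par M n) + (par M k + par M l) * (par M j + par M m)) *
      W i j k l * T j m l n)"
    unfolding tmul_def sum.cartesian_product ..
  also have "\<dots> = (\<Sum>(j, l)\<in>{(m, n), (n, m)}. (- 1) ^ ((par M i + par M j + par M k + par M l) *
      (par M j + par M m + par M l + par M n) + (par M k + par M l) * (par M j + par M m)) *
      W i j k l * T j m l n)"
  proof (intro sum.mono_neutral_right ballI)
    fix z assume z: "z \<in> ?S - {(m, n), (n, m)}"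
    obtain j l where "z = (j, l)" by (cases z)
    with z T[of j m l n] show "(case z of (j, l) \<Rightarrow> (- 1) ^ ((par M i + par M j + par M k + par M l) *
      (par M j + par M m + par M l + par M n) + (par M k + par M l) * (par M j + par M m)) *
      W i j k l * T j m l n) = 0" by auto
  qed (use ikmn in auto)
  also have "\<dots> = W i m k n * T m m n n + (if m = n then 0 else W i n k m * T n m m n)"
    using par by (cases "m = n") (auto simp: minus_one_power_iff)
  finally show "tmul M D W T i m k n = W i m k n * T m m n n + (if m = n then 0 else W i n k m * T n m m n)" .
qed

lemma scal_pull: "z * (scal a * scal b) = scal a * (scal b * z)"
proof -
  have "z * (scal a * scal b) = scal (a * b) * z"
    unfolding scal_simps(4)[symmetric] by (rule scal_central[symmetric])
  then show ?thesis by (simp only: scal_simps mult.assoc)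
qed

definition minus_q_inv :: "('m::len0, 'n::len0) Uq fps" where "minus_q_inv = scal (- inverse qv)"

text \<open>
The factor \<open>\<kappa>\<close> of \<open>qmanin\<close>; its two values are mutually inverse.
\<close>

definition swap_factor :: "nat \<Rightarrow> nat \<Rightarrow> ('m::len0, 'n::len0) Uq fps" where
  "swap_factor a b = scal (if a < b then - qv else - inverse qv)"

lemma R_at_support: "\<not> (i = j \<and> k = l) \<Longrightarrow> \<not> (i = l \<and> j = k) \<Longrightarrow> R_at M e i j k l = 0"
  unfolding R_at_def R_z_def R_w_def by (simp only: if_False) simp

lemma one_minus_q_nz: "e \<noteq> 0 \<Longrightarrow> 1 - qv powi e \<noteq> 0"
  using qv_powi_eq_1_iff[of e] by (auto simp del: qv_powi_eq_1_iff)

lemma qi_eq: "qi M i = (if i \<le> M then qv else inverse qv)"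
  by (simp add: qi_def par_def)

lemma R_at_diag:
  "R_at M e i i k k =
     (if i = k then qi M i - qv powi e * inverse (qi M i) else 1 - qv powi e)"
  by (simp add: R_at_def R_z_def R_w_def)

lemma R_at_swap:
  "i \<noteq> k \<Longrightarrow> R_at M e i k k i = (if i < k then 1 else qv powi e) * (qi M k - inverse (qi M k))"
  by (simp add: R_at_def R_z_def R_w_def)

text \<open>
At \<open>w = zq\<^sup>2\<close> the even block of \<open>R\<close> is \<open>1 - q\<^sup>2\<close> times a q-antisymmetriser.
\<close>

lemma R_at_even:
  assumes "i \<le> M" "k \<le> M"
  shows "R_at M 2 i i k k = (if i = k then 0 else 1 - qv powi 2)"
    and "i \<noteq> k \<Longrightarrow> R_at M 2 i k k i = (1 - qv powi 2) * (if i < k then - inverse qv else - qv)"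
proof -
  have q: "qv powi 2 * inverse qv = qv" by (simp add: power2_eq_square)
  show "R_at M 2 i i k k = (if i = k then 0 else 1 - qv powi 2)"
    unfolding R_at_diag qi_eq if_P[OF assms(1)] q by simp
  assume "i \<noteq> k"
  then show "R_at M 2 i k k i = (1 - qv powi 2) * (if i < k then - inverse qv else - qv)"
    unfolding R_at_swap[OF \<open>i \<noteq> k\<close>] qi_eq if_P[OF assms(2)]
    by (cases "i < k") (simp_all only: if_True if_False left_diff_distrib right_diff_distrib mult_1 q mult_minus_right, simp_all)
qed

text \<open>
In the odd block \<open>q\<close> is replaced by \<open>q\<^sup>-\<^sup>1\<close>, so the degeneration takes place at \<open>w = zq\<^sup>-\<^sup>2\<close>.
\<close>

lemma R_at_odd:
  assumes "M < i" "M < k"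
  shows "R_at M (- 2) i i k k = (if i = k then 0 else 1 - qv powi (- 2))"
    and "i \<noteq> k \<Longrightarrow> R_at M (- 2) i k k i = (1 - qv powi (- 2)) * (if i < k then - qv else - inverse qv)"
proof -
  have q: "qv powi (- 2) * qv = inverse qv" by (simp add: power_int_minus power2_eq_square)
  have ik: "\<not> i \<le> M" "\<not> k \<le> M" using assms by auto
  show "R_at M (- 2) i i k k = (if i = k then 0 else 1 - qv powi (- 2))"
    unfolding R_at_diag qi_eq if_not_P[OF ik(1)] inverse_inverse_eq q by simp
  assume "i \<noteq> k"
  then show "R_at M (- 2) i k k i = (1 - qv powi (- 2)) * (if i < k then - qv else - inverse qv)"
    unfolding R_at_swap[OF \<open>i \<noteq> k\<close>] qi_eq if_not_P[OF ik(2)] inverse_inverse_eq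
    by (cases "i < k") (simp_all only: if_True if_False left_diff_distrib right_diff_distrib mult_1 q mult_minus_right, simp_all)
qed

lemma zshift_of_bool [simp]: "zshift s a (of_bool b) = of_bool b"
  by simp

lemma twist_zsub: "twist p p' (zsub s a A) = zsub s a (twist p p' A)"
  by (intro ext) (simp add: twist_def zsub_eq minus_one_power_iff zshift_uminus)

lemma inverse_on_zsub_ordinary:
  "inverse_on S A X \<Longrightarrow> inverse_on S (zsub s a A) (zsub s a X)"
  unfolding inverse_on_def zsub_eq zshift_mult[symmetric] zshift_sum[symmetric] by simp

lemma inverse_on_zsub:
  "inverse_on S (twist p p A) (twist p p X) \<Longrightarrow>
    inverse_on S (twist p p (zsub s a A)) (twist p p (zsub s a X))"
  by (simp only: twist_zsub inverse_on_zsub_ordinary)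

text \<open>
The \<open>RLL\<close> relation at \<open>w = zq\<^sup>2\<close> in the rows \<open>(i, k)\<close>, divided by \<open>1 - q\<^sup>2\<close>: its left side is the
minor, and its right side shows how the minor depends on the columns \<open>(m, n)\<close>.
\<close>

lemma even_block_relations:
  fixes s :: pm
  assumes MN: "LENGTH('m) \<noteq> LENGTH('n)" and ik: "1 \<le> i" "i < k" "k \<le> LENGTH('m)"
    and m: "m \<in> {1..LENGTH('m)}" and n: "n \<in> {1..LENGTH('m)}"
  defines "L \<equiv> (Lmat s :: ('m::len0, 'n::len0) umat)"
  defines "L' \<equiv> zsub s 2 L"
  shows "m = n \<Longrightarrow> pairdet minus_q_inv (\<lambda>i. L i m) (\<lambda>i. L' i n) i k = 0"
    and "m \<noteq> n \<Longrightarrow> pairdet minus_q_inv (\<lambda>i. L i m) (\<lambda>i. L' i n) i k =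
      swap_factor m n * pairdet minus_q_inv (\<lambda>i. L i n) (\<lambda>i. L' i m) i k"
proof -
  let ?M = "LENGTH('m)" and ?D = "LENGTH('m) + LENGTH('n)"
  let ?T = "\<lambda>i j k l. scal (R_at ?M 2 i j k l) :: ('m, 'n) Uq fps"
  let ?u = "1 - qv powi 2"
  let ?P = "\<lambda>m n. pairdet minus_q_inv (\<lambda>i. L i m) (\<lambda>i. L' i n) i k"
  have par0: "par ?M i = 0" "par ?M k = 0" using ik by (auto simp: par_def)
  have T0: "?T i j k l = 0" if "\<not> (i = j \<and> k = l)" "\<not> (i = l \<and> j = k)" for i j k l
    using R_at_support[OF that] by (simp add: scal_simps)
  have u: "?u \<noteq> 0" by (rule one_minus_q_nz) simp
  have main: "?P m n = (if m = n then 0 else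
      L' k n * L i m + scal (if n < m then - inverse qv else - qv) * (L' k m * L i n))"
    if m: "m \<in> {1..?M}" and n: "n \<in> {1..?M}" for m n
  proof -
    have parm: "par ?M m = 0" "par ?M n = 0" using m n by (auto simp: par_def)
    have D: "{i, k, m, n} \<subseteq> {1..?D}" using ik m n by auto
    have "tmul ?M ?D ?T (tmul ?M ?D (leg1 L) (leg2 L')) i m k n =
        tmul ?M ?D (tmul ?M ?D (leg2 L') (leg1 L)) ?T i m k n"
      unfolding L_def L'_def by (rule RLL_specialised[OF _ MN]) (use D in auto)
    also have "tmul ?M ?D ?T (tmul ?M ?D (leg1 L) (leg2 L')) i m k n =
        ?T i i k k * (L i m * L' k n) + ?T i k k i * (L k m * L' i n)"
      using D ik by (subst tmul_two_terms(1)[OF T0 D]) (auto simp: par0 parm tmul_leg12)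
    also have "?T i i k k = scal ?u"
      using ik by (simp only: R_at_even) simp
    also have "?T i k k i = scal ?u * minus_q_inv"
      using ik unfolding minus_q_inv_def scal_simps(4)[symmetric] by (subst R_at_even(2)) simp_all
    also have "scal ?u * (L i m * L' k n) + scal ?u * minus_q_inv * (L k m * L' i n) = scal ?u * ?P m n"
      by (simp add: pairdet_def distrib_left mult.assoc)
    also have "tmul ?M ?D (tmul ?M ?D (leg2 L') (leg1 L)) ?T i m k n =
        L' k n * L i m * ?T m m n n + (if m = n then 0 else L' k m * L i n * ?T n m m n)"
      using D ik by (subst tmul_two_terms(2)[OF T0 D]) (auto simp: par0 parm tmul_leg21)
    also have "\<dots> = scal ?u * (if m = n then 0 else
        L' k n * L i m + scal (if n < m then - inverse qv else - qv) * (L' k m * L i n))"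
    proof (cases "m = n")
      case True
      then show ?thesis using m by (simp add: R_at_even scal_simps)
    next
      case False
      have "?T m m n n = scal ?u"
        using m n False by (simp only: R_at_even atLeastAtMost_iff if_False)
      moreover have "?T n m m n = scal ?u * scal (if n < m then - inverse qv else - qv)"
        using m n False by (simp only: R_at_even scal_simps(4) atLeastAtMost_iff not_False_eq_True)
      ultimately show ?thesis
        using False by (simp only: if_False scal_pull distrib_left scal_central[symmetric, of "L' k n * L i m" ?u])
    qed
    finally show ?thesis by (rule scal_cancel[OF u])
  qed
  show "m = n \<Longrightarrow> ?P m n = 0" using main[OF m n] by simp
  show "?P m n = swap_factor m n * ?P n m" if "m \<noteq> n"
  proof -
    let ?a = "if n < m then - inverse qv else - qv" and ?b = "if m < n then - inverse qv else - qv"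
    have "?a * ?b = 1" using that by auto
    then have "scal ?a * (scal ?b * x) = x" for x :: "('m, 'n) Uq fps"
      by (simp only: mult.assoc[symmetric] scal_simps(4)[symmetric] scal_simps(2) mult_1)
    then have ab: "x + scal ?a * y = scal ?a * (y + scal ?b * x)" for x y :: "('m, 'n) Uq fps"
      by (simp only: distrib_left) (rule add.commute)
    have a: "swap_factor m n = scal ?a" using that by (auto simp: swap_factor_def)
    show ?thesis
      unfolding a main[OF m n] main[OF n m] if_not_P[OF that] if_not_P[OF that[symmetric]] by (rule ab)
  qed
qed

text \<open>
As before, for the inverse matrix at \<open>w = zq\<^sup>-\<^sup>2\<close>; the roles of rows and columns are exchanged, because
the \<open>R\<close>-matrix now stands on the other side of the product.
\<close>

lemma odd_block_relations:
  fixes s :: pm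
  assumes MN: "LENGTH('m) \<noteq> LENGTH('n)"
    and mn: "LENGTH('m) < m" "m < n" "n \<le> LENGTH('m) + LENGTH('n)"
    and i: "i \<in> {LENGTH('m) + 1..LENGTH('m) + LENGTH('n)}"
    and k: "k \<in> {LENGTH('m) + 1..LENGTH('m) + LENGTH('n)}"
  defines "L \<equiv> (Lmat s :: ('m::len0, 'n::len0) umat)" and "p \<equiv> par LENGTH('m)"
  assumes X: "inverse_on {1..LENGTH('m) + LENGTH('n)} (twist p p L) (twist p p X)"
  defines "X' \<equiv> zsub s (- 2) X"
  shows "i = k \<Longrightarrow> pairdet minus_q_inv (\<lambda>m. X i m) (\<lambda>m. X' k m) m n = 0"
    and "i \<noteq> k \<Longrightarrow> pairdet minus_q_inv (\<lambda>m. X i m) (\<lambda>m. X' k m) m n =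
      swap_factor i k * pairdet minus_q_inv (\<lambda>m. X k m) (\<lambda>m. X' i m) m n"
proof -
  let ?M = "LENGTH('m)" and ?D = "LENGTH('m) + LENGTH('n)"
  let ?T = "\<lambda>i j k l. scal (R_at ?M (- 2) i j k l) :: ('m, 'n) Uq fps"
  let ?u = "1 - qv powi (- 2)"
  let ?L' = "zsub s (- 2) L"
  let ?P = "\<lambda>i k. pairdet minus_q_inv (\<lambda>m. X i m) (\<lambda>m. X' k m) m n"
  have X': "inverse_on {1..?D} (twist p p ?L') (twist p p X')"
    unfolding X'_def by (rule inverse_on_zsub[OF X])
  have parm: "par ?M m = 1" "par ?M n = 1" using mn by (auto simp: par_def)
  have T0: "?T i j k l = 0" if "\<not> (i = j \<and> k = l)" "\<not> (i = l \<and> j = k)" for i j k l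
    using R_at_support[OF that] by (simp add: scal_simps)
  have u: "?u \<noteq> 0" by (rule one_minus_q_nz) simp
  have main: "?P i k = (if i = k then 0 else
      X' k n * X i m + scal (if i < k then - qv else - inverse qv) * (X' i n * X k m))"
    if i: "i \<in> {?M + 1..?D}" and k: "k \<in> {?M + 1..?D}" for i k
  proof -
    have pari: "par ?M i = 1" "par ?M k = 1" using i k by (auto simp: par_def)
    have D: "{i, k, m, n} \<subseteq> {1..?D}" using i k mn by auto
    have "tmul ?M ?D (tmul ?M ?D (leg1 X) (leg2 X')) ?T i m k n =
        tmul ?M ?D ?T (tmul ?M ?D (leg2 X') (leg1 X)) i m k n"
      by (rule RLL_inverse[OF _ X[unfolded p_def] X'[unfolded p_def]])
         (unfold L_def, rule RLL_specialised[OF _ MN], assumption, use D in auto)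
    also have "tmul ?M ?D (tmul ?M ?D (leg1 X) (leg2 X')) ?T i m k n =
        X i m * X' k n * ?T m m n n + X i n * X' k m * ?T n m m n"
      using D mn by (subst tmul_two_terms(2)[OF T0 D]) (auto simp: pari parm tmul_leg12)
    also have "?T m m n n = scal ?u"
      using mn by (simp only: R_at_odd) simp
    also have "?T n m m n = scal ?u * minus_q_inv"
      using mn unfolding minus_q_inv_def scal_simps(4)[symmetric] by (subst R_at_odd(2)) simp_all
    also have "X i m * X' k n * scal ?u + X i n * X' k m * (scal ?u * minus_q_inv) = scal ?u * ?P i k"
      unfolding pairdet_def minus_q_inv_def distrib_left scal_pull scal_central[of ?u "X i m * X' k n"] ..
    also have "tmul ?M ?D ?T (tmul ?M ?D (leg2 X') (leg1 X)) i m k n =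
        ?T i i k k * (X' k n * X i m) + (if i = k then 0 else ?T i k k i * (X' i n * X k m))"
      using D by (subst tmul_two_terms(1)[OF T0 D]) (auto simp: pari parm tmul_leg21)
    also have "\<dots> = scal ?u * (if i = k then 0 else
        X' k n * X i m + scal (if i < k then - qv else - inverse qv) * (X' i n * X k m))"
    proof (cases "i = k")
      case True
      then show ?thesis using i by (simp add: R_at_odd scal_simps)
    next
      case False
      have lt: "?M < i" "?M < k" using i k by auto
      have "?T i i k k = scal ?u"
        using lt False by (simp only: R_at_odd if_False)
      moreover have "?T i k k i = scal ?u * scal (if i < k then - qv else - inverse qv)"
        using lt False by (simp only: R_at_odd scal_simps(4) not_False_eq_True)
      ultimately show ?thesis
        using False by (simp only: if_False distrib_left mult.assoc)
    qed
    finally show ?thesis by (rule scal_cancel[OF u])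
  qed
  show "i = k \<Longrightarrow> ?P i k = 0" using main[OF i k] by simp
  show "?P i k = swap_factor i k * ?P k i" if "i \<noteq> k"
  proof -
    let ?a = "if i < k then - qv else - inverse qv" and ?b = "if k < i then - qv else - inverse qv"
    have "?a * ?b = 1" using that by auto
    then have "scal ?a * (scal ?b * x) = x" for x :: "('m, 'n) Uq fps"
      by (simp only: mult.assoc[symmetric] scal_simps(4)[symmetric] scal_simps(2) mult_1)
    then have ab: "x + scal ?a * y = scal ?a * (y + scal ?b * x)" for x y :: "('m, 'n) Uq fps"
      by (simp only: distrib_left) (rule add.commute)
    show ?thesis
      unfolding swap_factor_def main[OF i k] main[OF k i] if_not_P[OF that] if_not_P[OF that[symmetric]] by (rule ab)
  qed
qed

section \<open>Factorisation of the Berezinian\<close>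

lemma pairdet_zshift:
  "pairdet minus_q_inv (\<lambda>i. zshift s a (u i)) (\<lambda>i. zshift s a (v i)) i j = zshift s a (pairdet minus_q_inv u v i j)"
  by (simp add: pairdet_def zshift_add zshift_mult minus_q_inv_def)

lemma qmanin_even_block:
  assumes "LENGTH('m) \<noteq> LENGTH('n)"
  shows "qmanin minus_q_inv swap_factor LENGTH('m)
    (\<lambda>p i a. zshift s (2 * int p - 2) ((Lmat s :: ('m::len0, 'n::len0) umat) i a))"
  unfolding qmanin_def
proof (intro conjI allI impI; (elim conjE)?)
  show "central (minus_q_inv :: ('m, 'n) Uq fps)" "central (swap_factor a b :: ('m, 'n) Uq fps)" for a b
    by (simp_all add: minus_q_inv_def swap_factor_def central_scal)
  let ?L = "Lmat s :: ('m, 'n) umat"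
  let ?B = "\<lambda>p i a. zshift s (2 * int p - 2) (?L i a)"
  have succ: "?B (Suc p) i a = zshift s (2 * int p - 2) (zsub s 2 ?L i a)" for p i a
    by (simp add: zsub_eq zshift_zshift)
  fix p i j a b
  assume ij: "1 \<le> i" "i < j" "j \<le> LENGTH('m)" and a: "a \<in> {1..LENGTH('m)}" and b: "b \<in> {1..LENGTH('m)}"
  note rel = even_block_relations[OF assms ij, of _ _ s]
  show "pairdet minus_q_inv (\<lambda>i. ?B p i a) (\<lambda>i. ?B (Suc p) i b) i j = 0" if "a = b"
    unfolding succ pairdet_zshift rel(1)[OF a b that] by simp
  show "pairdet minus_q_inv (\<lambda>i. ?B p i a) (\<lambda>i. ?B (Suc p) i b) i j =
      swap_factor a b * pairdet minus_q_inv (\<lambda>i. ?B p i b) (\<lambda>i. ?B (Suc p) i a) i j" if "a \<noteq> b"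
    unfolding succ pairdet_zshift rel(2)[OF a b that] zshift_mult by (simp add: swap_factor_def)
qed

text \<open>
The index order \<open>(a, i)\<close> transposes the block, since the second factor of the Berezinian permutes
columns and not rows.
\<close>

lemma qmanin_odd_block:
  fixes X :: "('m::len0, 'n::len0) umat"
  assumes MN: "LENGTH('m) \<noteq> LENGTH('n)"
    and X: "inverse_on {1..LENGTH('m) + LENGTH('n)} (twist (par LENGTH('m)) (par LENGTH('m)) (Lmat s)) X"
  shows "qmanin minus_q_inv swap_factor LENGTH('n) (\<lambda>p i a. zshift s (c - 2 * int p) (X (LENGTH('m) + a) (LENGTH('m) + i)))"
  unfolding qmanin_def
proof (intro conjI allI impI; (elim conjE)?)
  show "central (minus_q_inv :: ('m, 'n) Uq fps)" "central (swap_factor a b :: ('m, 'n) Uq fps)" for a b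
    by (simp_all add: minus_q_inv_def swap_factor_def central_scal)
  let ?M = "LENGTH('m)"
  let ?X = "twist (par ?M) (par ?M) X"
  let ?B = "\<lambda>p i a. zshift s (c - 2 * int p) (X (?M + a) (?M + i))"
  have tw: "?X (?M + a) (?M + i) = X (?M + a) (?M + i)" if "1 \<le> a" "1 \<le> i" for a i
    by (rule twist_eq_same_parity) (use that in \<open>simp add: par_def\<close>)
  have X': "inverse_on {1..?M + LENGTH('n)} (twist (par ?M) (par ?M) (Lmat s)) (twist (par ?M) (par ?M) ?X)"
    using X by (simp only: twist_twist)
  fix p i j a b
  assume ij: "1 \<le> i" "i < j" "j \<le> LENGTH('n)" and a: "a \<in> {1..LENGTH('n)}" and b: "b \<in> {1..LENGTH('n)}"
  have ab: "?M + a \<in> {?M + 1..?M + LENGTH('n)}" "?M + b \<in> {?M + 1..?M + LENGTH('n)}" using a b by auto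
  have ij': "?M < ?M + i" "?M + i < ?M + j" "?M + j \<le> ?M + LENGTH('n)" using ij by auto
  note rel = odd_block_relations[OF MN ij' ab X']
  have pd: "pairdet minus_q_inv (\<lambda>i. ?B p i a) (\<lambda>i. ?B (Suc p) i b) i j = zshift s (c - 2 * int p)
      (pairdet minus_q_inv (\<lambda>m. ?X (?M + a) m) (\<lambda>m. zsub s (- 2) ?X (?M + b) m) (?M + i) (?M + j))"
    if "a \<in> {1..LENGTH('n)}" "b \<in> {1..LENGTH('n)}" for a b
  proof -
    have succ: "?B (Suc p) i a = zshift s (c - 2 * int p) (zsub s (- 2) ?X (?M + a) (?M + i))"
      if "1 \<le> a" "1 \<le> i" for i a
    proof -
      have e: "c - 2 * int (Suc p) = (c - 2 * int p) + (- 2)" by simp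
      show ?thesis
        using that by (simp only: e zshift_zshift[symmetric] zsub_eq tw)
    qed
    have pos: "1 \<le> a" "1 \<le> b" "1 \<le> i" "1 \<le> j" using that ij by auto
    have "pairdet minus_q_inv (\<lambda>i. ?B p i a) (\<lambda>i. ?B (Suc p) i b) i j =
        pairdet minus_q_inv (\<lambda>m. zshift s (c - 2 * int p) (?X (?M + a) m))
          (\<lambda>m. zshift s (c - 2 * int p) (zsub s (- 2) ?X (?M + b) m)) (?M + i) (?M + j)"
      unfolding pairdet_def succ[OF pos(2,3)] succ[OF pos(2,4)] tw[OF pos(1,3)] tw[OF pos(1,4)] ..
    then show ?thesis unfolding pairdet_zshift .
  qed
  show "pairdet minus_q_inv (\<lambda>i. ?B p i a) (\<lambda>i. ?B (Suc p) i b) i j = 0" if "a = b"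
    unfolding pd[OF a b] using rel(1) that by simp
  show "pairdet minus_q_inv (\<lambda>i. ?B p i a) (\<lambda>i. ?B (Suc p) i b) i j =
      swap_factor a b * pairdet minus_q_inv (\<lambda>i. ?B p i b) (\<lambda>i. ?B (Suc p) i a) i j" if "a \<noteq> b"
    unfolding pd[OF a b] pd[OF b a] using rel(2) that by (simp add: zshift_mult swap_factor_def)
qed

lemma Lmat_invertible:
  assumes "d \<le> LENGTH('m) + LENGTH('n)"
  shows "\<exists>X. inverse_on {1..d} (twist p p (Lmat s :: ('m::len0, 'n::len0) umat)) X"
proof (rule fps_matrix_invertible)
  let ?D = "LENGTH('m) + LENGTH('n)"
  have inv: "ul Neg i i 0 * ul Pos i i 0 = (1 :: ('m, 'n) Uq)" "ul Pos i i 0 * ul Neg i i 0 = (1 :: ('m, 'n) Uq)"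
    if "i \<in> {1..?D}" for i
  proof -
    have "abs_Uq (fl Neg i i 0 * fl Pos i i 0) = (abs_Uq 1 :: ('m, 'n) Uq)"
      "abs_Uq (fl Pos i i 0 * fl Neg i i 0) = (abs_Uq 1 :: ('m, 'n) Uq)"
      using diag_np[OF that] diag_pn[OF that] by (simp_all add: Uq.abs_eq_iff)
    then show "ul Neg i i 0 * ul Pos i i 0 = (1 :: ('m, 'n) Uq)" "ul Pos i i 0 * ul Neg i i 0 = (1 :: ('m, 'n) Uq)"
      by (simp_all add: abs_Uq_simps)
  qed
  have tri: "ul Pos i a 0 = (0 :: ('m, 'n) Uq)" "ul Neg a i 0 = (0 :: ('m, 'n) Uq)"
    if "i \<in> {1..?D}" "a \<in> {1..<i}" for a i
  proof -
    have "a \<in> {1..?D}" "a < i" using that by auto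
    then have "abs_Uq (fl Pos i a 0) = (abs_Uq 0 :: ('m, 'n) Uq)" "abs_Uq (fl Neg a i 0) = (abs_Uq 0 :: ('m, 'n) Uq)"
      using that(1) unfolding Uq.abs_eq_iff by (auto intro: lower0 upper0)
    then show "ul Pos i a 0 = (0 :: ('m, 'n) Uq)" "ul Neg a i 0 = (0 :: ('m, 'n) Uq)"
      by (simp_all add: abs_Uq_simps)
  qed
  let ?A = "twist p p (Lmat s :: ('m, 'n) umat)"
  fix i assume i: "i \<in> {1..d}"
  then have iD: "i \<in> {1..?D}" using assms by auto
  have "\<exists>u. ul s i i 0 * u = (1 :: ('m, 'n) Uq) \<and> u * ul s i i 0 = 1"
    using inv[OF iD] by (cases s) blast+
  then show "\<exists>u. fps_nth (?A i i) 0 * u = 1 \<and> u * fps_nth (?A i i) 0 = 1"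
    by (simp add: twist_eq_same_parity Lmat_def)
  have "(\<forall>a\<in>{1..<i}. ul s i a 0 = (0 :: ('m, 'n) Uq)) \<or> (\<forall>a\<in>{1..<i}. ul s a i 0 = (0 :: ('m, 'n) Uq))"
    using tri[OF iD] by (cases s) blast+
  moreover have "fps_nth (?A i a) 0 = 0" if "ul s i a 0 = (0 :: ('m, 'n) Uq)" for i a
    using that by (simp add: twist_def Lmat_def minus_one_power_iff)
  ultimately show "(\<forall>a\<in>{1..<i}. fps_nth (?A i a) 0 = 0) \<or> (\<forall>a\<in>{1..<i}. fps_nth (?A a i) 0 = 0)"
    by blast
qed

lemma Bq_eq_cdet:
  "Bq s m n A = cdet minus_q_inv m (\<lambda>j i. zshift s (2 * int j - 2) (A i j)) *
    cdet minus_q_inv n (\<lambda>k i. ginv (m + n) (par m) (zsub s (2 * int m - 2 * int k) A) (m + k) (m + i))"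
proof -
  have "(- qv) powi (- int l) = (- inverse qv) ^ l" for l
    by (simp add: power_int_minus power_inverse[symmetric])
  then have "fps_const (usc ((- qv) powi (- int l))) = (minus_q_inv ^ l :: ('a, 'b) Uq fps)" for l
    unfolding minus_q_inv_def scal_power[symmetric] by (simp add: scal_def)
  then show ?thesis unfolding Bq_def cdet_def oprod_def zsub_eq by simp
qed

lemma cdet_0 [simp]: "cdet t 0 G = 1"
proof -
  have "perm_length 0 \<sigma> = 0" for \<sigma>
    unfolding perm_length_def by (intro card_eq_0_iff[THEN iffD2] disjI1) auto
  then show ?thesis by (simp add: cdet_def oprod_def)
qed

lemma ginv_zsub:
  assumes X: "inverse_on {1..d} (twist p p A) X" and ij: "i \<in> {1..d}" "j \<in> {1..d}" "p i = p j"
  shows "ginv d p (zsub s a A) i j = zshift s a (X i j)"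
proof -
  have "inverse_on {1..d} (twist p p (zsub s a A)) (zsub s a X)"
    unfolding twist_zsub by (rule inverse_on_zsub_ordinary[OF X])
  from twist_ginv[OF this ij(1,2)] show ?thesis
    by (simp add: twist_eq_same_parity ij(3) zsub_eq)
qed

lemma zshift_schur_on: "schur_on I (zsub s a A) (zsub s a Y) i j = zshift s a (schur_on I A Y i j)"
  by (simp add: schur_on_def zsub_eq zshift_diff zshift_sum zshift_mult)

lemma inverse_on_cong:
  assumes "\<And>i j. i \<in> S \<Longrightarrow> j \<in> S \<Longrightarrow> A i j = A' i j"
  shows "inverse_on S A X \<longleftrightarrow> inverse_on S A' X"
  using assms by (simp add: inverse_on_def)

lemma twist_schur_zsub:
  assumes Y: "inverse_on {1..k} (twist (par M) (par M) L) Y"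
  shows "twist (\<lambda>i. par M (k + i)) (\<lambda>i. par M (k + i)) (schur M k (zsub s a L)) i j =
    zshift s a (schur_on {1..k} (twist (par M) (par M) L) Y (k + i) (k + j))"
proof -
  have "inverse_on {1..k} (twist (par M) (par M) (zsub s a L)) (zsub s a Y)"
    unfolding twist_zsub by (rule inverse_on_zsub_ordinary[OF Y])
  then show ?thesis
    by (simp only: twist_schur twist_zsub zshift_schur_on)
qed

lemma inverse_on_schur_zsub:
  assumes k: "k \<le> D" and Y: "inverse_on {1..k} (twist (par M) (par M) L) Y"
    and X: "inverse_on {1..D} (twist (par M) (par M) L) X"
  shows "inverse_on {1..D - k}
    (twist (\<lambda>i. par M (k + i)) (\<lambda>i. par M (k + i)) (schur M k (zsub s a L)))
    (\<lambda>i j. zshift s a (X (k + i) (k + j)))"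
proof -
  have "{1..k} \<union> {k + 1..k + (D - k)} = {1..D}" "{1..k} \<inter> {k + 1..k + (D - k)} = {}" using k by auto
  then have "inverse_on {k + 1..k + (D - k)} (schur_on {1..k} (twist (par M) (par M) L) Y) X"
    by (intro inverse_on_schur) (use X Y in simp_all)
  then have "inverse_on {1..D - k} (\<lambda>i j. schur_on {1..k} (twist (par M) (par M) L) Y (k + i) (k + j))
      (\<lambda>i j. X (k + i) (k + j))"
    by (rule inverse_on_shift)
  then have "inverse_on {1..D - k} (zsub s a (\<lambda>i j. schur_on {1..k} (twist (par M) (par M) L) Y (k + i) (k + j)))
      (zsub s a (\<lambda>i j. X (k + i) (k + j)))"
    by (rule inverse_on_zsub_ordinary)
  then show ?thesis
    unfolding inverse_on_def by (simp only: zsub_eq twist_schur_zsub[OF Y])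
qed

lemma block_0_0: "block 0 0 A = A"
  by (simp add: block_def fun_eq_iff)

text \<open>
The quantum determinant of the even block splits by \<open>cdet_schur_right\<close>. The odd parts of the two sides
agree term by term, because the inverse of the Schur complement is a block of \<open>L\<^sup>-\<^sup>1\<close>.
\<close>

lemma Bq_schur_even:
  fixes s :: pm
  assumes MN: "LENGTH('m) \<noteq> LENGTH('n)" and k: "k < LENGTH('m)"
  defines "L \<equiv> (Lmat s :: ('m::len0, 'n::len0) umat)" and "M \<equiv> LENGTH('m)" and "N \<equiv> LENGTH('n)"
  shows "Bq s M N L = Bq s k 0 (block 0 0 L) * Bq s (M - k) N (schur M k (zsub s (2 * int k) L))"
proof -
  let ?p = "par M" and ?t = "minus_q_inv :: ('m, 'n) Uq fps"
  let ?S = "schur M k (zsub s (2 * int k) L)"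
  have kM: "k < M" using k by (simp add: M_def)
  obtain X where X: "inverse_on {1..M + N} (twist ?p ?p L) X"
    using Lmat_invertible[where 'm = 'm and 'n = 'n, of "M + N" ?p s] by (auto simp: L_def M_def N_def)
  obtain Y where Y: "inverse_on {1..k} (twist ?p ?p L) Y"
    using Lmat_invertible[where 'm = 'm and 'n = 'n, of k ?p s] kM by (auto simp: L_def M_def N_def)
  have twL: "twist ?p ?p L i j = L i j" if "i \<le> M" "j \<le> M" for i j
    by (rule twist_eq_same_parity) (use that in \<open>simp add: par_def\<close>)
  have par_eq: "par (M - k) = (\<lambda>i. par M (k + i))"
    using kM by (auto simp: par_def fun_eq_iff)
  have LY: "(\<Sum>l = 1..k. L i l * (\<Sum>b = 1..k. Y l b * L b p)) = L i p" if i: "i \<in> {1..k}" and p: "p \<le> M" for i p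
  proof -
    have "(\<Sum>l = 1..k. L i l * (\<Sum>b = 1..k. Y l b * L b p)) = (\<Sum>b = 1..k. (\<Sum>l = 1..k. L i l * Y l b) * L b p)"
      by (rule sum_mult_assoc[symmetric])
    also have "\<dots> = (\<Sum>b = 1..k. of_bool (i = b) * L b p)"
    proof (rule sum.cong[OF HOL.refl])
      fix b assume b: "b \<in> {1..k}"
      have "(\<Sum>l = 1..k. L i l * Y l b) = (\<Sum>l = 1..k. twist ?p ?p L i l * Y l b)"
        by (intro sum.cong HOL.refl) (use i kM in \<open>simp add: twL\<close>)
      then show "(\<Sum>l = 1..k. L i l * Y l b) * L b p = of_bool (i = b) * L b p"
        using inverse_onD(1)[OF Y i b] by simp
    qed
    also have "\<dots> = L i p" using i by (intro sum_delta_left) auto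
    finally show ?thesis .
  qed
  let ?B = "\<lambda>p i a. zshift s (2 * int p - 2) (L i a)"
  let ?V = "\<lambda>p l. zshift s (2 * int p - 2) (\<Sum>b = 1..k. Y l b * L b p)"
  have "cdet ?t M (\<lambda>j i. ?B j i j) = cdet ?t k (\<lambda>j i. ?B j i j) *
      cdet ?t (M - k) (\<lambda>j i. ?B (k + j) (k + i) (k + j) - (\<Sum>l = 1..k. ?B (k + j) (k + i) l * ?V (k + j) l))"
  proof (rule cdet_schur_right)
    show "qmanin ?t swap_factor M ?B" unfolding M_def L_def by (rule qmanin_even_block[OF MN])
    show "(\<Sum>l = 1..k. ?B p i l * ?V p l) = ?B p i p" if "p \<in> {k + 1..M}" "i \<in> {1..k}" for p i
      using LY[OF that(2), of p] that(1) by (simp flip: zshift_mult zshift_sum)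
  qed (use kM in simp)
  also have "cdet ?t (M - k) (\<lambda>j i. ?B (k + j) (k + i) (k + j) - (\<Sum>l = 1..k. ?B (k + j) (k + i) l * ?V (k + j) l)) =
      cdet ?t (M - k) (\<lambda>j i. zshift s (2 * int j - 2) (?S i j))"
  proof (rule cdet_cong)
    fix j i assume ji: "1 \<le> j" "j \<le> M - k" "1 \<le> i" "i \<le> M - k"
    then have le: "k + i \<le> M" "k + j \<le> M" using kM by auto
    have "?S i j = twist (\<lambda>i. par M (k + i)) (\<lambda>i. par M (k + i)) ?S i j"
      by (rule twist_eq_same_parity[symmetric]) (use le in \<open>simp add: par_def\<close>)
    also have "\<dots> = zshift s (2 * int k) (schur_on {1..k} (twist ?p ?p L) Y (k + i) (k + j))"
      by (rule twist_schur_zsub[OF Y])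
    also have "schur_on {1..k} (twist ?p ?p L) Y (k + i) (k + j) =
        L (k + i) (k + j) - (\<Sum>b = 1..k. (\<Sum>a = 1..k. L (k + i) a * Y a b) * L b (k + j))"
      unfolding schur_on_def using le kM by (simp add: twL)
    also have "\<dots> = L (k + i) (k + j) - (\<Sum>a = 1..k. L (k + i) a * (\<Sum>b = 1..k. Y a b * L b (k + j)))"
      by (simp only: sum_mult_assoc)
    finally show "?B (k + j) (k + i) (k + j) - (\<Sum>l = 1..k. ?B (k + j) (k + i) l * ?V (k + j) l) =
        zshift s (2 * int j - 2) (?S i j)"
      by (simp add: zshift_zshift algebra_simps flip: zshift_mult zshift_sum zshift_diff)
  qed
  finally have top: "cdet ?t M (\<lambda>j i. ?B j i j) = cdet ?t k (\<lambda>j i. ?B j i j) *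
      cdet ?t (M - k) (\<lambda>j i. zshift s (2 * int j - 2) (?S i j))" .
  have bottom: "ginv (M + N) ?p (zsub s (2 * int M - 2 * int c) L) (M + c) (M + i) =
      ginv (M - k + N) (par (M - k)) (zsub s (2 * int (M - k) - 2 * int c) ?S) (M - k + c) (M - k + i)"
    if "1 \<le> c" "c \<le> N" "1 \<le> i" "i \<le> N" for c i
  proof -
    let ?a = "2 * int M - 2 * int c" and ?a' = "2 * int (M - k) - 2 * int c"
    have "ginv (M + N) ?p (zsub s ?a L) (M + c) (M + i) = zshift s ?a (X (M + c) (M + i))"
      by (rule ginv_zsub[OF X]) (use that in \<open>auto simp: par_def\<close>)
    moreover have "ginv (M - k + N) (par (M - k)) (zsub s ?a' ?S) (M - k + c) (M - k + i) =
        zshift s ?a' (zshift s (2 * int k) (X (k + (M - k + c)) (k + (M - k + i))))"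
    proof (rule ginv_zsub)
      have "M + N - k = M - k + N" using kM by simp
      then show "inverse_on {1..M - k + N} (twist (par (M - k)) (par (M - k)) ?S)
          (\<lambda>i j. zshift s (2 * int k) (X (k + i) (k + j)))"
        unfolding par_eq using inverse_on_schur_zsub[OF _ Y X, of s "2 * int k"] kM by simp
    qed (use that in \<open>auto simp: par_def\<close>)
    moreover have "k + (M - k + c) = M + c" "k + (M - k + i) = M + i" "?a' + 2 * int k = ?a"
      using kM by (auto simp: of_nat_diff)
    ultimately show ?thesis by (simp only: zshift_zshift)
  qed
  have "cdet ?t N (\<lambda>c i. ginv (M + N) ?p (zsub s (2 * int M - 2 * int c) L) (M + c) (M + i)) =
      cdet ?t N (\<lambda>c i. ginv (M - k + N) (par (M - k)) (zsub s (2 * int (M - k) - 2 * int c) ?S) (M - k + c) (M - k + i))"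
    by (rule cdet_cong) (rule bottom)
  then show ?thesis
    unfolding Bq_eq_cdet block_0_0 top by (simp add: mult.assoc)
qed

text \<open>
The even parts of the two sides are equal, and the determinant of the odd block of \<open>L\<^sup>-\<^sup>1\<close> splits by
\<open>cdet_schur_left\<close>, with \<open>h = k - M\<close> and the lower right block of \<open>L\<^sup>-\<^sup>1\<close> inverted by the Schur
complement \<open>Z\<close> of \<open>L\<close>.
\<close>

lemma Bq_schur_odd:
  fixes s :: pm
  assumes MN: "LENGTH('m) \<noteq> LENGTH('n)" and k: "LENGTH('m) \<le> k" "k \<le> LENGTH('m) + LENGTH('n)"
  defines "L \<equiv> (Lmat s :: ('m::len0, 'n::len0) umat)" and "M \<equiv> LENGTH('m)" and "N \<equiv> LENGTH('n)"
  shows "Bq s M N L = Bq s M (k - M) (block 0 0 L) *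
    Bq s 0 (M + N - k) (schur M k (zsub s (4 * int M - 2 * int k) L))"
proof -
  let ?p = "par M" and ?t = "minus_q_inv :: ('m, 'n) Uq fps" and ?r = "4 * int M - 2 * int k"
  let ?S = "schur M k (zsub s ?r L)"
  define h where "h = k - M"
  have kM: "M \<le> k" "k \<le> M + N" and kh: "k = M + h" "h \<le> N" using k by (auto simp: M_def N_def h_def)
  obtain X where X: "inverse_on {1..M + N} (twist ?p ?p L) X"
    using Lmat_invertible[where 'm = 'm and 'n = 'n, of "M + N" ?p s] by (auto simp: L_def M_def N_def)
  obtain Y where Y: "inverse_on {1..k} (twist ?p ?p L) Y"
    using Lmat_invertible[where 'm = 'm and 'n = 'n, of k ?p s] k by (auto simp: L_def)
  let ?J = "{k + 1..M + N}"
  have IJ: "{1..k} \<union> ?J = {1..M + N}" "{1..k} \<inter> ?J = {}" using kM by auto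
  define Z where "Z = schur_on {1..k} (twist ?p ?p L) Y"
  have ZX: "inverse_on ?J Z X"
    unfolding Z_def by (rule inverse_on_schur) (use IJ X Y in simp_all)
  have Y_eq: "Y i j = X i j - (\<Sum>b\<in>?J. (\<Sum>a\<in>?J. X i a * Z a b) * X b j)"
    if "i \<in> {1..k}" "j \<in> {1..k}" for i j
    unfolding Z_def by (rule inverse_block_eq) (use IJ X Y that in simp_all)
  let ?B = "\<lambda>p i a. zshift s (2 * int M - 2 * int p) (X (M + a) (M + i))"
  let ?V = "\<lambda>p l. zshift s (2 * int M - 2 * int p) (\<Sum>a\<in>?J. X (M + p) a * Z a (M + l))"
  have shift_sum: "(\<Sum>l = h + 1..N. f (M + l)) = (\<Sum>b\<in>?J. f b)" for f :: "nat \<Rightarrow> ('m, 'n) Uq fps"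
    using sum.shift_bounds_cl_nat_ivl[of f "h + 1" M N] by (simp add: kh add.commute)
  have VB: "(\<Sum>l = h + 1..N. ?V p l * ?B p i l) = zshift s (2 * int M - 2 * int p)
      (\<Sum>b\<in>?J. (\<Sum>a\<in>?J. X (M + p) a * Z a b) * X b (M + i))" for p i
    using shift_sum[of "\<lambda>b. (\<Sum>a\<in>?J. X (M + p) a * Z a b) * X b (M + i)"]
    by (simp flip: zshift_mult zshift_sum)
  have left: "cdet ?t N (\<lambda>j i. ?B j i j) =
      cdet ?t h (\<lambda>j i. ?B j i j - (\<Sum>l = h + 1..N. ?V j l * ?B j i l)) *
      cdet ?t (N - h) (\<lambda>j i. ?B (h + j) (h + i) (h + j))"
  proof (rule cdet_schur_left)
    show "qmanin ?t swap_factor N ?B" unfolding M_def N_def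
      by (rule qmanin_odd_block[OF MN]) (use X in \<open>simp add: L_def M_def N_def\<close>)
    fix p i assume pi: "p \<in> {1..h}" "i \<in> {h + 1..N}"
    have "(\<Sum>b\<in>?J. (\<Sum>a\<in>?J. X (M + p) a * Z a b) * X b (M + i)) =
        (\<Sum>a\<in>?J. X (M + p) a * (\<Sum>b\<in>?J. Z a b * X b (M + i)))"
      by (rule sum_mult_assoc)
    also have "\<dots> = X (M + p) (M + i)"
    proof -
      have i: "M + i \<in> ?J" using pi kh by auto
      have "(\<Sum>a\<in>?J. X (M + p) a * (\<Sum>b\<in>?J. Z a b * X b (M + i))) =
          (\<Sum>a\<in>?J. X (M + p) a * of_bool (a = M + i))"
        by (intro sum.cong HOL.refl) (simp only: inverse_onD(1)[OF ZX _ i])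
      then show ?thesis using i by (simp only: sum_delta_right finite_atLeastAtMost)
    qed
    finally show "(\<Sum>l = h + 1..N. ?V p l * ?B p i l) = ?B p i p" unfolding VB by simp
  qed (use kh in simp)
  have e1: "cdet ?t N (\<lambda>c i. ginv (M + N) ?p (zsub s (2 * int M - 2 * int c) L) (M + c) (M + i)) =
      cdet ?t N (\<lambda>j i. ?B j i j)"
  proof (rule cdet_cong)
    fix c i assume ci: "1 \<le> c" "c \<le> N" "1 \<le> i" "i \<le> N"
    show "ginv (M + N) ?p (zsub s (2 * int M - 2 * int c) L) (M + c) (M + i) = ?B c i c"
      by (rule ginv_zsub[OF X]) (use ci in \<open>auto simp: par_def\<close>)
  qed
  have e2: "cdet ?t h (\<lambda>c i. ginv (M + h) ?p (zsub s (2 * int M - 2 * int c) L) (M + c) (M + i)) =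
      cdet ?t h (\<lambda>j i. ?B j i j - (\<Sum>l = h + 1..N. ?V j l * ?B j i l))"
  proof (rule cdet_cong)
    fix c i assume ci: "1 \<le> c" "c \<le> h" "1 \<le> i" "i \<le> h"
    have "ginv (M + h) ?p (zsub s (2 * int M - 2 * int c) L) (M + c) (M + i) =
        zshift s (2 * int M - 2 * int c) (Y (M + c) (M + i))"
      by (rule ginv_zsub[OF Y[unfolded kh]]) (use ci in \<open>auto simp: par_def\<close>)
    then show "ginv (M + h) ?p (zsub s (2 * int M - 2 * int c) L) (M + c) (M + i) =
        ?B c i c - (\<Sum>l = h + 1..N. ?V c l * ?B c i l)"
      unfolding VB using Y_eq[of "M + c" "M + i"] ci kh by (simp add: zshift_diff)
  qed
  have e3: "cdet ?t (N - h) (\<lambda>c i. ginv (0 + (N - h)) (par 0) (zsub s (2 * int 0 - 2 * int c) ?S) (0 + c) (0 + i)) =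
      cdet ?t (N - h) (\<lambda>j i. ?B (h + j) (h + i) (h + j))"
  proof (rule cdet_cong)
    fix c i assume ci: "1 \<le> c" "c \<le> N - h" "1 \<le> i" "i \<le> N - h"
    let ?a = "2 * int 0 - 2 * int c"
    have "inverse_on {1..M + N - k} (twist (\<lambda>i. par M (k + i)) (\<lambda>i. par M (k + i)) ?S)
        (\<lambda>i j. zshift s ?r (X (k + i) (k + j)))"
      by (rule inverse_on_schur_zsub[OF kM(2) Y X])
    moreover have "twist (\<lambda>i. par M (k + i)) (\<lambda>i. par M (k + i)) ?S i j = twist (par 0) (par 0) ?S i j"
      if "i \<in> {1..M + N - k}" "j \<in> {1..M + N - k}" for i j
      using that kM by (simp add: twist_def par_def)
    ultimately have "inverse_on {1..M + N - k} (twist (par 0) (par 0) ?S) (\<lambda>i j. zshift s ?r (X (k + i) (k + j)))"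
      by (rule inverse_on_cong[THEN iffD1, rotated])
    moreover have "M + N - k = 0 + (N - h)" using kh by simp
    ultimately have "inverse_on {1..0 + (N - h)} (twist (par 0) (par 0) ?S) (\<lambda>i j. zshift s ?r (X (k + i) (k + j)))"
      by simp
    then have "ginv (0 + (N - h)) (par 0) (zsub s ?a ?S) (0 + c) (0 + i) =
        zshift s ?a (zshift s ?r (X (k + (0 + c)) (k + (0 + i))))"
      by (rule ginv_zsub) (use ci in \<open>auto simp: par_def\<close>)
    also have "\<dots> = ?B (h + c) (h + i) (h + c)"
      by (simp add: zshift_zshift kh algebra_simps)
    finally show "ginv (0 + (N - h)) (par 0) (zsub s ?a ?S) (0 + c) (0 + i) = ?B (h + c) (h + i) (h + c)" .
  qed
  have "M + N - k = N - h" using kh by simp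
  then show ?thesis
    unfolding Bq_eq_cdet block_0_0 h_def[symmetric] e1 e2 left
    by (simp only: e3 cdet_0 mult_1 mult.assoc)
qed

theorem theorem4p5:
  fixes L :: "('m::len0, 'n::len0) umat" and M N k :: nat and s :: pm
  assumes "M = LENGTH('m)" and "N = LENGTH('n)" and "M \<noteq> N"
    and "k \<le> M + N"
    and "L = Lmat s"
  shows "(k < M \<longrightarrow>
      Bq s M N L = Bq s k 0 (block 0 0 L) *
        Bq s (M - k) N (schur M k (zsub s (2 * int k) L))) \<and>
    (M \<le> k \<longrightarrow>
      Bq s M N L = Bq s M (k - M) (block 0 0 L) *
        Bq s 0 (M + N - k) (schur M k (zsub s (4 * int M - 2 * int k) L)))"
  using Bq_schur_even[where 'm = 'm and 'n = 'n, of k s] Bq_schur_odd[where 'm = 'm and 'n = 'n, of k s] assms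
  by simp

end
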